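(* Let $G\sim\mathbb{G}(n,p_n)$ be an Erdős–Rényi random graph on vertex set $V_n$, conditioned on the edge $(a,b)$ being present, where $a,b\in V_n$ are fixed, and let $\kappa_n(a,b)$ be the Ricci curvature of the edge $(a,b)$ in $G$. Then: (a) If $np_n\to0$, then with probability $1-o(1)$ the edge $(a,b)$ is isolated, and consequently $\kappa_n(a,b)=0$. (b) If $np_n\to\lambda$ with $0<\lambda<\infty$, then $\kappa_n(a,b)$ converges in distribution to $-2\left(1-\frac{1}{1+X_1}-\frac{1}{1+X_2}\right)_+$, where $X_1,X_2$ are independent Poisson($\lambda$) random variables. (c) If $np_n\to\infty$ and $n^2p_n^3\to0$, then $\kappa_n(a,b)\to-2$ in probability. (d) If $n^2p_n^3\to\infty$ and $np_n^2\to0$, then $\kappa_n(a,b)\to-1$ in probability. (e) If $np_n^2\to\infty$ and $p_n\to0$, then $\kappa_n(a,b)\to0$ in probability. (f) If $p_n\to p$ with $0<p<1$, then $\kappa_n(a,b)\to p$ in probability.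
   Context: $\mathbb{G}(n,p)$ is the random graph on $n$ vertices in which each pair of vertices is an edge independently with probability $p$. For a graph $G$, $d_G$ is the shortest-path metric, $N_G(v)$ the neighbour set and $d_v$ the degree of $v$; $m_v$ is the uniform probability measure on $N_G(v)$, and for an edge $(x,y)$ the Ricci curvature is $\kappa(x,y)=1-W_1(m_x,m_y)$, where $W_1$ is the Wasserstein-1 (transportation) distance with respect to $d_G$. $(t)_+=\max(t,0)$. *)

theory Defs
  imports "HOL-Probability.Probability"
begin

text \<open>Vertex set V_n = {0..<n}; a graph is a predicate on 2-element vertex sets (its edge set).\<close>

definition vpairs :: "nat \<Rightarrow> nat set set" where
  "vpairs n = {{i, j} | i j. i < j \<and> j < n}"

definition gnp :: "nat \<Rightarrow> real \<Rightarrow> (nat set \<Rightarrow> bool) pmf" where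
  "gnp n p = Pi_pmf (vpairs n) False (\<lambda>_. bernoulli_pmf p)"

definition gnp_edge :: "nat \<Rightarrow> real \<Rightarrow> nat \<Rightarrow> nat \<Rightarrow> (nat set \<Rightarrow> bool) pmf" where
  "gnp_edge n p a b = cond_pmf (gnp n p) {G. G {a, b}}"

definition adj :: "(nat set \<Rightarrow> bool) \<Rightarrow> nat \<Rightarrow> nat \<Rightarrow> bool" where
  "adj G x y \<longleftrightarrow> x \<noteq> y \<and> G {x, y}"

definition nbrs :: "nat \<Rightarrow> (nat set \<Rightarrow> bool) \<Rightarrow> nat \<Rightarrow> nat set" where
  "nbrs n G x = {y. y < n \<and> adj G x y}"

definition walk :: "nat \<Rightarrow> (nat set \<Rightarrow> bool) \<Rightarrow> nat list \<Rightarrow> bool" where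
  "walk n G xs \<longleftrightarrow> xs \<noteq> [] \<and> set xs \<subseteq> {..<n} \<and>
     (\<forall>i. Suc i < length xs \<longrightarrow> adj G (xs ! i) (xs ! Suc i))"

text \<open>Shortest-path distance (infinite if no path).\<close>
definition gdist :: "nat \<Rightarrow> (nat set \<Rightarrow> bool) \<Rightarrow> nat \<Rightarrow> nat \<Rightarrow> enat" where
  "gdist n G x y = (INF xs \<in> {xs. walk n G xs \<and> hd xs = x \<and> last xs = y}. enat (length xs - 1))"

definition unif_nbr :: "nat \<Rightarrow> (nat set \<Rightarrow> bool) \<Rightarrow> nat \<Rightarrow> nat \<Rightarrow> real" where
  "unif_nbr n G x u = (if u \<in> nbrs n G x then 1 / real (card (nbrs n G x)) else 0)"

definition coupling :: "nat \<Rightarrow> (nat \<Rightarrow> real) \<Rightarrow> (nat \<Rightarrow> real) \<Rightarrow> (nat \<Rightarrow> nat \<Rightarrow> real) \<Rightarrow> bool" where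
  "coupling n \<mu> \<nu> \<pi> \<longleftrightarrow> (\<forall>u v. 0 \<le> \<pi> u v) \<and> (\<forall>u v. (n \<le> u \<or> n \<le> v) \<longrightarrow> \<pi> u v = 0) \<and>
     (\<forall>u<n. (\<Sum>v<n. \<pi> u v) = \<mu> u) \<and> (\<forall>v<n. (\<Sum>u<n. \<pi> u v) = \<nu> v)"

definition W1 :: "nat \<Rightarrow> (nat set \<Rightarrow> bool) \<Rightarrow> (nat \<Rightarrow> real) \<Rightarrow> (nat \<Rightarrow> real) \<Rightarrow> ereal" where
  "W1 n G \<mu> \<nu> = (INF \<pi> \<in> {\<pi>. coupling n \<mu> \<nu> \<pi>}.
      \<Sum>u<n. \<Sum>v<n. ereal (\<pi> u v) * ereal_of_enat (gdist n G u v))"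

definition ricci :: "nat \<Rightarrow> (nat set \<Rightarrow> bool) \<Rightarrow> nat \<Rightarrow> nat \<Rightarrow> real" where
  "ricci n G x y = 1 - real_of_ereal (W1 n G (unif_nbr n G x) (unif_nbr n G y))"

definition isolated_edge :: "nat \<Rightarrow> (nat set \<Rightarrow> bool) \<Rightarrow> nat \<Rightarrow> nat \<Rightarrow> bool" where
  "isolated_edge n G a b \<longleftrightarrow> nbrs n G a = {b} \<and> nbrs n G b = {a}"

definition poisson_limit :: "nat \<times> nat \<Rightarrow> real" where
  "poisson_limit k = -2 * max 0 (1 - 1 / (1 + real (fst k)) - 1 / (1 + real (snd k)))"

definition conv_in_prob :: "(nat \<Rightarrow> 'a pmf) \<Rightarrow> (nat \<Rightarrow> 'a \<Rightarrow> real) \<Rightarrow> real \<Rightarrow> bool" where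
  "conv_in_prob M X c \<longleftrightarrow>
     (\<forall>e>0. (\<lambda>n. measure_pmf.prob (M n) {G. \<bar>X n G - c\<bar> > e}) \<longlonglongrightarrow> 0)"

end

theory Submission
  imports Defs
begin

text \<open>All distances between neighbours of \<open>a\<close> and neighbours of \<open>b\<close> are at most 3, so the Wasserstein
distance is bounded below by showing that most such pairs are far apart (weak duality) and above by an
explicit transport plan. Write \<open>D = n p\<close>. The expected number of neighbours of \<open>a\<close> within distance 2 of a
further neighbour of \<open>b\<close> is at most \<open>n p\<^sup>2 + 2 n\<^sup>2 p\<^sup>3 + n\<^sup>3 p\<^sup>4\<close>: if this tends to 0, the edge looks like
an edge of a tree, where the curvature is a function of the two (independent, asymptotically Poisson)
degrees; if it is \<open>o(D)\<close>, the curvature tends to \<open>-2\<close>. Beyond that threshold mass can be spread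
evenly over the paths of length 2, and, once \<open>n p\<^sup>2\<close> is large, over the edges between the two
neighbourhoods. A second-moment computation shows that the marginals of these plans deviate from the
uniform ones by \<open>o(1)\<close> in expectation, so a small correction turns them into couplings. The
convergences in probability thus even hold in \<open>L\<^sup>1\<close>.\<close>

section \<open>Transport between the neighbourhoods of an edge\<close>

text \<open>The obstacle is that both neighbourhoods are random, so an exact coupling must meet
  random marginals and would lead to matchings in a random bipartite graph. Fractional plans avoid
  this: they are written with the deterministic weight \<open>1 / D\<close> in place of both
  marginals. Outside the tree-like case, each bound on the curvature holds for every graph
  containing the edge and is linear in a few nonnegative error terms, so taking expectations needs
  neither a good event nor estimates uniform over vertices. The thresholds count targets: a given
  neighbour of \<open>a\<close> reaches about \<open>n p^2\<close> neighbours of \<open>b\<close>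
  along edges and about \<open>n^2 p^3\<close> along paths of length 2, and such a count must
  diverge for its relative variance to vanish. Common neighbours form a fraction of about
  \<open>p\<close> of all neighbours; hence the regimes with large \<open>n p^2\<close> are treated
  together, with the deviation measured from \<open>p\<close> itself.\<close>

lemma adj_commute: "adj G x y = adj G y x"
  by (auto simp: adj_def insert_commute)

lemma finite_nbrs [simp]: "finite (nbrs n G x)"
  by (simp add: nbrs_def)

lemma walk_simps [simp]:
  "\<not> walk n G []"
  "walk n G [x] \<longleftrightarrow> x < n"
  "walk n G (x # y # xs) \<longleftrightarrow> x < n \<and> adj G x y \<and> walk n G (y # xs)"
  by (auto simp: walk_def nth_Cons less_Suc_eq_0_disj split: nat.splits)

lemma gdist_le_walk: "walk n G xs \<Longrightarrow> gdist n G (hd xs) (last xs) \<le> enat (length xs - 1)"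
  unfolding gdist_def by (rule INF_lower) simp

lemma gdist_le_0: "x < n \<Longrightarrow> gdist n G x x \<le> enat 0"
  using gdist_le_walk[of n G "[x]"] by simp

lemma gdist_le_1: "x < n \<Longrightarrow> y < n \<Longrightarrow> adj G x y \<Longrightarrow> gdist n G x y \<le> enat 1"
  using gdist_le_walk[of n G "[x, y]"] by simp

lemma gdist_le_2:
  "x < n \<Longrightarrow> z < n \<Longrightarrow> y < n \<Longrightarrow> adj G x z \<Longrightarrow> adj G z y \<Longrightarrow> gdist n G x y \<le> enat 2"
  using gdist_le_walk[of n G "[x, z, y]"] by (simp add: numeral_2_eq_2)

lemma gdist_nbrs_le_3:
  assumes "a < n" "b < n" "adj G a b" "u \<in> nbrs n G a" "v \<in> nbrs n G b"
  shows "gdist n G u v \<le> enat 3"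
  using gdist_le_walk[of n G "[u, a, b, v]"] assms
  by (simp add: numeral_3_eq_3 nbrs_def adj_commute)

lemma gdist_geI:
  assumes "\<And>xs. walk n G xs \<Longrightarrow> hd xs = x \<Longrightarrow> last xs = y \<Longrightarrow> k \<le> length xs - 1"
  shows "enat k \<le> gdist n G x y"
  unfolding gdist_def using assms by (intro INF_greatest) auto

lemma gdist_ge_1: "x \<noteq> y \<Longrightarrow> enat 1 \<le> gdist n G x y"
proof (rule gdist_geI)
  fix xs assume "x \<noteq> y" "walk n G xs" "hd xs = x" "last xs = y"
  then show "1 \<le> length xs - 1"
    by (cases xs rule: remdups_adj.cases) auto
qed

lemma gdist_ge_2: "x \<noteq> y \<Longrightarrow> \<not> adj G x y \<Longrightarrow> enat 2 \<le> gdist n G x y"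
proof (rule gdist_geI)
  fix xs assume *: "x \<noteq> y" "\<not> adj G x y" "walk n G xs" "hd xs = x" "last xs = y"
  then obtain u v ws where xs: "xs = u # v # ws"
    by (cases xs rule: remdups_adj.cases) auto
  with * show "2 \<le> length xs - 1"
    by (cases ws) auto
qed

lemma gdist_ge_3:
  assumes "x \<noteq> y" "\<not> adj G x y" "\<And>z. z < n \<Longrightarrow> adj G x z \<Longrightarrow> adj G z y \<Longrightarrow> False"
  shows "enat 3 \<le> gdist n G x y"
proof (rule gdist_geI)
  fix xs assume *: "walk n G xs" "hd xs = x" "last xs = y"
  with assms(1) obtain u v ws where xs: "xs = u # v # ws"
    by (cases xs rule: remdups_adj.cases) auto
  with * assms(2) obtain w ws' where ws: "ws = w # ws'"
    by (cases ws) auto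
  show "3 \<le> length xs - 1"
    using * assms(3)[of v] xs ws by (cases ws') auto
qed

text \<open>Meaningful only where \<open>gdist\<close> is finite; elsewhere the value is an
  unspecified natural number. Couplings charge only pairs at distance at most 3, so costs can be
  computed in the reals. The upper bound in \<open>gdist_real_ge\<close> serves to exclude the
  infinite case.\<close>

definition gdist_real :: "nat \<Rightarrow> (nat set \<Rightarrow> bool) \<Rightarrow> nat \<Rightarrow> nat \<Rightarrow> real" where
  "gdist_real n G u v = real (the_enat (gdist n G u v))"

lemma gdist_real_le: "gdist n G u v \<le> enat k \<Longrightarrow> gdist_real n G u v \<le> real k"
  by (cases "gdist n G u v") (auto simp: gdist_real_def)

lemma gdist_real_ge: "enat k \<le> gdist n G u v \<Longrightarrow> gdist n G u v \<le> enat l \<Longrightarrow> real k \<le> gdist_real n G u v"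
  by (cases "gdist n G u v") (auto simp: gdist_real_def)

lemma gdist_real_nonneg: "0 \<le> gdist_real n G u v"
  by (simp add: gdist_real_def)

lemma ereal_of_enat_gdist:
  "gdist n G u v \<le> enat k \<Longrightarrow> ereal_of_enat (gdist n G u v) = ereal (gdist_real n G u v)"
  by (cases "gdist n G u v") (auto simp: gdist_real_def)

section \<open>Couplings of the two neighbour measures in a fixed graph: dual bounds and explicit
  plans\<close>

locale graph_edge =
  fixes n :: nat and G :: "nat set \<Rightarrow> bool" and a b :: nat
  assumes a_less: "a < n" and b_less: "b < n" and adj_ab: "adj G a b"
begin

abbreviation Na where "Na \<equiv> nbrs n G a"
abbreviation Nb where "Nb \<equiv> nbrs n G b"
abbreviation da where "da \<equiv> real (card Na)"
abbreviation db where "db \<equiv> real (card Nb)"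

lemma b_in_Na: "b \<in> Na" and a_in_Nb: "a \<in> Nb"
  using a_less b_less adj_ab by (auto simp: nbrs_def adj_commute)

lemma a_notin_Na: "a \<notin> Na" and b_notin_Nb: "b \<notin> Nb"
  by (auto simp: nbrs_def adj_def)

lemma a_neq_b: "a \<noteq> b" using adj_ab by (auto simp: adj_def)

lemma da_ge_1: "1 \<le> da" and db_ge_1: "1 \<le> db"
  using b_in_Na a_in_Nb card_gt_0_iff[of Na] card_gt_0_iff[of Nb] by force+

lemma Na_less: "Na \<subseteq> {..<n}" and Nb_less: "Nb \<subseteq> {..<n}"
  by (auto simp: nbrs_def)

lemma gdist_le_3: "u \<in> Na \<Longrightarrow> v \<in> Nb \<Longrightarrow> gdist n G u v \<le> enat 3"
  using gdist_nbrs_le_3 a_less b_less adj_ab by blast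

context
  fixes \<pi>
  assumes cp: "coupling n (unif_nbr n G a) (unif_nbr n G b) \<pi>"
begin

lemma coupling_nonneg: "0 \<le> \<pi> u v"
  using cp by (simp add: coupling_def)

text \<open>A row or column with zero marginal consists of nonnegative entries summing to 0.\<close>

lemma coupling_outside: "u \<notin> Na \<or> v \<notin> Nb \<Longrightarrow> \<pi> u v = 0"
proof (cases "u < n \<and> v < n")
  case True
  assume "u \<notin> Na \<or> v \<notin> Nb"
  then show ?thesis
  proof
    assume "u \<notin> Na"
    then have "(\<Sum>v<n. \<pi> u v) = 0" using True cp by (simp add: coupling_def unif_nbr_def)
    then show ?thesis using True coupling_nonneg by (subst (asm) sum_nonneg_eq_0_iff) auto
  next
    assume "v \<notin> Nb"
    then have "(\<Sum>u<n. \<pi> u v) = 0" using True cp by (simp add: coupling_def unif_nbr_def)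
    then show ?thesis using True coupling_nonneg by (subst (asm) sum_nonneg_eq_0_iff) auto
  qed
next
  case False
  then show ?thesis using cp by (auto simp: coupling_def not_less)
qed

lemma coupling_row: "u \<in> Na \<Longrightarrow> (\<Sum>v\<in>Nb. \<pi> u v) = 1 / da"
proof -
  assume u: "u \<in> Na"
  have "(\<Sum>v\<in>Nb. \<pi> u v) = (\<Sum>v<n. \<pi> u v)"
    using Nb_less coupling_outside by (intro sum.mono_neutral_left) auto
  then show ?thesis using u cp Na_less by (auto simp: coupling_def unif_nbr_def)
qed

lemma coupling_col: "v \<in> Nb \<Longrightarrow> (\<Sum>u\<in>Na. \<pi> u v) = 1 / db"
proof -
  assume u: "v \<in> Nb"
  have "(\<Sum>u\<in>Na. \<pi> u v) = (\<Sum>u<n. \<pi> u v)"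
    using Na_less coupling_outside by (intro sum.mono_neutral_left) auto
  then show ?thesis using u cp Nb_less by (auto simp: coupling_def unif_nbr_def)
qed

lemma coupling_cost:
  "(\<Sum>u<n. \<Sum>v<n. ereal (\<pi> u v) * ereal_of_enat (gdist n G u v)) =
     ereal (\<Sum>u\<in>Na. \<Sum>v\<in>Nb. \<pi> u v * gdist_real n G u v)"
proof -
  have "(\<Sum>u<n. \<Sum>v<n. ereal (\<pi> u v) * ereal_of_enat (gdist n G u v)) =
        (\<Sum>u\<in>Na. \<Sum>v<n. ereal (\<pi> u v) * ereal_of_enat (gdist n G u v))"
    using Na_less coupling_outside by (intro sum.mono_neutral_right) (auto simp flip: zero_ereal_def)
  also have "\<dots> = (\<Sum>u\<in>Na. \<Sum>v\<in>Nb. ereal (\<pi> u v) * ereal_of_enat (gdist n G u v))"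
    using Nb_less coupling_outside
    by (intro sum.cong refl sum.mono_neutral_right) (auto simp flip: zero_ereal_def)
  also have "\<dots> = (\<Sum>u\<in>Na. \<Sum>v\<in>Nb. ereal (\<pi> u v * gdist_real n G u v))"
    by (intro sum.cong refl) (simp add: ereal_of_enat_gdist[OF gdist_le_3])
  finally show ?thesis by simp
qed

end

text \<open>Weak duality with two separate potentials rather than one Lipschitz function: the
  constraint is then required only on \<open>Na\<close> times \<open>Nb\<close>, so distances
  between other vertices, which may be infinite, never enter.\<close>

lemma W1_ge:
  assumes "\<And>u v. u \<in> Na \<Longrightarrow> v \<in> Nb \<Longrightarrow> f u + g v \<le> gdist_real n G u v"
  shows "ereal ((\<Sum>u\<in>Na. f u) / da + (\<Sum>v\<in>Nb. g v) / db) \<le> W1 n G (unif_nbr n G a) (unif_nbr n G b)"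
  unfolding W1_def
proof (rule INF_greatest)
  fix \<pi> assume "\<pi> \<in> {\<pi>. coupling n (unif_nbr n G a) (unif_nbr n G b) \<pi>}"
  then have cp: "coupling n (unif_nbr n G a) (unif_nbr n G b) \<pi>" by simp
  have "(\<Sum>u\<in>Na. f u) / da + (\<Sum>v\<in>Nb. g v) / db
      = (\<Sum>u\<in>Na. f u * (\<Sum>v\<in>Nb. \<pi> u v)) + (\<Sum>v\<in>Nb. g v * (\<Sum>u\<in>Na. \<pi> u v))"
    by (simp add: coupling_row[OF cp] coupling_col[OF cp] sum_divide_distrib)
  also have "(\<Sum>v\<in>Nb. g v * (\<Sum>u\<in>Na. \<pi> u v)) = (\<Sum>u\<in>Na. \<Sum>v\<in>Nb. g v * \<pi> u v)"
    by (simp add: sum_distrib_left sum.swap[of _ Na])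
  also have "(\<Sum>u\<in>Na. f u * (\<Sum>v\<in>Nb. \<pi> u v)) + \<dots> = (\<Sum>u\<in>Na. \<Sum>v\<in>Nb. \<pi> u v * (f u + g v))"
    by (simp add: sum_distrib_left sum.distrib algebra_simps)
  also have "\<dots> \<le> (\<Sum>u\<in>Na. \<Sum>v\<in>Nb. \<pi> u v * gdist_real n G u v)"
    by (intro sum_mono mult_left_mono assms coupling_nonneg[OF cp])
  finally show "ereal ((\<Sum>u\<in>Na. f u) / da + (\<Sum>v\<in>Nb. g v) / db)
      \<le> (\<Sum>u<n. \<Sum>v<n. ereal (\<pi> u v) * ereal_of_enat (gdist n G u v))"
    by (simp add: coupling_cost[OF cp])
qed

text \<open>The mass missing from a subcoupling is transported by the product of the residual marginals,
  at distance at most 3. If nothing is missing, the residuals vanish and so does their quotient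
  by \<open>1 - m = 0\<close>.\<close>

lemma W1_le_subcoupling:
  assumes nonneg: "\<And>u v. 0 \<le> w u v"
    and row: "\<And>u. u \<in> Na \<Longrightarrow> (\<Sum>v\<in>Nb. w u v) \<le> 1 / da"
    and col: "\<And>v. v \<in> Nb \<Longrightarrow> (\<Sum>u\<in>Na. w u v) \<le> 1 / db"
  shows "W1 n G (unif_nbr n G a) (unif_nbr n G b) \<le>
    ereal ((\<Sum>u\<in>Na. \<Sum>v\<in>Nb. w u v * gdist_real n G u v) + 3 * (1 - (\<Sum>u\<in>Na. \<Sum>v\<in>Nb. w u v)))"
proof -
  define r where "r u = (\<Sum>v\<in>Nb. w u v)" for u
  define c where "c v = (\<Sum>u\<in>Na. w u v)" for v
  define m where "m = (\<Sum>u\<in>Na. \<Sum>v\<in>Nb. w u v)"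
  have mr: "m = (\<Sum>u\<in>Na. r u)" by (simp add: m_def r_def)
  have mc: "m = (\<Sum>v\<in>Nb. c v)" unfolding m_def c_def by (rule sum.swap)
  have r1: "(\<Sum>u\<in>Na. 1 / da - r u) = 1 - m" using b_in_Na by (auto simp: mr sum_subtractf)
  have c1: "(\<Sum>v\<in>Nb. 1 / db - c v) = 1 - m" using a_in_Nb by (auto simp: mc sum_subtractf)
  have r_le: "u \<in> Na \<Longrightarrow> 0 \<le> 1 / da - r u" for u using row by (simp add: r_def)
  have c_le: "v \<in> Nb \<Longrightarrow> 0 \<le> 1 / db - c v" for v using col by (simp add: c_def)
  have m1: "0 \<le> 1 - m" unfolding r1[symmetric] by (rule sum_nonneg) (rule r_le)
  define \<rho> where "\<rho> u v = (1 / da - r u) * (1 / db - c v) / (1 - m)" for u v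
  have \<rho>_nonneg: "0 \<le> \<rho> u v" if "u \<in> Na" "v \<in> Nb" for u v
    unfolding \<rho>_def by (intro divide_nonneg_nonneg mult_nonneg_nonneg r_le c_le that m1)
  define \<pi> where "\<pi> u v = (if u \<in> Na \<and> v \<in> Nb then w u v + \<rho> u v else 0)" for u v
  have \<rho>_row: "(\<Sum>v\<in>Nb. \<rho> u v) = 1 / da - r u" if u: "u \<in> Na" for u
  proof (cases "m = 1")
    case True
    then have "1 / da - r u = 0" using r1 r_le u by (simp add: sum_nonneg_eq_0_iff)
    then show ?thesis by (simp add: \<rho>_def)
  next
    case False
    have "(\<Sum>v\<in>Nb. \<rho> u v) = (1 / da - r u) * (\<Sum>v\<in>Nb. 1 / db - c v) / (1 - m)"
      by (simp only: \<rho>_def sum_divide_distrib sum_distrib_left)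
    with False show ?thesis unfolding c1 by simp
  qed
  have \<rho>_col: "(\<Sum>u\<in>Na. \<rho> u v) = 1 / db - c v" if v: "v \<in> Nb" for v
  proof (cases "m = 1")
    case True
    then have "1 / db - c v = 0" using c1 c_le v by (simp add: sum_nonneg_eq_0_iff)
    then show ?thesis by (simp add: \<rho>_def)
  next
    case False
    have "(\<Sum>u\<in>Na. \<rho> u v) = (\<Sum>u\<in>Na. 1 / da - r u) * (1 / db - c v) / (1 - m)"
      by (simp only: \<rho>_def sum_divide_distrib sum_distrib_right)
    with False show ?thesis unfolding r1 by simp
  qed
  have cp: "coupling n (unif_nbr n G a) (unif_nbr n G b) \<pi>"
    unfolding coupling_def
  proof (intro conjI allI impI)
    show "0 \<le> \<pi> u v" for u v using nonneg \<rho>_nonneg by (auto simp: \<pi>_def)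
    show "\<pi> u v = 0" if "n \<le> u \<or> n \<le> v" for u v
      using that Na_less Nb_less by (auto simp: \<pi>_def)
    show "(\<Sum>v<n. \<pi> u v) = unif_nbr n G a u" for u
    proof (cases "u \<in> Na")
      case True
      have "(\<Sum>v<n. \<pi> u v) = (\<Sum>v\<in>Nb. w u v + \<rho> u v)"
        using Nb_less True by (intro sum.mono_neutral_cong_right) (auto simp: \<pi>_def)
      then show ?thesis using True by (simp add: sum.distrib \<rho>_row unif_nbr_def flip: r_def)
    qed (simp add: \<pi>_def unif_nbr_def)
    show "(\<Sum>u<n. \<pi> u v) = unif_nbr n G b v" for v
    proof (cases "v \<in> Nb")
      case True
      have "(\<Sum>u<n. \<pi> u v) = (\<Sum>u\<in>Na. w u v + \<rho> u v)"
        using Na_less True by (intro sum.mono_neutral_cong_right) (auto simp: \<pi>_def)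
      then show ?thesis using True by (simp add: sum.distrib \<rho>_col unif_nbr_def flip: c_def)
    qed (simp add: \<pi>_def unif_nbr_def)
  qed
  have "W1 n G (unif_nbr n G a) (unif_nbr n G b) \<le> ereal (\<Sum>u\<in>Na. \<Sum>v\<in>Nb. \<pi> u v * gdist_real n G u v)"
    unfolding W1_def coupling_cost[OF cp, symmetric] by (rule INF_lower) (simp add: cp)
  also have "\<dots> \<le> ereal (\<Sum>u\<in>Na. \<Sum>v\<in>Nb. w u v * gdist_real n G u v + \<rho> u v * 3)"
    unfolding ereal_less_eq
  proof (intro sum_mono)
    fix u v assume uv: "u \<in> Na" "v \<in> Nb"
    show "\<pi> u v * gdist_real n G u v \<le> w u v * gdist_real n G u v + \<rho> u v * 3"
      using mult_left_mono[OF gdist_real_le[OF gdist_le_3[OF uv]] \<rho>_nonneg[OF uv]] uv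
      by (simp add: \<pi>_def distrib_right)
  qed
  also have "(\<Sum>u\<in>Na. \<Sum>v\<in>Nb. w u v * gdist_real n G u v + \<rho> u v * 3) =
      (\<Sum>u\<in>Na. \<Sum>v\<in>Nb. w u v * gdist_real n G u v) + 3 * (\<Sum>u\<in>Na. \<Sum>v\<in>Nb. \<rho> u v)"
    by (simp add: sum.distrib sum_distrib_left mult.commute)
  also have "(\<Sum>u\<in>Na. \<Sum>v\<in>Nb. \<rho> u v) = 1 - m"
    using r1 by (simp add: \<rho>_row cong: sum.cong)
  finally show ?thesis by (simp add: m_def)
qed

lemma ricci_ge_subcoupling:
  assumes "\<And>u v. 0 \<le> w u v"
    and "\<And>u. u \<in> Na \<Longrightarrow> (\<Sum>v\<in>Nb. w u v) \<le> 1 / da"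
    and "\<And>v. v \<in> Nb \<Longrightarrow> (\<Sum>u\<in>Na. w u v) \<le> 1 / db"
  shows "1 - ((\<Sum>u\<in>Na. \<Sum>v\<in>Nb. w u v * gdist_real n G u v) + 3 * (1 - (\<Sum>u\<in>Na. \<Sum>v\<in>Nb. w u v)))
     \<le> ricci n G a b"
proof -
  \<comment> \<open>\<open>real_of_ereal\<close> sends both infinities to 0, so \<open>W1\<close>
    must be known to be finite before a bound on it says anything about the curvature.\<close>
  have "0 \<le> W1 n G (unif_nbr n G a) (unif_nbr n G b)"
    using W1_ge[of "\<lambda>_. 0" "\<lambda>_. 0"] by (simp add: gdist_real_nonneg flip: zero_ereal_def)
  then show ?thesis
    using W1_le_subcoupling[OF assms] unfolding ricci_def
    by (cases "W1 n G (unif_nbr n G a) (unif_nbr n G b)") auto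
qed

text \<open>The zero subcoupling leaves all mass to be moved at distance at most 3, whence
  \<open>1 - 3\<close>.\<close>

lemma ricci_ge: "- 2 \<le> ricci n G a b"
  using ricci_ge_subcoupling[of "\<lambda>_ _. 0"] da_ge_1 db_ge_1 by simp

lemma ricci_le:
  assumes "\<And>u v. u \<in> Na \<Longrightarrow> v \<in> Nb \<Longrightarrow> f u + g v \<le> gdist_real n G u v"
  shows "ricci n G a b \<le> 1 - ((\<Sum>u\<in>Na. f u) / da + (\<Sum>v\<in>Nb. g v) / db)"
proof -
  \<comment> \<open>Again only finiteness is wanted, this time from above.\<close>
  have "W1 n G (unif_nbr n G a) (unif_nbr n G b) \<le> ereal 3"
    using W1_le_subcoupling[of "\<lambda>_ _. 0"] da_ge_1 db_ge_1 by simp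
  then show ?thesis
    using W1_ge[OF assms] unfolding ricci_def
    by (cases "W1 n G (unif_nbr n G a) (unif_nbr n G b)") auto
qed

text \<open>A plan whose marginals are only nearly uniform becomes a subcoupling when each entry is divided by
  the relative excess of its row and of its column; this costs no more mass than the total deviation of
  the marginals.\<close>

lemma ricci_ge_approx_coupling:
  assumes nonneg: "\<And>u v. 0 \<le> w u v" and D: "0 < D"
  shows "1 - (\<Sum>u\<in>Na. \<Sum>v\<in>Nb. w u v * gdist_real n G u v)
      - 3 * ((\<Sum>u\<in>Na. \<bar>(\<Sum>v\<in>Nb. w u v) - 1 / D\<bar>) + (\<Sum>v\<in>Nb. \<bar>(\<Sum>u\<in>Na. w u v) - 1 / D\<bar>)
             + \<bar>da / D - 1\<bar> + \<bar>db / D - 1\<bar>)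
    \<le> ricci n G a b"
proof -
  define r where "r u = (\<Sum>v\<in>Nb. w u v)" for u
  define c where "c v = (\<Sum>u\<in>Na. w u v)" for v
  define s where "s u = max 1 (da * r u)" for u
  define t where "t v = max 1 (db * c v)" for v
  define m where "m = (\<Sum>u\<in>Na. \<Sum>v\<in>Nb. w u v)"
  have mc: "m = (\<Sum>v\<in>Nb. c v)" unfolding m_def c_def by (rule sum.swap)
  have s1: "1 \<le> s u" and t1: "1 \<le> t v" for u v by (auto simp: s_def t_def)
  have r0: "0 \<le> r u" and c0: "0 \<le> c v" for u v by (auto simp: r_def c_def intro: sum_nonneg nonneg)
  define w' where "w' u v = w u v / (s u * t v)" for u v
  have w'_nonneg: "0 \<le> w' u v" for u v
    using nonneg s1[of u] t1[of v] by (simp add: w'_def)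
  have w'_le_s: "w' u v \<le> w u v / s u" and w'_le_t: "w' u v \<le> w u v / t v" for u v
    unfolding w'_def using nonneg[of u v] s1[of u] t1[of v]
    by (auto intro!: divide_left_mono)
  have w'_le: "w' u v \<le> w u v" for u v
    using w'_le_s[of u v] nonneg[of u v] s1[of u]
    by (smt (verit) div_by_1 frac_le)
  \<comment> \<open>Rescaling a row by its excess cuts it down to the permitted sum and leaves
    smaller rows alone; the same holds for columns.\<close>
  have rs: "r u / s u = min (r u) (1 / da)" for u
    using da_ge_1 r0[of u] by (auto simp: s_def min_def max_def field_simps)
  have ct: "c v / t v = min (c v) (1 / db)" for v
    using db_ge_1 c0[of v] by (auto simp: t_def min_def max_def field_simps)
  have row: "(\<Sum>v\<in>Nb. w' u v) \<le> 1 / da" for u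
  proof -
    have "(\<Sum>v\<in>Nb. w' u v) \<le> (\<Sum>v\<in>Nb. w u v / s u)" by (rule sum_mono) (rule w'_le_s)
    also have "\<dots> = r u / s u" by (simp add: r_def sum_divide_distrib)
    finally show ?thesis by (simp add: rs)
  qed
  have col: "(\<Sum>u\<in>Na. w' u v) \<le> 1 / db" for v
  proof -
    have "(\<Sum>u\<in>Na. w' u v) \<le> (\<Sum>u\<in>Na. w u v / t v)" by (rule sum_mono) (rule w'_le_t)
    also have "\<dots> = c v / t v" by (simp add: c_def sum_divide_distrib)
    finally show ?thesis by (simp add: ct)
  qed
  \<comment> \<open>Since \<open>(1 - 1/s) (1 - 1/t) \<ge> 0\<close>, one has
    \<open>1/(s t) \<ge> 1/s + 1/t - 1\<close>: the row loss and the column loss add up instead of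
    interacting.\<close>
  have w'_ge: "w u v / s u + w u v / t v - w u v \<le> w' u v" for u v
  proof -
    have "0 \<le> w u v * ((1 - 1 / s u) * (1 - 1 / t v))"
      using nonneg s1[of u] t1[of v] by (intro mult_nonneg_nonneg) (auto simp: field_simps)
    also have "\<dots> = w' u v - (w u v / s u + w u v / t v - w u v)"
      by (simp add: w'_def algebra_simps)
    finally show ?thesis by simp
  qed
  have "(\<Sum>u\<in>Na. \<Sum>v\<in>Nb. w u v / s u + w u v / t v - w u v) \<le> (\<Sum>u\<in>Na. \<Sum>v\<in>Nb. w' u v)"
    by (intro sum_mono w'_ge)
  moreover have "(\<Sum>u\<in>Na. \<Sum>v\<in>Nb. w u v / s u + w u v / t v - w u v) =
      (\<Sum>u\<in>Na. \<Sum>v\<in>Nb. w u v / s u) + (\<Sum>u\<in>Na. \<Sum>v\<in>Nb. w u v / t v) - m"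
    by (simp add: sum.distrib sum_subtractf m_def)
  moreover have "(\<Sum>u\<in>Na. \<Sum>v\<in>Nb. w u v / s u) = (\<Sum>u\<in>Na. r u / s u)"
    by (simp add: r_def sum_divide_distrib)
  moreover have "(\<Sum>u\<in>Na. \<Sum>v\<in>Nb. w u v / t v) = (\<Sum>v\<in>Nb. c v / t v)"
    by (subst sum.swap) (simp add: c_def sum_divide_distrib)
  \<comment> \<open>Rows are compared with the target \<open>1 / da\<close>, whose total is 1, but
    columns with their own mass \<open>c v\<close>, whose total \<open>m\<close> cancels the
    \<open>- m\<close> above.\<close>
  moreover have "(\<Sum>u\<in>Na. 1 / da - \<bar>r u - 1 / da\<bar>) \<le> (\<Sum>u\<in>Na. r u / s u)"
    unfolding rs by (intro sum_mono) (auto simp: min_def)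
  moreover have "(\<Sum>u\<in>Na. 1 / da - \<bar>r u - 1 / da\<bar>) = 1 - (\<Sum>u\<in>Na. \<bar>r u - 1 / da\<bar>)"
    using b_in_Na by (auto simp: sum_subtractf)
  moreover have "(\<Sum>v\<in>Nb. c v - \<bar>c v - 1 / db\<bar>) \<le> (\<Sum>v\<in>Nb. c v / t v)"
    unfolding ct by (intro sum_mono) (auto simp: min_def)
  moreover have "(\<Sum>v\<in>Nb. c v - \<bar>c v - 1 / db\<bar>) = m - (\<Sum>v\<in>Nb. \<bar>c v - 1 / db\<bar>)"
    by (auto simp: sum_subtractf mc)
  ultimately have mass: "1 - (\<Sum>u\<in>Na. \<bar>r u - 1 / da\<bar>) - (\<Sum>v\<in>Nb. \<bar>c v - 1 / db\<bar>)
      \<le> (\<Sum>u\<in>Na. \<Sum>v\<in>Nb. w' u v)" by linarith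
  \<comment> \<open>Replacing the random target \<open>1 / da\<close> by \<open>1 / D\<close> costs
    \<open>\<bar>1 / D - 1 / da\<bar>\<close> for each of \<open>da\<close> rows, in total
    \<open>\<bar>da / D - 1\<bar>\<close>.\<close>
  have "(\<Sum>u\<in>Na. \<bar>r u - 1 / da\<bar>) \<le> (\<Sum>u\<in>Na. \<bar>r u - 1 / D\<bar> + \<bar>1 / D - 1 / da\<bar>)"
    by (intro sum_mono) linarith
  also have "\<dots> = (\<Sum>u\<in>Na. \<bar>r u - 1 / D\<bar>) + da * \<bar>1 / D - 1 / da\<bar>"
    by (simp add: sum.distrib)
  also have "da * \<bar>1 / D - 1 / da\<bar> = \<bar>da / D - 1\<bar>"
  proof -
    have "da * (1 / D - 1 / da) = da / D - 1" using b_in_Na by (auto simp: right_diff_distrib)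
    then show ?thesis by (metis abs_mult abs_of_nat)
  qed
  finally have ea: "(\<Sum>u\<in>Na. \<bar>r u - 1 / da\<bar>) \<le> (\<Sum>u\<in>Na. \<bar>r u - 1 / D\<bar>) + \<bar>da / D - 1\<bar>" .
  have "(\<Sum>v\<in>Nb. \<bar>c v - 1 / db\<bar>) \<le> (\<Sum>v\<in>Nb. \<bar>c v - 1 / D\<bar> + \<bar>1 / D - 1 / db\<bar>)"
    by (intro sum_mono) linarith
  also have "\<dots> = (\<Sum>v\<in>Nb. \<bar>c v - 1 / D\<bar>) + db * \<bar>1 / D - 1 / db\<bar>"
    by (simp add: sum.distrib)
  also have "db * \<bar>1 / D - 1 / db\<bar> = \<bar>db / D - 1\<bar>"
  proof -
    have "db * (1 / D - 1 / db) = db / D - 1" using a_in_Nb by (auto simp: right_diff_distrib)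
    then show ?thesis by (metis abs_mult abs_of_nat)
  qed
  finally have eb: "(\<Sum>v\<in>Nb. \<bar>c v - 1 / db\<bar>) \<le> (\<Sum>v\<in>Nb. \<bar>c v - 1 / D\<bar>) + \<bar>db / D - 1\<bar>" .
  have "(\<Sum>u\<in>Na. \<Sum>v\<in>Nb. w' u v * gdist_real n G u v) \<le> (\<Sum>u\<in>Na. \<Sum>v\<in>Nb. w u v * gdist_real n G u v)"
    by (intro sum_mono mult_right_mono w'_le gdist_real_nonneg)
  then show ?thesis
    using ricci_ge_subcoupling[OF w'_nonneg row col] mass ea eb unfolding r_def c_def by argo
qed

text \<open>The dual potentials are \<open>k\<close> minus \<open>k\<close> on \<open>B\<close>, and
  0 minus \<open>k\<close> on \<open>C\<close>. If \<open>u\<close> or \<open>v\<close> is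
  exceptional, their sum is at most 0 and the constraint is trivial; the price is \<open>k\<close>
  times the fraction of exceptional vertices on each side.\<close>

lemma ricci_le_exceptional:
  assumes D: "0 < D" and B: "B \<subseteq> Na" and C: "C \<subseteq> Nb"
    and far: "\<And>u v. u \<in> Na - B \<Longrightarrow> v \<in> Nb - C \<Longrightarrow> enat k \<le> gdist n G u v"
  shows "ricci n G a b \<le> 1 - real k
    + real k * (card B / D + card C / D + \<bar>da / D - 1\<bar> + \<bar>db / D - 1\<bar>)"
proof -
  have le: "real k - real k * of_bool (u \<in> B) + (- real k * of_bool (v \<in> C)) \<le> gdist_real n G u v"
    if uv: "u \<in> Na" "v \<in> Nb" for u v
    using gdist_real_ge[OF far gdist_le_3, of u v] uv gdist_real_nonneg[of n G u v] by auto
  \<comment> \<open>As \<open>card B / da\<close> is at most 1, passing to the denominator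
    \<open>D\<close> costs no more than the relative error of the degree.\<close>
  have frac: "card B / da \<le> card B / D + \<bar>da / D - 1\<bar>"
  proof -
    have "card B / da - card B / D = card B / da * (1 - da / D)"
      using da_ge_1 b_in_Na by (auto simp: right_diff_distrib)
    also have "\<dots> \<le> 1 * \<bar>da / D - 1\<bar>"
    proof -
      have "card B / da \<le> 1" using da_ge_1 card_mono[OF _ B] by (auto simp: divide_simps)
      then have "card B / da * (1 - da / D) \<le> card B / da * \<bar>1 - da / D\<bar>"
        and "card B / da * \<bar>1 - da / D\<bar> \<le> 1 * \<bar>1 - da / D\<bar>"
        by (intro mult_left_mono mult_right_mono; simp)+
      then show ?thesis by (simp add: abs_minus_commute)
    qed
    finally show ?thesis by simp
  qed
  have frac': "card C / db \<le> card C / D + \<bar>db / D - 1\<bar>"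
  proof -
    have "card C / db - card C / D = card C / db * (1 - db / D)"
      using db_ge_1 a_in_Nb by (auto simp: right_diff_distrib)
    also have "\<dots> \<le> 1 * \<bar>db / D - 1\<bar>"
    proof -
      have "card C / db \<le> 1" using db_ge_1 card_mono[OF _ C] by (auto simp: divide_simps)
      then have "card C / db * (1 - db / D) \<le> card C / db * \<bar>1 - db / D\<bar>"
        and "card C / db * \<bar>1 - db / D\<bar> \<le> 1 * \<bar>1 - db / D\<bar>"
        by (intro mult_left_mono mult_right_mono; simp)+
      then show ?thesis by (simp add: abs_minus_commute)
    qed
    finally show ?thesis by simp
  qed
  have sB: "(\<Sum>u\<in>Na. of_bool (u \<in> B) :: real) = card B"
    using B by (simp add: sum_of_bool_eq Int_absorb1 flip: Int_def)
  have sC: "(\<Sum>u\<in>Nb. of_bool (u \<in> C) :: real) = card C"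
    using C by (simp add: sum_of_bool_eq Int_absorb1 flip: Int_def)
  have "ricci n G a b \<le> 1 - ((\<Sum>u\<in>Na. real k - real k * of_bool (u \<in> B)) / da
      + (\<Sum>v\<in>Nb. - real k * of_bool (v \<in> C)) / db)"
    by (rule ricci_le) (rule le)
  also have "(\<Sum>u\<in>Na. real k - real k * of_bool (u \<in> B)) = da * k - k * card B"
    by (simp add: sum_subtractf sB flip: sum_distrib_left)
  also have "(\<Sum>v\<in>Nb. - real k * of_bool (v \<in> C)) = - (k * card C)"
    by (simp add: sum_negf sC flip: sum_distrib_left)
  also have "1 - ((da * k - k * card B) / da + - (k * card C) / db) = 1 - real k + k * (card B / da + card C / db)"
    using b_in_Na by (auto simp: diff_divide_distrib distrib_left)
  also have "\<dots> \<le> 1 - real k + k * ((card B / D + \<bar>da / D - 1\<bar>) + (card C / D + \<bar>db / D - 1\<bar>))"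
    using frac frac' by (intro add_left_mono mult_left_mono add_mono) auto
  finally show ?thesis by (simp add: algebra_simps)
qed

text \<open>Only moves out of \<open>b\<close> or into \<open>a\<close> are cheap, at distance 1;
  all others cost 3. The potentials 3, lowered by 2 at \<open>b\<close>, and 0, lowered by 2 at
  \<open>a\<close>, give \<open>W1 \<ge> 3 - 2/da - 2/db\<close>, the constant potential 1 gives
  \<open>W1 \<ge> 1\<close>, and explicit plans attain the larger of the two. The decrements by 1 in
  the degrees remove \<open>a\<close> and \<open>b\<close> themselves, as the Poisson variables
  count only further neighbours.\<close>

lemma ricci_tree_like:
  assumes far: "\<And>u v. u \<in> Na - {b} \<Longrightarrow> v \<in> Nb - {a} \<Longrightarrow> enat 3 \<le> gdist n G u v"
  shows "ricci n G a b = poisson_limit (card Na - 1, card Nb - 1)"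
proof -
  have pl: "poisson_limit (card Na - 1, card Nb - 1) = - 2 * max 0 (1 - 1 / da - 1 / db)"
    using da_ge_1 db_ge_1 by (simp add: poisson_limit_def of_nat_diff)
  \<comment> \<open>A common neighbour of \<open>a\<close> and \<open>b\<close> would be a far pair
    with itself at distance 0; so there are no triangles on the edge.\<close>
  have ge1: "1 \<le> gdist_real n G u v" if uv: "u \<in> Na" "v \<in> Nb" for u v
  proof -
    have "u \<noteq> v"
    proof
      assume "u = v"
      then have "u \<in> Na - {b}" "u \<in> Nb - {a}" using uv b_notin_Nb a_notin_Na by auto
      from far[OF this] show False
        using gdist_le_0[of u n G] Na_less uv by (cases "gdist n G u u") auto
    qed
    then show ?thesis using gdist_real_ge[OF gdist_ge_1 gdist_le_3] uv by fastforce
  qed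
  have "ricci n G a b \<le> 1 - ((\<Sum>u\<in>Na. 1) / da + (\<Sum>v\<in>Nb. 0) / db)"
    by (rule ricci_le) (use ge1 in auto)
  then have le0: "ricci n G a b \<le> 0" using b_in_Na by (auto split: if_splits)
  have "ricci n G a b \<le> 1 - ((\<Sum>u\<in>Na. 3 - 2 * of_bool (u = b)) / da + (\<Sum>v\<in>Nb. - 2 * of_bool (v = a)) / db)"
  proof (rule ricci_le)
    fix u v assume uv: "u \<in> Na" "v \<in> Nb"
    show "3 - 2 * of_bool (u = b) + - 2 * of_bool (v = a) \<le> gdist_real n G u v"
      using gdist_real_ge[OF far gdist_le_3, of u v] ge1[of u v] uv by auto
  qed
  also have "(\<Sum>u\<in>Na. 3 - 2 * of_bool (u = b)) = 3 * da - 2"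
  proof -
    have "(\<Sum>u\<in>Na. of_bool (u = b) :: real) = 1" using b_in_Na by (simp add: of_bool_def)
    then show ?thesis by (simp add: sum_subtractf flip: sum_distrib_left)
  qed
  also have "(\<Sum>v\<in>Nb. - 2 * of_bool (v = a) :: real) = - 2"
  proof -
    have "(\<Sum>v\<in>Nb. of_bool (v = a) :: real) = 1" using a_in_Nb by (simp add: of_bool_def)
    then show ?thesis by (simp add: sum_negf flip: sum_distrib_left)
  qed
  also have "1 - ((3 * da - 2) / da + - 2 / db) = - 2 * (1 - 1 / da - 1 / db)"
    using b_in_Na by (auto simp: diff_divide_distrib)
  finally have upper: "ricci n G a b \<le> - 2 * max 0 (1 - 1 / da - 1 / db)"
    using le0 by (auto simp: max_def)
  have edge: "gdist_real n G u v \<le> 1" if "u \<in> Na" "v \<in> Nb" "u = b \<or> v = a" for u v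
  proof -
    have "gdist n G u v \<le> enat 1"
      using that by (intro gdist_le_1) (auto simp: nbrs_def adj_commute a_less b_less)
    from gdist_real_le[OF this] show ?thesis by simp
  qed
  have "- 2 * max 0 (1 - 1 / da - 1 / db) \<le> ricci n G a b"
  \<comment> \<open>If \<open>a\<close> or \<open>b\<close> is a leaf, every pair has
    \<open>u = b\<close> or \<open>v = a\<close>, so any coupling costs at most 1, and the maximum
    in the limit formula is 0.\<close>
  proof (cases "card Na = 1 \<or> card Nb = 1")
    case True
    define w where "w u v = 1 / (da * db)" for u v :: nat
    have w1: "(\<Sum>u\<in>Na. \<Sum>v\<in>Nb. w u v) = 1"
      using da_ge_1 db_ge_1 b_in_Na a_in_Nb by (auto simp: w_def)
    from True have "u = b \<or> v = a" if "u \<in> Na" "v \<in> Nb" for u v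
      using that b_in_Na a_in_Nb by (auto simp: card_1_singleton_iff)
    then have "(\<Sum>u\<in>Na. \<Sum>v\<in>Nb. w u v * gdist_real n G u v) \<le> (\<Sum>u\<in>Na. \<Sum>v\<in>Nb. w u v * 1)"
      by (intro sum_mono mult_left_mono edge) (auto simp: w_def)
    with w1 have cost: "(\<Sum>u\<in>Na. \<Sum>v\<in>Nb. w u v * gdist_real n G u v) \<le> 1" by simp
    have "1 - ((\<Sum>u\<in>Na. \<Sum>v\<in>Nb. w u v * gdist_real n G u v) + 3 * (1 - (\<Sum>u\<in>Na. \<Sum>v\<in>Nb. w u v)))
       \<le> ricci n G a b"
      using da_ge_1 db_ge_1 by (intro ricci_ge_subcoupling) (auto simp: w_def divide_simps)
    with w1 cost True show ?thesis by auto
  next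
    case False
    with da_ge_1 db_ge_1 have ge2: "2 \<le> da" "2 \<le> db" by auto
    have half: "1 / da \<le> 1 / 2" "1 / db \<le> 1 / 2" using ge2 by (auto simp: field_simps)
    \<comment> \<open>The mass at \<open>b\<close> is spread over the other neighbours of
      \<open>b\<close>, and the demand at \<open>a\<close> is drawn from the other neighbours of
      \<open>a\<close>. Moving \<open>b\<close> to \<open>a\<close> is avoided: it would use up a
      cheap source and a cheap target at once.\<close>
    define w where "w u v = (if u = b \<and> v \<noteq> a then 1 / (da * (db - 1)) else
      if u \<noteq> b \<and> v = a then 1 / (db * (da - 1)) else 0)" for u v
    have Nb_split: "Nb = insert a (Nb - {a})" and Na_split: "Na = insert b (Na - {b})"
      using a_in_Nb b_in_Na by auto
    have cb: "real (card (Nb - {a})) = db - 1" "real (card (Na - {b})) = da - 1"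
      using a_in_Nb b_in_Na da_ge_1 db_ge_1 by (auto simp: card_Diff_singleton of_nat_diff)
    have row_b: "(\<Sum>v\<in>Nb. w b v) = 1 / da"
    proof -
      have "(\<Sum>v\<in>Nb. w b v) = (\<Sum>v\<in>Nb - {a}. 1 / (da * (db - 1)))"
        by (subst Nb_split, subst sum.insert) (auto simp: w_def)
      also have "\<dots> = 1 / da" using cb ge2 by simp
      finally show ?thesis .
    qed
    have row_u: "(\<Sum>v\<in>Nb. w u v) = 1 / (db * (da - 1))" if "u \<noteq> b" for u
      using that by (subst Nb_split, subst sum.insert) (auto simp: w_def)
    have col_a: "(\<Sum>u\<in>Na. w u a) = 1 / db"
    proof -
      have "(\<Sum>u\<in>Na. w u a) = (\<Sum>u\<in>Na - {b}. 1 / (db * (da - 1)))"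
        by (subst Na_split, subst sum.insert) (auto simp: w_def)
      also have "\<dots> = 1 / db" using cb ge2 by simp
      finally show ?thesis .
    qed
    have col_v: "(\<Sum>u\<in>Na. w u v) = 1 / (da * (db - 1))" if "v \<noteq> a" for v
      using that by (subst Na_split, subst sum.insert) (auto simp: w_def)
    \<comment> \<open>The rows with \<open>u \<noteq> b\<close> and the columns with
      \<open>v \<noteq> a\<close> fit under their marginals exactly when
      \<open>da + db \<le> da * db\<close>, which is true for degrees at least 2.\<close>
    have "0 \<le> (da - 2) * (db - 2) + (da - 2) + (db - 2)"
      using ge2 by (intro add_nonneg_nonneg mult_nonneg_nonneg) auto
    then have prod: "da + db \<le> da * db" by (simp add: algebra_simps)
    have w_nonneg: "0 \<le> w u v" for u v using ge2 by (auto simp: w_def)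
    have row: "(\<Sum>v\<in>Nb. w u v) \<le> 1 / da" for u
      using row_b row_u[of u] prod ge2
      by (cases "u = b") (auto intro!: divide_left_mono mult_pos_pos simp: algebra_simps)
    have col: "(\<Sum>u\<in>Na. w u v) \<le> 1 / db" for v
      using col_a col_v[of v] prod ge2
      by (cases "v = a") (auto intro!: divide_left_mono mult_pos_pos simp: algebra_simps)
    have mass: "(\<Sum>u\<in>Na. \<Sum>v\<in>Nb. w u v) = 1 / da + 1 / db"
      using cb ge2 by (subst Na_split, subst sum.insert) (auto simp: row_b row_u)
    have "(\<Sum>u\<in>Na. \<Sum>v\<in>Nb. w u v * gdist_real n G u v) \<le> (\<Sum>u\<in>Na. \<Sum>v\<in>Nb. w u v)"
    proof (intro sum_mono)
      fix u v assume uv: "u \<in> Na" "v \<in> Nb"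
      show "w u v * gdist_real n G u v \<le> w u v"
        using mult_left_mono[OF edge[OF uv] w_nonneg, of u v] by (cases "u = b \<or> v = a") (auto simp: w_def)
    qed
    then show ?thesis
      using ricci_ge_subcoupling[OF w_nonneg row col] mass half by auto
  qed
  with upper pl show ?thesis by linarith
qed

end

section \<open>Moments under the conditioned random graph\<close>

lemma doubleton_in_vpairs [simp]: "{i, j} \<in> vpairs n \<longleftrightarrow> i \<noteq> j \<and> i < n \<and> j < n"
  unfolding vpairs_def using linorder_less_linear[of i j] by (auto simp: doubleton_eq_iff)

lemma finite_vpairs [simp]: "finite (vpairs n)"
  by (rule finite_subset[of _ "Pow {..<n}"]) (auto simp: vpairs_def)

lemma prob_gnp_edges:
  assumes "0 \<le> p" "p \<le> 1" "E \<subseteq> vpairs n" "F \<subseteq> vpairs n" "E \<inter> F = {}"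
  shows "measure_pmf.prob (gnp n p) {G. (\<forall>e\<in>E. G e) \<and> (\<forall>e\<in>F. \<not> G e)} = p ^ card E * (1 - p) ^ card F"
proof -
  \<comment> \<open>Prescribing edges and non-edges is a product event, one condition per vertex
    pair, so its measure factors.\<close>
  define B where "B e = (if e \<in> E then {True} else if e \<in> F then {False} else UNIV)" for e
  have "{G. (\<forall>e\<in>E. G e) \<and> (\<forall>e\<in>F. \<not> G e)} = Pi (vpairs n) B"
    using assms(3-5) by (auto simp: B_def Pi_def split: if_splits)
  then have "measure_pmf.prob (gnp n p) {G. (\<forall>e\<in>E. G e) \<and> (\<forall>e\<in>F. \<not> G e)} =
      (\<Prod>e\<in>vpairs n. measure_pmf.prob (bernoulli_pmf p) (B e))"
    by (simp add: gnp_def measure_Pi_pmf_Pi)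
  also have "\<dots> = (\<Prod>e\<in>vpairs n. (if e \<in> E then p else 1) * (if e \<in> F then 1 - p else 1))"
    using assms by (intro prod.cong refl) (auto simp: B_def measure_pmf_single)
  also have "\<dots> = p ^ card E * (1 - p) ^ card F"
    using assms(3,4) by (simp add: prod.distrib prod.If_cases Int_absorb1 flip: Int_def)
  finally show ?thesis .
qed

section \<open>First and second moments of sums of indicators\<close>

lemma integrable_finite_pmf:
  "finite (set_pmf P) \<Longrightarrow> integrable (measure_pmf P) (f :: 'a \<Rightarrow> real)"
  by (rule integrable_measure_pmf_finite)

lemma expectation_of_bool: "measure_pmf.expectation P (\<lambda>G. of_bool (Q G)) = measure_pmf.prob P {G. Q G}"
proof -
  have "(\<lambda>G. of_bool (Q G) :: real) = indicat_real {G. Q G}" by (auto simp: indicator_def)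
  then show ?thesis by simp
qed

lemma expectation_mono_pmf:
  fixes f g :: "'a \<Rightarrow> real"
  assumes "finite (set_pmf P)" "\<And>G. G \<in> set_pmf P \<Longrightarrow> f G \<le> g G"
  shows "measure_pmf.expectation P f \<le> measure_pmf.expectation P g"
  using assms by (intro integral_mono_AE integrable_finite_pmf AE_pmfI) auto

lemma expectation_square_deviation:
  fixes P :: "'a pmf" and m :: real
  assumes fin: "finite (set_pmf P)" and "finite I" "m \<noteq> 0"
  shows "measure_pmf.expectation P (\<lambda>G. of_bool (A G) * ((\<Sum>i\<in>I. of_bool (B i G)) / m - 1)\<^sup>2) =
    (\<Sum>i\<in>I. \<Sum>j\<in>I. measure_pmf.prob P {G. A G \<and> B i G \<and> B j G}) / m\<^sup>2
     - 2 * (\<Sum>i\<in>I. measure_pmf.prob P {G. A G \<and> B i G}) / m + measure_pmf.prob P {G. A G}"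
proof -
  have "of_bool (A G) * ((\<Sum>i\<in>I. of_bool (B i G)) / m - 1)\<^sup>2 =
     (\<Sum>i\<in>I. \<Sum>j\<in>I. of_bool (A G \<and> B i G \<and> B j G)) / m\<^sup>2
     - 2 * (\<Sum>i\<in>I. of_bool (A G \<and> B i G)) / m + of_bool (A G)" (is "?l = ?r") for G
  proof (cases "A G")
    case True
    have "(\<Sum>i\<in>I. \<Sum>j\<in>I. of_bool (B i G \<and> B j G)) = (\<Sum>i\<in>I. of_bool (B i G) :: real)\<^sup>2"
      by (simp add: power2_eq_square sum_product of_bool_conj)
    with True show ?thesis by (simp add: power2_diff power_divide)
  qed simp
  then show ?thesis
    by (simp add: integrable_finite_pmf[OF fin] expectation_of_bool)
qed

text \<open>The pointwise inequality \<open>\<bar>x\<bar> \<le> sqrt v + x^2 / sqrt v\<close> stands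
  in for Cauchy-Schwarz, at the price of the factor 2.\<close>

lemma expectation_abs_le_sqrt:
  fixes X :: "'a \<Rightarrow> real"
  assumes fin: "finite (set_pmf P)" and v: "0 < v"
    and A: "measure_pmf.prob P {G. A G} = \<alpha>"
    and X: "measure_pmf.expectation P (\<lambda>G. of_bool (A G) * (X G)\<^sup>2) \<le> \<alpha> * v"
  shows "measure_pmf.expectation P (\<lambda>G. of_bool (A G) * \<bar>X G\<bar>) \<le> 2 * \<alpha> * sqrt v"
proof -
  have "\<bar>x\<bar> \<le> sqrt v + x\<^sup>2 / sqrt v" for x
  proof (cases "\<bar>x\<bar> \<le> sqrt v")
    case False
    then have "\<bar>x\<bar> * sqrt v \<le> \<bar>x\<bar> * \<bar>x\<bar>" by (intro mult_left_mono) auto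
    then have "\<bar>x\<bar> \<le> x\<^sup>2 / sqrt v" using v by (simp add: field_simps power2_eq_square)
    then show ?thesis using v by (smt (verit) real_sqrt_gt_zero)
  qed (use v in \<open>auto intro: add_increasing2\<close>)
  then have "measure_pmf.expectation P (\<lambda>G. of_bool (A G) * \<bar>X G\<bar>)
      \<le> measure_pmf.expectation P (\<lambda>G. of_bool (A G) * sqrt v + of_bool (A G) * (X G)\<^sup>2 / sqrt v)"
    by (intro expectation_mono_pmf fin) auto
  also have "\<dots> = \<alpha> * sqrt v + measure_pmf.expectation P (\<lambda>G. of_bool (A G) * (X G)\<^sup>2) / sqrt v"
    by (simp add: integrable_finite_pmf[OF fin] expectation_of_bool A)
  also have "\<dots> \<le> \<alpha> * sqrt v + \<alpha> * v / sqrt v"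
    using X v by (intro add_left_mono divide_right_mono) auto
  also have "\<dots> = 2 * \<alpha> * sqrt v"
    using v by (simp add: real_div_sqrt flip: times_divide_eq_right)
  finally show ?thesis .
qed

text \<open>\<open>M\<close> is the round nominal number of summands, such as \<open>n\<close>, and
  \<open>card I\<close> the true one; normalising by \<open>M * s\<close> instead of the true mean
  produces \<open>2 * (1 - card I / M)\<close>. The relative excess of the second moment over the
  uncorrelated value is \<open>\<eta>\<close>.\<close>

lemma expectation_deviation_le:
  fixes M s \<eta> :: real
  assumes fin: "finite (set_pmf P)" and I: "finite I" and pos: "0 < M" "0 < s" "0 < v"
    and A: "measure_pmf.prob P {G. A G} = \<alpha>"
    and B: "\<And>i. i \<in> I \<Longrightarrow> measure_pmf.prob P {G. A G \<and> B i G} = \<alpha> * s"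
    and BB: "(\<Sum>i\<in>I. \<Sum>j\<in>I. measure_pmf.prob P {G. A G \<and> B i G \<and> B j G}) \<le> \<alpha> * (M * s)\<^sup>2 * (1 + \<eta>)"
    and v: "\<eta> + 2 * (1 - card I / M) \<le> v"
  shows "measure_pmf.expectation P (\<lambda>G. of_bool (A G) * \<bar>(\<Sum>i\<in>I. of_bool (B i G)) / (M * s) - 1\<bar>)
    \<le> 2 * \<alpha> * sqrt v"
proof (rule expectation_abs_le_sqrt[OF fin pos(3) A])
  have \<alpha>: "0 \<le> \<alpha>" using A measure_nonneg by metis
  have "measure_pmf.expectation P (\<lambda>G. of_bool (A G) * ((\<Sum>i\<in>I. of_bool (B i G)) / (M * s) - 1)\<^sup>2)
      = (\<Sum>i\<in>I. \<Sum>j\<in>I. measure_pmf.prob P {G. A G \<and> B i G \<and> B j G}) / (M * s)\<^sup>2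
        - 2 * (card I * (\<alpha> * s)) / (M * s) + \<alpha>"
    using pos by (subst expectation_square_deviation[OF fin I]) (auto simp: A B)
  also have "\<dots> \<le> \<alpha> * (M * s)\<^sup>2 * (1 + \<eta>) / (M * s)\<^sup>2 - 2 * (card I * (\<alpha> * s)) / (M * s) + \<alpha>"
    using BB by (intro add_right_mono diff_right_mono divide_right_mono) auto
  also have "\<dots> = \<alpha> * (\<eta> + 2 * (1 - card I / M))"
    using pos by (simp add: field_simps)
  also have "\<dots> \<le> \<alpha> * v" using v \<alpha> by (rule mult_left_mono)
  finally show "measure_pmf.expectation P (\<lambda>G. of_bool (A G) * ((\<Sum>i\<in>I. of_bool (B i G)) / (M * s) - 1)\<^sup>2)
    \<le> \<alpha> * v" .
qed

text \<open>For summands uncorrelated given \<open>A\<close>, only the diagonal exceeds the product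
  value; it contributes the inverse nominal mean \<open>1 / (M * s)\<close>.\<close>

lemma expectation_deviation_pairwise_le:
  fixes M s :: real
  assumes fin: "finite (set_pmf P)" and I: "finite I" and pos: "0 < M" "0 < s"
    and IM: "card I \<le> M"
    and A: "measure_pmf.prob P {G. A G} = \<alpha>"
    and B: "\<And>i. i \<in> I \<Longrightarrow> measure_pmf.prob P {G. A G \<and> B i G} = \<alpha> * s"
    and BB: "\<And>i j. i \<in> I \<Longrightarrow> j \<in> I \<Longrightarrow> i \<noteq> j \<Longrightarrow>
      measure_pmf.prob P {G. A G \<and> B i G \<and> B j G} = \<alpha> * s\<^sup>2"
  shows "measure_pmf.expectation P (\<lambda>G. of_bool (A G) * \<bar>(\<Sum>i\<in>I. of_bool (B i G)) / (M * s) - 1\<bar>)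
    \<le> 2 * \<alpha> * sqrt (1 / (M * s) + 2 * (1 - card I / M))"
proof (rule expectation_deviation_le[OF fin I pos _ A B])
  have \<alpha>: "0 \<le> \<alpha>" using A measure_nonneg by metis
  have "(\<Sum>i\<in>I. \<Sum>j\<in>I. measure_pmf.prob P {G. A G \<and> B i G \<and> B j G})
      \<le> (\<Sum>i\<in>I. \<Sum>j\<in>I. \<alpha> * s\<^sup>2 + (if i = j then \<alpha> * s else 0))"
    using \<alpha> by (intro sum_mono) (auto simp: BB B)
  also have "\<dots> = (card I)\<^sup>2 * (\<alpha> * s\<^sup>2) + card I * (\<alpha> * s)"
    using I by (simp add: sum.distrib power2_eq_square distrib_left)
  also have "\<dots> \<le> M\<^sup>2 * (\<alpha> * s\<^sup>2) + M * (\<alpha> * s)"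
    using IM \<alpha> pos by (intro add_mono mult_right_mono) (auto intro: power_mono)
  also have "\<dots> = \<alpha> * (M * s)\<^sup>2 * (1 + 1 / (M * s))"
    using pos by (simp add: field_simps power2_eq_square)
  finally show "(\<Sum>i\<in>I. \<Sum>j\<in>I. measure_pmf.prob P {G. A G \<and> B i G \<and> B j G})
    \<le> \<alpha> * (M * s)\<^sup>2 * (1 + 1 / (M * s))" .
  show "0 < 1 / (M * s) + 2 * (1 - card I / M)"
    using pos IM by (intro add_pos_nonneg) (auto simp: field_simps)
qed auto

section \<open>Subgraph probabilities around the conditioned edge\<close>

lemma gnp_edge_commute: "gnp_edge n p a b = gnp_edge n p b a"
  by (simp add: gnp_edge_def insert_commute)

locale edge_gnp =
  fixes n :: nat and p :: real and a b :: nat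
  assumes a_less: "a < n" and b_less: "b < n" and a_neq_b: "a \<noteq> b"
    and p_pos: "0 < p" and p_le_1: "p \<le> 1"
begin

abbreviation P where "P \<equiv> gnp_edge n p a b"
abbreviation expec :: "((nat set \<Rightarrow> bool) \<Rightarrow> real) \<Rightarrow> real" where
  "expec \<equiv> measure_pmf.expectation P"

definition V where "V = {..<n} - {a, b}"

text \<open>The law of the graph is symmetric in the endpoints, so each statement about
  \<open>a\<close> yields its counterpart for \<open>b\<close> by instantiating the locale with the
  roles exchanged.\<close>

lemma swap: "edge_gnp n p b a"
  using a_less b_less a_neq_b p_pos p_le_1 by unfold_locales auto

lemma V_swap: "edge_gnp.V n b a = V"
  unfolding edge_gnp.V_def[OF swap] V_def by auto

lemma finite_V [simp]: "finite V"
  by (simp add: V_def)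

lemma card_V: "card V = n - 2"
  using a_less b_less a_neq_b by (simp add: V_def card_Diff_subset)

lemma n_ge_2: "2 \<le> n"
  using a_less b_less a_neq_b by linarith

lemma prob_edge_pos: "measure_pmf.prob (gnp n p) {G. G {a, b}} = p"
  using prob_gnp_edges[of p "{{a, b}}" n "{}"] a_less b_less a_neq_b p_pos p_le_1 by simp

lemma cond_nonempty: "set_pmf (gnp n p) \<inter> {G. G {a, b}} \<noteq> {}"
  using prob_edge_pos p_pos by (auto simp: measure_pmf_zero_iff[symmetric] simp del: measure_pmf_zero_iff)

lemma finite_set_gnp: "finite (set_pmf (gnp n p))"
  by (rule finite_subset[OF set_Pi_pmf_subset'[OF finite_vpairs, of n False "\<lambda>_. bernoulli_pmf p", folded gnp_def]])
     (auto intro!: finite_PiE_dflt)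

lemma finite_P [simp]: "finite (set_pmf P)"
  using finite_set_gnp by (simp add: gnp_edge_def set_cond_pmf[OF cond_nonempty])

lemma edge_P: "G \<in> set_pmf P \<Longrightarrow> G {a, b}"
  by (simp add: gnp_edge_def set_cond_pmf[OF cond_nonempty])

lemma graph_edge_P: "G \<in> set_pmf P \<Longrightarrow> graph_edge n G a b"
  using edge_P a_less b_less a_neq_b by (auto simp: graph_edge_def adj_def)

lemma integ [simp]: "integrable (measure_pmf P) (f :: _ \<Rightarrow> real)"
  by (simp add: integrable_finite_pmf)

lemma prob_P_conv:
  "measure_pmf.prob P S = measure_pmf.prob (gnp n p) ({G. G {a, b}} \<inter> S) / p"
  by (simp add: gnp_edge_def cond_pmf.rep_eq[OF cond_nonempty] measure_uniform_measure
      measure_measure_pmf_not_zero cond_nonempty emeasure_measure_pmf_not_zero prob_edge_pos)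

text \<open>Requiring \<open>{a, b}\<close> as well adds one factor \<open>p\<close>, which the
  conditioning divides out: the other pairs remain independent.\<close>

lemma prob_P_edges:
  assumes "E \<subseteq> vpairs n - {{a, b}}" "F \<subseteq> vpairs n - {{a, b}}" "E \<inter> F = {}"
  shows "measure_pmf.prob P {G. (\<forall>e\<in>E. G e) \<and> (\<forall>e\<in>F. \<not> G e)} = p ^ card E * (1 - p) ^ card F"
proof -
  have finE: "finite E" using assms(1) finite_subset[of E "vpairs n"] by auto
  have "{G. G {a, b}} \<inter> {G. (\<forall>e\<in>E. G e) \<and> (\<forall>e\<in>F. \<not> G e)}
      = {G. (\<forall>e\<in>insert {a, b} E. G e) \<and> (\<forall>e\<in>F. \<not> G e)}" by auto
  moreover have "measure_pmf.prob (gnp n p) \<dots> = p ^ card (insert {a, b} E) * (1 - p) ^ card F"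
    using assms a_less b_less a_neq_b p_pos p_le_1 by (intro prob_gnp_edges) auto
  moreover have "card (insert {a, b} E) = Suc (card E)"
    using assms(1) finE by (subst card_insert_disjoint) auto
  ultimately show ?thesis using p_pos by (simp add: prob_P_conv)
qed

text \<open>Listing the edges turns the cardinality in the exponent into a distinctness check on
  vertex pairs, which simplification can settle.\<close>

lemma prob_P_eqI:
  assumes "\<And>G. Q G \<longleftrightarrow> (\<forall>e\<in>set es. G e) \<and> (\<forall>e\<in>set fs. \<not> G e)"
    and "set (es @ fs) \<subseteq> vpairs n - {{a, b}}" "distinct (es @ fs)"
    and "k = length es" "l = length fs"
  shows "measure_pmf.prob P {G. Q G} = p ^ k * (1 - p) ^ l"
  using prob_P_edges[of "set es" "set fs"] assms by (simp add: distinct_card)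

lemma prob_P_eqI':
  assumes "\<And>G. Q G \<longleftrightarrow> (\<forall>e\<in>set es. G e)"
    and "set es \<subseteq> vpairs n - {{a, b}}" "distinct es" "k = length es"
  shows "measure_pmf.prob P {G. Q G} = p ^ k"
  using prob_P_eqI[of Q es "[]" k 0] assms by simp

lemmas edge_simps = adj_def V_def a_less b_less a_neq_b a_neq_b[symmetric] doubleton_eq_iff

lemma prob_nbr_a: "x \<in> V \<Longrightarrow> measure_pmf.prob P {G. adj G a x} = p"
  using prob_P_eqI'[of "\<lambda>G. adj G a x" "[{a, x}]" 1] by (simp add: edge_simps)

lemma prob_common:
  "x \<in> V \<Longrightarrow> measure_pmf.prob P {G. adj G a x \<and> adj G b x} = p\<^sup>2"
  by (rule prob_P_eqI'[where es = "[{a, x}, {b, x}]"])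
     (simp_all add: edge_simps)

lemma prob_4_cycle:
  "x \<in> V \<Longrightarrow> y \<in> V \<Longrightarrow> x \<noteq> y \<Longrightarrow> measure_pmf.prob P {G. adj G a x \<and> adj G b y \<and> adj G x y} = p ^ 3"
  by (rule prob_P_eqI'[where es = "[{a, x}, {b, y}, {x, y}]"])
     (simp_all add: edge_simps)

lemma prob_pendant_triangle:
  "x \<in> V \<Longrightarrow> y \<in> V \<Longrightarrow> x \<noteq> y \<Longrightarrow> measure_pmf.prob P {G. adj G a x \<and> adj G b y \<and> adj G a y} = p ^ 3"
  by (rule prob_P_eqI'[where es = "[{a, x}, {b, y}, {a, y}]"])
     (simp_all add: edge_simps)

lemma prob_5_cycle:
  "x \<in> V \<Longrightarrow> y \<in> V \<Longrightarrow> z \<in> V \<Longrightarrow> distinct [x, y, z] \<Longrightarrow>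
    measure_pmf.prob P {G. adj G a x \<and> adj G x z \<and> adj G z y \<and> adj G b y} = p ^ 4"
  by (rule prob_P_eqI'[where es = "[{a, x}, {x, z}, {z, y}, {b, y}]"])
     (simp_all add: edge_simps)

lemma expectation_nbr_deviation:
  "expec (\<lambda>G. \<bar>(\<Sum>x\<in>V. of_bool (adj G a x)) / (n * p) - 1\<bar>) \<le> 2 * sqrt (1 / (n * p) + 4 / n)"
proof -
  have "expec (\<lambda>G. of_bool True * \<bar>(\<Sum>x\<in>V. of_bool (adj G a x)) / (real n * p) - 1\<bar>)
    \<le> 2 * 1 * sqrt (1 / (real n * p) + 2 * (1 - card V / real n))"
  proof (rule expectation_deviation_pairwise_le)
    fix x y assume "x \<in> V" "y \<in> V" "x \<noteq> y"
    then show "measure_pmf.prob P {G. True \<and> adj G a x \<and> adj G a y} = 1 * p\<^sup>2"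
      unfolding mult_1 by (intro prob_P_eqI'[where es = "[{a, x}, {a, y}]"])
         (simp_all add: edge_simps)
  qed (use n_ge_2 p_pos in \<open>auto simp: prob_nbr_a card_V\<close>)
  moreover have "2 * (1 - card V / real n) = 4 / n"
    using n_ge_2 by (simp add: card_V of_nat_diff field_simps)
  ultimately show ?thesis by simp
qed

lemma expectation_common_deviation:
  "expec (\<lambda>G. \<bar>(\<Sum>x\<in>V. of_bool (adj G a x \<and> adj G b x)) / (n * p\<^sup>2) - 1\<bar>) \<le> 2 * sqrt (1 / (n * p\<^sup>2) + 4 / n)"
proof -
  have "expec (\<lambda>G. of_bool True * \<bar>(\<Sum>x\<in>V. of_bool (adj G a x \<and> adj G b x)) / (real n * p\<^sup>2) - 1\<bar>)
    \<le> 2 * 1 * sqrt (1 / (real n * p\<^sup>2) + 2 * (1 - card V / real n))"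
  proof (rule expectation_deviation_pairwise_le)
    fix x y assume "x \<in> V" "y \<in> V" "x \<noteq> y"
    then show "measure_pmf.prob P {G. True \<and> (adj G a x \<and> adj G b x) \<and> adj G a y \<and> adj G b y} = 1 * (p\<^sup>2)\<^sup>2"
      unfolding mult_1 power_mult[symmetric] by (intro prob_P_eqI'[where es = "[{a, x}, {b, x}, {a, y}, {b, y}]"])
         (simp_all add: edge_simps)
  qed (use n_ge_2 p_pos in \<open>auto simp: prob_common card_V\<close>)
  moreover have "2 * (1 - card V / real n) = 4 / n"
    using n_ge_2 by (simp add: card_V of_nat_diff field_simps)
  ultimately show ?thesis by simp
qed

text \<open>Multiplying by the indicator of the edge \<open>{a, x}\<close> replaces an appeal to independence:
  summing over \<open>x\<close> later yields the expected deviation over the random set of neighbours of \<open>a\<close>.\<close>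

lemma expectation_row_deviation_1:
  fixes s :: real
  assumes x: "x \<in> V" and p1: "p < 1" and n3: "3 \<le> n"
  defines "s \<equiv> p\<^sup>2 * (1 - p)"
  shows "expec (\<lambda>G. of_bool (adj G a x) *
      \<bar>(\<Sum>y\<in>V - {x}. of_bool (adj G b y \<and> \<not> adj G a y \<and> adj G x y)) / (real n * s) - 1\<bar>)
    \<le> 2 * p * sqrt (1 / (real n * s) + 6 / n)"
proof -
  have "0 < s" using p1 p_pos by (simp add: s_def)
  have card: "card (V - {x}) = n - 3" using x by (simp add: card_V)
  have "expec (\<lambda>G. of_bool (adj G a x) *
      \<bar>(\<Sum>y\<in>V - {x}. of_bool (adj G b y \<and> \<not> adj G a y \<and> adj G x y)) / (real n * s) - 1\<bar>)
    \<le> 2 * p * sqrt (1 / (real n * s) + 2 * (1 - card (V - {x}) / real n))"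
  proof (rule expectation_deviation_pairwise_le)
    fix y assume y: "y \<in> V - {x}"
    show "measure_pmf.prob P {G. adj G a x \<and> adj G b y \<and> \<not> adj G a y \<and> adj G x y} = p * s"
    proof -
      have "p * s = p ^ 3 * (1 - p) ^ 1" unfolding s_def by algebra
      then show ?thesis using x y
        by (simp only:, intro prob_P_eqI[where es = "[{a, x}, {b, y}, {x, y}]" and fs = "[{a, y}]"],
            simp_all add: edge_simps, blast?)
    qed
    fix y' assume y': "y' \<in> V - {x}" "y \<noteq> y'"
    show "measure_pmf.prob P {G. adj G a x \<and> (adj G b y \<and> \<not> adj G a y \<and> adj G x y) \<and>
        adj G b y' \<and> \<not> adj G a y' \<and> adj G x y'} = p * s\<^sup>2"
    proof -
      have ne: "x < n" "x \<noteq> a" "x \<noteq> b" "a \<noteq> x" "b \<noteq> x"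
        "y < n" "y \<noteq> a" "y \<noteq> b" "y \<noteq> x" "a \<noteq> y" "b \<noteq> y" "x \<noteq> y"
        "y' < n" "y' \<noteq> a" "y' \<noteq> b" "y' \<noteq> x" "a \<noteq> y'" "b \<noteq> y'" "x \<noteq> y'"
        "y \<noteq> y'" "y' \<noteq> y"
        using x y y' by (auto simp: V_def)
      moreover have "p * s\<^sup>2 = p ^ 5 * (1 - p) ^ 2" unfolding s_def by algebra
      ultimately show ?thesis
        by (simp only:) (intro prob_P_eqI[where es = "[{a, x}, {b, y}, {x, y}, {b, y'}, {x, y'}]" and fs = "[{a, y}, {a, y'}]"],
          auto simp: ne adj_def a_less b_less a_neq_b a_neq_b[symmetric] doubleton_eq_iff)
    qed
  qed (use n_ge_2 p_pos x \<open>0 < s\<close> in \<open>auto simp: prob_nbr_a card\<close>)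
  \<comment> \<open>Three vertices, \<open>a\<close>, \<open>b\<close> and \<open>x\<close>, are
    missing from the nominal \<open>n\<close>.\<close>
  moreover have "2 * (1 - card (V - {x}) / real n) = 6 / n"
    using n3 unfolding card by (simp add: of_nat_diff field_simps)
  ultimately show ?thesis by simp
qed

lemma sum_of_bool_eq_left [simp]: "finite A \<Longrightarrow> z \<in> A \<Longrightarrow> (\<Sum>x\<in>A. of_bool (z = x) :: real) = 1"
  by (simp add: of_bool_def)

text \<open>Two 5-cycles through \<open>b\<close>, \<open>a\<close>, \<open>x\<close> share the edge
  \<open>{a, x}\<close>, the leading factor. Further sharing is \<open>{x, z}\<close> if
  \<open>z = z'\<close>, \<open>{b, y}\<close> if \<open>y = y'\<close>, all edges if both hold, and
  \<open>{z, y}\<close> if the second path is reversed. Adding all cases weighted by indicators,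
  instead of distinguishing them, makes the later sums over the four vertices factor.\<close>

lemma prob_two_5_cycles_le:
  assumes V: "x \<in> V" "y \<in> V" "z \<in> V" "y' \<in> V" "z' \<in> V"
    and d: "distinct [x, y, z]" "distinct [x, y', z']"
  shows "measure_pmf.prob P {G. adj G a x \<and> (adj G x z \<and> adj G z y \<and> adj G b y) \<and>
      (adj G x z' \<and> adj G z' y' \<and> adj G b y')} \<le>
    p * (p ^ 6 + of_bool (z = z') * p ^ 5 + of_bool (y = y') * p ^ 5
      + of_bool (z = z') * of_bool (y = y') * p ^ 3 + of_bool (z = y') * of_bool (y = z') * p ^ 5)"
    (is "?P \<le> _")
proof -
  have pos: "0 \<le> p ^ k" for k using p_pos by simp
  have ne: "x < n" "x \<noteq> a" "x \<noteq> b" "a \<noteq> x" "b \<noteq> x"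
    "y < n" "y \<noteq> a" "y \<noteq> b" "y \<noteq> x" "a \<noteq> y" "b \<noteq> y" "x \<noteq> y"
    "z < n" "z \<noteq> a" "z \<noteq> b" "z \<noteq> x" "a \<noteq> z" "b \<noteq> z" "x \<noteq> z"
    "y' < n" "y' \<noteq> a" "y' \<noteq> b" "y' \<noteq> x" "a \<noteq> y'" "b \<noteq> y'" "x \<noteq> y'"
    "z' < n" "z' \<noteq> a" "z' \<noteq> b" "z' \<noteq> x" "a \<noteq> z'" "b \<noteq> z'" "x \<noteq> z'"
    "y \<noteq> z" "z \<noteq> y" "y' \<noteq> z'" "z' \<noteq> y'"
    using V d by (auto simp: V_def)
  note simps = ne adj_def a_less b_less a_neq_b a_neq_b[symmetric] doubleton_eq_iff
  consider "z = z'" "y = y'" | "z = z'" "y \<noteq> y'" | "z \<noteq> z'" "y = y'"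
    | "z \<noteq> z'" "y \<noteq> y'" "z = y'" "y = z'" | "z \<noteq> z'" "y \<noteq> y'" "z \<noteq> y' \<or> y \<noteq> z'" by blast
  then show ?thesis
  proof cases
    case 1
    have "?P = p ^ 4"
      by (rule prob_P_eqI'[where es = "[{a, x}, {x, z}, {z, y}, {b, y}]"])
        (auto simp: simps 1[symmetric])
    also have "\<dots> = p * p ^ 3" by (simp add: eval_nat_numeral)
    finally show ?thesis using 1 p_pos d pos by (auto intro!: mult_left_mono)
  next
    case 2
    then have "z \<noteq> y'" "y' \<noteq> z" using d by auto
    note 2 = 2 this
    have "?P = p ^ 6"
      by (rule prob_P_eqI'[where es = "[{a, x}, {x, z}, {z, y}, {b, y}, {z, y'}, {b, y'}]"])
        (auto simp: simps 2(1)[symmetric] 2(2) 2(2)[symmetric] 2(3,4))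
    also have "\<dots> = p * p ^ 5" by (simp add: eval_nat_numeral)
    finally show ?thesis using 2 p_pos d pos by (auto intro!: mult_left_mono)
  next
    case 3
    then have "z' \<noteq> y" "y \<noteq> z'" using d by auto
    note 3 = 3 this
    have "?P = p ^ 6"
      by (rule prob_P_eqI'[where es = "[{a, x}, {x, z}, {z, y}, {b, y}, {x, z'}, {z', y}]"])
        (auto simp: simps 3(2)[symmetric] 3(1) 3(1)[symmetric] 3(3,4))
    also have "\<dots> = p * p ^ 5" by (simp add: eval_nat_numeral)
    finally show ?thesis using 3 p_pos d pos by (auto intro!: mult_left_mono)
  next
    case 4
    have "?P = p ^ 6"
      by (rule prob_P_eqI'[where es = "[{a, x}, {x, z}, {z, y}, {b, y}, {x, y}, {b, z}]"])
        (auto simp: simps 4(3,4)[symmetric] insert_commute[of y z])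
    also have "\<dots> = p * p ^ 5" by (simp add: eval_nat_numeral)
    finally show ?thesis using 4 p_pos d pos by (auto intro!: mult_left_mono)
  next
    case 5
    have "?P = p ^ 7"
      by (rule prob_P_eqI'[where es = "[{a, x}, {x, z}, {z, y}, {b, y}, {x, z'}, {z', y'}, {b, y'}]"])
        (use 5 in \<open>auto simp: simps\<close>)
    also have "\<dots> = p * p ^ 6" by (simp add: eval_nat_numeral)
    finally show ?thesis using 5 p_pos d pos by (auto intro!: mult_left_mono)
  qed
qed

text \<open>Candidates for a path \<open>x\<close>, \<open>z\<close>, \<open>y\<close> avoiding
  \<open>a\<close> and \<open>b\<close>, middle vertex first; no edge is required yet.\<close>

definition paths2 :: "nat \<Rightarrow> (nat \<times> nat) set" where
  "paths2 x = {(z, y) \<in> V \<times> V. distinct [x, y, z]}"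

lemma finite_paths2 [simp]: "finite (paths2 x)"
  by (rule finite_subset[of _ "V \<times> V"]) (auto simp: paths2_def)

lemma card_paths2: "x \<in> V \<Longrightarrow> card (paths2 x) = (n - 3) * (n - 4)"
proof -
  assume x: "x \<in> V"
  have "paths2 x = Sigma (V - {x}) (\<lambda>z. V - {x} - {z})" by (auto simp: paths2_def)
  moreover have "card (V - {x} - {z}) = n - 4" if "z \<in> V - {x}" for z
    using that x by (simp add: card_V)
  ultimately show ?thesis using x by (simp add: card_SigmaI card_V)
qed

text \<open>Relative to the main term \<open>n^4 p^6\<close>, the overlapping pairs of paths
  contribute \<open>2 / (n p)\<close> (common middle or common end), \<open>1 / (n^2 p^3)\<close>
  (equal paths) and \<open>1 / (n^2 p)\<close> (reversed paths).\<close>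

lemma expectation_row_deviation_2:
  assumes x: "x \<in> V" and n4: "4 \<le> n"
  shows "expec (\<lambda>G. of_bool (adj G a x) *
      \<bar>(\<Sum>(z, y)\<in>paths2 x. of_bool (adj G x z \<and> adj G z y \<and> adj G b y)) / ((real n)\<^sup>2 * p ^ 3) - 1\<bar>)
    \<le> 2 * p * sqrt (2 / (n * p) + 1 / ((real n)\<^sup>2 * p ^ 3) + 1 / ((real n)\<^sup>2 * p) + 14 / n)"
proof -
  define B where "B = (\<lambda>(z, y) G. adj G x z \<and> adj G z y \<and> adj G b y)"
  define \<eta> where "\<eta> = 2 / (n * p) + 1 / ((real n)\<^sup>2 * p ^ 3) + 1 / ((real n)\<^sup>2 * p)"
  have n0: "0 < real n" using n4 by simp
  have \<eta>0: "0 < \<eta>" unfolding \<eta>_def using p_pos n0 by (intro add_pos_pos) auto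
  have "expec (\<lambda>G. of_bool (adj G a x) *
      \<bar>(\<Sum>q\<in>paths2 x. of_bool (B q G)) / ((real n)\<^sup>2 * p ^ 3) - 1\<bar>) \<le> 2 * p * sqrt (\<eta> + 14 / n)"
  proof (rule expectation_deviation_le)
    show "measure_pmf.prob P {G. adj G a x} = p" using x by (rule prob_nbr_a)
    show "measure_pmf.prob P {G. adj G a x \<and> B q G} = p * p ^ 3" if "q \<in> paths2 x" for q
    proof -
      obtain z y where q: "q = (z, y)" by force
      show ?thesis using prob_5_cycle[of x y z] that x unfolding q B_def paths2_def
        by (simp add: eval_nat_numeral)
    qed
    define N where "N = real (card V)"
    define t where "t = (\<lambda>z y z' y' :: nat. p * (p ^ 6 + of_bool (z = z') * p ^ 5 + of_bool (y = y') * p ^ 5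
      + of_bool (z = z') * of_bool (y = y') * p ^ 3 + of_bool (z = y') * of_bool (y = z') * p ^ 5))"
    have t0: "0 \<le> t z y z' y'" for z y z' y' :: nat using p_pos by (simp add: t_def)
    have "(\<Sum>q\<in>paths2 x. \<Sum>q'\<in>paths2 x. measure_pmf.prob P {G. adj G a x \<and> B q G \<and> B q' G})
        \<le> (\<Sum>q\<in>paths2 x. \<Sum>q'\<in>paths2 x. t (fst q) (snd q) (fst q') (snd q'))"
    proof (intro sum_mono)
      fix q q' assume qq: "q \<in> paths2 x" "q' \<in> paths2 x"
      obtain z y z' y' where q: "q = (z, y)" "q' = (z', y')" by force
      show "measure_pmf.prob P {G. adj G a x \<and> B q G \<and> B q' G} \<le> t (fst q) (snd q) (fst q') (snd q')"
        using prob_two_5_cycles_le[of x y z y' z'] qq x unfolding q by (simp add: B_def t_def paths2_def)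
    qed
    also have "\<dots> \<le> (\<Sum>q\<in>V \<times> V. \<Sum>q'\<in>V \<times> V. t (fst q) (snd q) (fst q') (snd q'))"
    proof -
      have sub: "paths2 x \<subseteq> V \<times> V" by (auto simp: paths2_def)
      show ?thesis
        by (rule order_trans[OF sum_mono[OF sum_mono2] sum_mono2])
          (use sub t0 in \<open>auto intro!: sum_nonneg\<close>)
    qed
    also have "\<dots> = (\<Sum>z\<in>V. \<Sum>y\<in>V. \<Sum>z'\<in>V. \<Sum>y'\<in>V. t z y z' y')"
      by (simp add: sum.cartesian_product')
    also have "\<dots> = p * (N ^ 4 * p ^ 6 + 2 * (N ^ 3 * p ^ 5) + N ^ 2 * p ^ 3 + N ^ 2 * p ^ 5)"
    proof -
      have 1: "(\<Sum>y'\<in>V. t z y z' y') = p * (N * p ^ 6 + of_bool (z = z') * (N * p ^ 5) + p ^ 5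
        + of_bool (z = z') * p ^ 3 + of_bool (y = z') * p ^ 5)" if "z \<in> V" "y \<in> V" for z y z'
        using that unfolding t_def
        by (simp only: sum.distrib sum_distrib_left[symmetric] sum_distrib_right[symmetric]
            sum_of_bool_eq_left[OF finite_V]) (simp add: N_def)
      have 2: "(\<Sum>z'\<in>V. p * (N * p ^ 6 + of_bool (z = z') * (N * p ^ 5) + p ^ 5
        + of_bool (z = z') * p ^ 3 + of_bool (y = z') * p ^ 5)) =
        p * (N * (N * p ^ 6) + N * p ^ 5 + N * p ^ 5 + p ^ 3 + p ^ 5)" if "z \<in> V" "y \<in> V" for z y
        using that
        by (simp only: sum.distrib sum_distrib_left[symmetric] sum_distrib_right[symmetric]
            sum_of_bool_eq_left[OF finite_V]) (simp add: N_def)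
      have "(\<Sum>z\<in>V. \<Sum>y\<in>V. \<Sum>z'\<in>V. \<Sum>y'\<in>V. t z y z' y') =
          (\<Sum>z\<in>V. \<Sum>y\<in>V. p * (N * (N * p ^ 6) + N * p ^ 5 + N * p ^ 5 + p ^ 3 + p ^ 5))"
        by (intro sum.cong refl) (simp add: 1 2)
      also have "\<dots> = N * (N * (p * (N * (N * p ^ 6) + N * p ^ 5 + N * p ^ 5 + p ^ 3 + p ^ 5)))"
        by (simp add: N_def)
      also have "\<dots> = p * (N ^ 4 * p ^ 6 + 2 * (N ^ 3 * p ^ 5) + N ^ 2 * p ^ 3 + N ^ 2 * p ^ 5)"
        by algebra
      finally show ?thesis .
    qed
    also have "\<dots> \<le> p * (real n ^ 4 * p ^ 6 + 2 * (real n ^ 3 * p ^ 5) + real n ^ 2 * p ^ 3 + real n ^ 2 * p ^ 5)"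
    proof -
      have "N \<le> n" "0 \<le> N" by (auto simp: N_def card_V)
      then show ?thesis using p_pos
        by (intro mult_left_mono add_mono mult_right_mono power_mono) auto
    qed
    also have "\<dots> = p * ((real n)\<^sup>2 * p ^ 3)\<^sup>2 * (1 + \<eta>)"
      using p_pos n0 unfolding \<eta>_def by (simp add: field_simps eval_nat_numeral)
    finally show "(\<Sum>q\<in>paths2 x. \<Sum>q'\<in>paths2 x. measure_pmf.prob P {G. adj G a x \<and> B q G \<and> B q' G})
      \<le> p * ((real n)\<^sup>2 * p ^ 3)\<^sup>2 * (1 + \<eta>)" .
    \<comment> \<open>The nominal \<open>n^2\<close> exceeds the number of paths by
      \<open>7 n - 12\<close>; twice the relative defect is at most \<open>14 / n\<close>.\<close>
    have "real ((n - 3) * (n - 4)) = (real n - 3) * (real n - 4)"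
      using n4 by (simp add: of_nat_diff)
    then have "1 - card (paths2 x) / (real n)\<^sup>2 = (7 * real n - 12) / (real n)\<^sup>2"
      using n0 n4 by (simp add: card_paths2[OF x] field_simps power2_eq_square of_nat_diff)
    also have "\<dots> \<le> (7 * real n) / (real n)\<^sup>2" by (intro divide_right_mono) auto
    also have "\<dots> = 7 / n" using n0 by (simp add: power2_eq_square)
    finally show "\<eta> + 2 * (1 - card (paths2 x) / (real n)\<^sup>2) \<le> \<eta> + 14 / n" by simp
    show "0 < \<eta> + 14 / n" using \<eta>0 n0 by (intro add_pos_nonneg) auto
  qed (use p_pos n0 in auto)
  then show ?thesis unfolding B_def \<eta>_def split_def by simp
qed

section \<open>Degrees, and neighbours close to the other neighbourhood\<close>

lemma nbrs_a_eq: "G \<in> set_pmf P \<Longrightarrow> nbrs n G a = insert b {x \<in> V. adj G a x}"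
  using edge_P[of G] a_less b_less a_neq_b by (auto simp: nbrs_def V_def adj_def)

lemma nbrs_b_eq: "G \<in> set_pmf P \<Longrightarrow> nbrs n G b = insert a {x \<in> V. adj G b x}"
  using edge_gnp.nbrs_a_eq[OF swap] by (simp add: V_swap gnp_edge_commute)

lemma sum_nbrs_a:
  "G \<in> set_pmf P \<Longrightarrow> (\<Sum>x\<in>nbrs n G a. f x :: real) = f b + (\<Sum>x\<in>V. of_bool (adj G a x) * f x)"
proof -
  assume G: "G \<in> set_pmf P"
  have "(\<Sum>x\<in>{x \<in> V. adj G a x}. f x) = (\<Sum>x\<in>V. of_bool (adj G a x) * f x)"
    by (simp add: Int_def)
  moreover have "b \<notin> {x \<in> V. adj G a x}" by (simp add: V_def)
  ultimately show ?thesis by (simp add: nbrs_a_eq[OF G])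
qed

lemma sum_nbrs_b:
  "G \<in> set_pmf P \<Longrightarrow> (\<Sum>x\<in>nbrs n G b. f x :: real) = f a + (\<Sum>x\<in>V. of_bool (adj G b x) * f x)"
proof -
  assume G: "G \<in> set_pmf P"
  have "(\<Sum>x\<in>{x \<in> V. adj G b x}. f x) = (\<Sum>x\<in>V. of_bool (adj G b x) * f x)"
    by (simp add: Int_def)
  moreover have "a \<notin> {x \<in> V. adj G b x}" by (simp add: V_def)
  ultimately show ?thesis by (simp add: nbrs_b_eq[OF G])
qed

lemma card_nbrs_a: "G \<in> set_pmf P \<Longrightarrow> real (card (nbrs n G a)) = 1 + (\<Sum>x\<in>V. of_bool (adj G a x))"
  using sum_nbrs_a[of G "\<lambda>_. 1"] by simp

text \<open>The last summand pays for the known neighbour at the other end of the edge, which lies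
  outside \<open>V\<close>.\<close>

definition deg_err :: real where
  "deg_err = 2 * sqrt (1 / (n * p) + 4 / n) + 1 / (n * p)"

lemma np_pos: "0 < real n * p"
  using n_ge_2 p_pos by simp

lemma expectation_deg_a: "expec (\<lambda>G. \<bar>card (nbrs n G a) / (n * p) - 1\<bar>) \<le> deg_err"
proof -
  have "expec (\<lambda>G. \<bar>card (nbrs n G a) / (n * p) - 1\<bar>)
      \<le> expec (\<lambda>G. \<bar>(\<Sum>x\<in>V. of_bool (adj G a x)) / (n * p) - 1\<bar> + 1 / (n * p))"
  proof (rule expectation_mono_pmf[OF finite_P])
    fix G assume G: "G \<in> set_pmf P"
    have "card (nbrs n G a) / (n * p) - 1 = ((\<Sum>x\<in>V. of_bool (adj G a x)) / (n * p) - 1) + 1 / (n * p)"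
      by (simp add: card_nbrs_a[OF G] add_divide_distrib)
    then show "\<bar>card (nbrs n G a) / (n * p) - 1\<bar>
        \<le> \<bar>(\<Sum>x\<in>V. of_bool (adj G a x)) / (n * p) - 1\<bar> + 1 / (n * p)"
      using np_pos by (smt (verit) zero_less_divide_1_iff)
  qed
  also have "\<dots> \<le> deg_err"
    using expectation_nbr_deviation by (simp add: deg_err_def)
  finally show ?thesis .
qed

lemma expectation_deg_b: "expec (\<lambda>G. \<bar>card (nbrs n G b) / (n * p) - 1\<bar>) \<le> deg_err"
  using edge_gnp.expectation_deg_a[OF swap] by (simp add: gnp_edge_commute edge_gnp.deg_err_def[OF swap] deg_err_def)

text \<open>The neighbours of \<open>a\<close> that may lie within distance 1 (respectively 2) of a neighbour of \<open>b\<close>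
  other than \<open>a\<close>.\<close>

definition near2 :: "(nat set \<Rightarrow> bool) \<Rightarrow> nat set" where
  "near2 G = {x \<in> V. adj G a x \<and> (adj G b x \<or> (\<exists>y\<in>V - {x}. adj G b y \<and> adj G x y))}"

definition near3 :: "(nat set \<Rightarrow> bool) \<Rightarrow> nat set" where
  "near3 G = {x \<in> V. adj G a x \<and> (adj G b x \<or> (\<exists>y\<in>V - {x}. adj G b y \<and> adj G x y)
    \<or> (\<exists>y\<in>V - {x}. adj G b y \<and> adj G a y)
    \<or> (\<exists>(z, y)\<in>paths2 x. adj G x z \<and> adj G z y \<and> adj G b y))}"

lemma finite_near2 [simp]: "finite (near2 G)" and finite_near3 [simp]: "finite (near3 G)"
  by (simp_all add: near2_def near3_def)

lemma far2:
  assumes G: "G \<in> set_pmf P" and u: "u \<in> nbrs n G a - insert b (near2 G)" and v: "v \<in> nbrs n G b - {a}"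
  shows "enat 2 \<le> gdist n G u v"
proof (rule gdist_ge_2)
  have "u \<in> V" "adj G a u" "v \<in> V" "adj G b v" "u \<notin> near2 G"
    using u v by (auto simp: nbrs_a_eq[OF G] nbrs_b_eq[OF G])
  then show "u \<noteq> v" "\<not> adj G u v" by (auto simp: near2_def)
qed

lemma far3:
  assumes G: "G \<in> set_pmf P" and u: "u \<in> nbrs n G a - insert b (near3 G)" and v: "v \<in> nbrs n G b - {a}"
  shows "enat 3 \<le> gdist n G u v"
proof (rule gdist_ge_3)
  have uv: "u \<in> V" "adj G a u" "v \<in> V" "adj G b v" "u \<notin> near3 G"
    using u v by (auto simp: nbrs_a_eq[OF G] nbrs_b_eq[OF G])
  then show ne: "u \<noteq> v" "\<not> adj G u v" by (auto simp: near3_def)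
  fix z assume z: "z < n" "adj G u z" "adj G z v"
  \<comment> \<open>A path of length 2 through \<open>a\<close> makes \<open>v\<close> a common
    neighbour of \<open>a\<close> and \<open>b\<close>, one through \<open>b\<close> makes
    \<open>u\<close> a common neighbour, and one through \<open>V\<close> closes a 5-cycle with the
    edge; \<open>near3\<close> lists all three.\<close>
  consider "z = a" | "z = b" | "z \<in> V" using z by (auto simp: V_def)
  then show False
  proof cases
    case 3
    have "distinct [u, v, z]" using ne z by (auto simp: adj_def)
    with 3 uv have "(z, v) \<in> paths2 u" by (auto simp: paths2_def)
    with uv z show False by (auto simp: near3_def)
  qed (use uv z ne in \<open>auto simp: near3_def adj_commute\<close>)
qed

lemma card_eq_sum_of_bool: "finite A \<Longrightarrow> real (card {x \<in> A. Q x}) = (\<Sum>x\<in>A. of_bool (Q x))"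
  by (simp add: Int_def)

lemma of_bool_Bex_le:
  "finite A \<Longrightarrow> (of_bool (\<exists>x\<in>A. Q x) :: real) \<le> (\<Sum>x\<in>A. of_bool (Q x))"
proof (cases "\<exists>x\<in>A. Q x")
  case True
  assume "finite A"
  then obtain x where x: "x \<in> A" "Q x" using True by auto
  have "(of_bool (Q x) :: real) \<le> (\<Sum>x\<in>A. of_bool (Q x))"
    using \<open>finite A\<close> x(1) by (intro member_le_sum) auto
  with x True show ?thesis by simp
qed (auto intro: sum_nonneg)

lemma card_V_le: "real (card V) \<le> n" "real (card (V - {x})) \<le> n"
  using card_Diff1_le[of V x] by (auto simp: card_V)

lemma sum_V_le:
  fixes f :: "nat \<Rightarrow> real" and c :: real
  assumes "\<And>x. x \<in> V \<Longrightarrow> f x \<le> c" "0 \<le> c"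
  shows "(\<Sum>x\<in>V. f x) \<le> n * c"
proof -
  have "(\<Sum>x\<in>V. f x) \<le> card V * c" using assms(1) by (intro sum_bounded_above)
  also have "\<dots> \<le> n * c" using card_V_le assms(2) by (intro mult_right_mono)
  finally show ?thesis .
qed

lemma sum_V_minus_le:
  fixes f :: "nat \<Rightarrow> real" and c :: real
  assumes "\<And>y. y \<in> V - {x} \<Longrightarrow> f y \<le> c" "0 \<le> c"
  shows "(\<Sum>y\<in>V - {x}. f y) \<le> n * c"
proof -
  have "(\<Sum>y\<in>V - {x}. f y) \<le> card (V - {x}) * c" using assms(1) by (intro sum_bounded_above)
  also have "\<dots> \<le> n * c" using card_V_le assms(2) by (intro mult_right_mono)
  finally show ?thesis .
qed

text \<open>Union bound over triangles and 4-cycles on the edge \<open>{a, b}\<close>.\<close>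

lemma expectation_near2: "expec (\<lambda>G. card (near2 G)) \<le> n * p\<^sup>2 + (real n)\<^sup>2 * p ^ 3"
proof -
  have "expec (\<lambda>G. card (near2 G)) \<le> expec (\<lambda>G. \<Sum>x\<in>V. of_bool (adj G a x \<and> adj G b x)
      + (\<Sum>y\<in>V - {x}. of_bool (adj G a x \<and> adj G b y \<and> adj G x y)))"
  proof (rule expectation_mono_pmf[OF finite_P])
    fix G
    have "real (card (near2 G)) = (\<Sum>x\<in>V. of_bool (adj G a x \<and>
        (adj G b x \<or> (\<exists>y\<in>V - {x}. adj G b y \<and> adj G x y))))"
      unfolding near2_def by (rule card_eq_sum_of_bool) simp
    also have "\<dots> \<le> (\<Sum>x\<in>V. of_bool (adj G a x \<and> adj G b x)
      + (\<Sum>y\<in>V - {x}. of_bool (adj G a x \<and> adj G b y \<and> adj G x y)))"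
    proof (rule sum_mono)
      fix x
      show "of_bool (adj G a x \<and> (adj G b x \<or> (\<exists>y\<in>V - {x}. adj G b y \<and> adj G x y)))
        \<le> of_bool (adj G a x \<and> adj G b x) + (\<Sum>y\<in>V - {x}. of_bool (adj G a x \<and> adj G b y \<and> adj G x y) :: real)"
        using of_bool_Bex_le[of "V - {x}" "\<lambda>y. adj G b y \<and> adj G x y"] by (cases "adj G a x"; cases "adj G b x") auto
    qed
    finally show "real (card (near2 G)) \<le> (\<Sum>x\<in>V. of_bool (adj G a x \<and> adj G b x)
      + (\<Sum>y\<in>V - {x}. of_bool (adj G a x \<and> adj G b y \<and> adj G x y)))" .
  qed
  also have "\<dots> = (\<Sum>x\<in>V. p\<^sup>2 + (\<Sum>y\<in>V - {x}. p ^ 3))"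
  proof -
    have "expec (\<lambda>G. \<Sum>x\<in>V. of_bool (adj G a x \<and> adj G b x)
        + (\<Sum>y\<in>V - {x}. of_bool (adj G a x \<and> adj G b y \<and> adj G x y))) =
      (\<Sum>x\<in>V. measure_pmf.prob P {G. adj G a x \<and> adj G b x}
        + (\<Sum>y\<in>V - {x}. measure_pmf.prob P {G. adj G a x \<and> adj G b y \<and> adj G x y}))"
      by (simp only: Bochner_Integration.integral_sum Bochner_Integration.integral_add integ expectation_of_bool)
    also have "\<dots> = (\<Sum>x\<in>V. p\<^sup>2 + (\<Sum>y\<in>V - {x}. p ^ 3))"
      by (intro sum.cong refl arg_cong2[where f = "(+)"] prob_common prob_4_cycle) auto
    finally show ?thesis .
  qed
  also have "\<dots> \<le> n * (p\<^sup>2 + n * p ^ 3)"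
    using p_pos by (intro sum_V_le add_left_mono sum_V_minus_le) auto
  finally show ?thesis by (simp add: algebra_simps power2_eq_square)
qed

text \<open>Besides 5-cycles, of order \<open>n^3 p^4\<close>, there is a second
  \<open>n^2 p^3\<close>: one common neighbour of \<open>a\<close> and \<open>b\<close> brings every
  other neighbour of \<open>a\<close> within distance 2 of it.\<close>

lemma expectation_near3:
  "expec (\<lambda>G. card (near3 G)) \<le> n * p\<^sup>2 + 2 * (real n)\<^sup>2 * p ^ 3 + (real n) ^ 3 * p ^ 4"
proof -
  define T where "T = (\<lambda>x G. of_bool (adj G a x \<and> adj G b x)
      + (\<Sum>y\<in>V - {x}. of_bool (adj G a x \<and> adj G b y \<and> adj G x y))
      + (\<Sum>y\<in>V - {x}. of_bool (adj G a x \<and> adj G b y \<and> adj G a y))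
      + (\<Sum>q\<in>paths2 x. of_bool (adj G a x \<and> adj G x (fst q) \<and> adj G (fst q) (snd q) \<and> adj G b (snd q)) :: real))"
  have "expec (\<lambda>G. card (near3 G)) \<le> expec (\<lambda>G. \<Sum>x\<in>V. T x G)"
  proof (rule expectation_mono_pmf[OF finite_P])
    fix G
    have "real (card (near3 G)) = (\<Sum>x\<in>V. of_bool (adj G a x \<and>
        (adj G b x \<or> (\<exists>y\<in>V - {x}. adj G b y \<and> adj G x y) \<or> (\<exists>y\<in>V - {x}. adj G b y \<and> adj G a y)
    \<or> (\<exists>(z, y)\<in>paths2 x. adj G x z \<and> adj G z y \<and> adj G b y))))"
      unfolding near3_def by (rule card_eq_sum_of_bool) simp
    also have "\<dots> \<le> (\<Sum>x\<in>V. T x G)"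
    proof (rule sum_mono)
      fix x
      have or_le: "of_bool (A \<or> B \<or> C \<or> D) \<le> (of_bool A + of_bool B + of_bool C + of_bool D :: real)" for A B C D
        by auto
      show "of_bool (adj G a x \<and> (adj G b x \<or> (\<exists>y\<in>V - {x}. adj G b y \<and> adj G x y)
         \<or> (\<exists>y\<in>V - {x}. adj G b y \<and> adj G a y)
         \<or> (\<exists>(z, y)\<in>paths2 x. adj G x z \<and> adj G z y \<and> adj G b y))) \<le> T x G"
      proof (cases "adj G a x")
        case True
        then show ?thesis
          using of_bool_Bex_le[of "V - {x}" "\<lambda>y. adj G b y \<and> adj G x y"]
            of_bool_Bex_le[of "V - {x}" "\<lambda>y. adj G b y \<and> adj G a y"]
            of_bool_Bex_le[of "paths2 x" "\<lambda>q. adj G x (fst q) \<and> adj G (fst q) (snd q) \<and> adj G b (snd q)"]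
            or_le[of "adj G b x" "\<exists>y\<in>V - {x}. adj G b y \<and> adj G x y" "\<exists>y\<in>V - {x}. adj G b y \<and> adj G a y"
              "\<exists>(z, y)\<in>paths2 x. adj G x z \<and> adj G z y \<and> adj G b y"]
          unfolding T_def split_def by (simp only: True simp_thms finite_V finite_Diff finite_paths2) linarith
      qed (simp add: T_def)
    qed
    finally show "real (card (near3 G)) \<le> (\<Sum>x\<in>V. T x G)" .
  qed
  also have "\<dots> = (\<Sum>x\<in>V. expec (T x))" by simp
  also have "\<dots> \<le> n * (p\<^sup>2 + n * p ^ 3 + n * p ^ 3 + (real n)\<^sup>2 * p ^ 4)"
  proof (rule sum_V_le)
    fix x assume x: "x \<in> V"
    have paths: "expec (\<lambda>G. \<Sum>q\<in>paths2 x. of_bool (adj G a x \<and> adj G x (fst q) \<and> adj G (fst q) (snd q) \<and> adj G b (snd q)))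
        \<le> (real n)\<^sup>2 * p ^ 4"
    proof -
      have "expec (\<lambda>G. \<Sum>q\<in>paths2 x. of_bool (adj G a x \<and> adj G x (fst q) \<and> adj G (fst q) (snd q) \<and> adj G b (snd q)))
        = (\<Sum>q\<in>paths2 x. measure_pmf.prob P {G. adj G a x \<and> adj G x (fst q) \<and> adj G (fst q) (snd q) \<and> adj G b (snd q)})"
        by (simp only: Bochner_Integration.integral_sum integ expectation_of_bool)
      also have "\<dots> = (\<Sum>q\<in>paths2 x. p ^ 4)"
        using x by (intro sum.cong refl prob_5_cycle) (auto simp: paths2_def)
      also have "\<dots> \<le> (real n)\<^sup>2 * p ^ 4"
      proof -
        have "(n - 3) * (n - 4) \<le> n * n" by (intro mult_mono) auto
        then have "real ((n - 3) * (n - 4)) \<le> real (n * n)" by (rule of_nat_mono)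
        then show ?thesis using x p_pos by (simp add: card_paths2 power2_eq_square)
      qed
      finally show ?thesis .
    qed
    have c4: "(\<Sum>y\<in>V - {x}. expec (\<lambda>G. of_bool (adj G a x \<and> adj G b y \<and> adj G x y))) \<le> n * p ^ 3"
      using x p_pos by (intro sum_V_minus_le) (auto simp: expectation_of_bool prob_4_cycle)
    have c3: "(\<Sum>y\<in>V - {x}. expec (\<lambda>G. of_bool (adj G a x \<and> adj G b y \<and> adj G a y))) \<le> n * p ^ 3"
      using x p_pos by (intro sum_V_minus_le) (auto simp: expectation_of_bool prob_pendant_triangle)
    have "expec (T x) = expec (\<lambda>G. of_bool (adj G a x \<and> adj G b x))
      + (\<Sum>y\<in>V - {x}. expec (\<lambda>G. of_bool (adj G a x \<and> adj G b y \<and> adj G x y)))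
      + (\<Sum>y\<in>V - {x}. expec (\<lambda>G. of_bool (adj G a x \<and> adj G b y \<and> adj G a y)))
      + expec (\<lambda>G. \<Sum>q\<in>paths2 x. of_bool (adj G a x \<and> adj G x (fst q) \<and> adj G (fst q) (snd q) \<and> adj G b (snd q)))"
      unfolding T_def by (simp only: Bochner_Integration.integral_sum Bochner_Integration.integral_add integ)
    then show "expec (T x) \<le> p\<^sup>2 + n * p ^ 3 + n * p ^ 3 + (real n)\<^sup>2 * p ^ 4"
      using paths c4 c3 prob_common[OF x] by (simp only: expectation_of_bool)
  qed (use p_pos in auto)
  finally show ?thesis by (simp add: algebra_simps eval_nat_numeral)
qed

lemma card_insert_le_real: "finite A \<Longrightarrow> real (card (insert x A)) \<le> real (card A) + 1"
  by (simp add: card_insert_if)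

text \<open>The bound \<open>- 2\<close> from below holds for every graph, so only the dual side is
  needed. Besides \<open>near3\<close>, the vertices \<open>b\<close> and \<open>a\<close> are
  exceptional, being adjacent to the opposite neighbourhoods.\<close>

lemma expectation_ricci_sparse:
  "expec (\<lambda>G. \<bar>ricci n G a b - (- 2)\<bar>)
    \<le> 3 * (p + 2 * real n * p\<^sup>2 + (real n)\<^sup>2 * p ^ 3 + 2 / (n * p) + 2 * deg_err)"
proof -
  let ?D = "real n * p"
  let ?da = "\<lambda>G. \<bar>card (nbrs n G a) / ?D - 1\<bar>" and ?db = "\<lambda>G. \<bar>card (nbrs n G b) / ?D - 1\<bar>"
  have "expec (\<lambda>G. \<bar>ricci n G a b - (- 2)\<bar>)
      \<le> expec (\<lambda>G. 3 * (card (near3 G) / ?D + 2 / ?D + ?da G + ?db G))"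
  proof (rule expectation_mono_pmf[OF finite_P])
    fix G assume G: "G \<in> set_pmf P"
    interpret graph_edge n G a b using G by (rule graph_edge_P)
    have "ricci n G a b \<le> 1 - real 3
        + real 3 * (card (insert b (near3 G)) / ?D + card {a} / ?D + ?da G + ?db G)"
      using far3[OF G] b_in_Na a_in_Nb np_pos
      by (intro ricci_le_exceptional) (auto simp: near3_def nbrs_a_eq[OF G])
    moreover have "card (insert b (near3 G)) / ?D \<le> (card (near3 G) + 1) / ?D"
      using np_pos card_insert_le_real[OF finite_near3, of b G] by (intro divide_right_mono) auto
    moreover have "(card (near3 G) + 1) / ?D = card (near3 G) / ?D + 1 / ?D" "2 / ?D = 1 / ?D + 1 / ?D"
      "real (card {a}) / ?D = 1 / ?D" by (simp_all add: add_divide_distrib)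
    ultimately show "\<bar>ricci n G a b - (- 2)\<bar> \<le> 3 * (card (near3 G) / ?D + 2 / ?D + ?da G + ?db G)"
      using ricci_ge by (simp only: of_nat_numeral abs_le_iff) argo
  qed
  also have "\<dots> = 3 * (expec (\<lambda>G. card (near3 G)) / ?D + 2 / ?D + expec ?da + expec ?db)"
    by simp
  also have "\<dots> \<le> 3 * ((n * p\<^sup>2 + 2 * (real n)\<^sup>2 * p ^ 3 + (real n) ^ 3 * p ^ 4) / ?D + 2 / ?D + deg_err + deg_err)"
    using np_pos by (intro mult_left_mono add_mono divide_right_mono expectation_near3 expectation_deg_a
      expectation_deg_b) auto
  also have "(n * p\<^sup>2 + 2 * (real n)\<^sup>2 * p ^ 3 + (real n) ^ 3 * p ^ 4) / ?D = p + 2 * real n * p\<^sup>2 + (real n)\<^sup>2 * p ^ 3"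
  proof -
    have "n * p\<^sup>2 + 2 * (real n)\<^sup>2 * p ^ 3 + (real n) ^ 3 * p ^ 4 = (p + 2 * real n * p\<^sup>2 + (real n)\<^sup>2 * p ^ 3) * ?D" by algebra
    moreover have "?D \<noteq> 0" using np_pos by linarith
    ultimately show ?thesis by (metis nonzero_mult_div_cancel_right)
  qed
  finally show ?thesis by simp
qed

section \<open>The plan along paths of length 2\<close>

lemma sum_paths2:
  "x \<in> V \<Longrightarrow> (\<Sum>(z, y)\<in>paths2 x. f z y :: real) = (\<Sum>y\<in>V. \<Sum>z\<in>V. of_bool (distinct [x, y, z]) * f z y)"
proof -
  have "(\<Sum>(z, y)\<in>paths2 x. f z y) = (\<Sum>q\<in>{q \<in> V \<times> V. distinct [x, snd q, fst q]}. f (fst q) (snd q))"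
    unfolding paths2_def split_def by (intro sum.cong) auto
  also have "\<dots> = (\<Sum>q\<in>V \<times> V. if distinct [x, snd q, fst q] then f (fst q) (snd q) else 0)"
    by (rule sum.inter_filter) simp
  also have "\<dots> = (\<Sum>z\<in>V. \<Sum>y\<in>V. if distinct [x, y, z] then f z y else 0)"
    by (simp only: sum.cartesian_product' fst_conv snd_conv)
  also have "\<dots> = (\<Sum>z\<in>V. \<Sum>y\<in>V. of_bool (distinct [x, y, z]) * f z y)"
    by (intro sum.cong) auto
  also have "\<dots> = (\<Sum>y\<in>V. \<Sum>z\<in>V. of_bool (distinct [x, y, z]) * f z y)"
    by (rule sum.swap)
  finally show ?thesis .
qed

lemma paths2_swap: "edge_gnp.paths2 n b a = paths2"
  unfolding edge_gnp.paths2_def[OF swap] paths2_def V_swap ..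

text \<open>Each of at most \<open>n\<close> rows contributes \<open>2 p c\<close>, and division by
  \<open>n p\<close> leaves \<open>2 c\<close>. The summand \<open>1 / (n p)\<close> is the
  deviation of the one endpoint row, to which the plans assign no mass.\<close>

lemma expectation_row_error:
  fixes X :: "nat \<Rightarrow> (nat set \<Rightarrow> bool) \<Rightarrow> real"
  assumes "\<And>x. x \<in> V \<Longrightarrow> expec (\<lambda>G. of_bool (adj G a x) * \<bar>X x G\<bar>) \<le> 2 * p * c" "0 \<le> c"
  shows "expec (\<lambda>G. 1 / (n * p) + (\<Sum>x\<in>V. of_bool (adj G a x) * \<bar>X x G\<bar>) / (n * p)) \<le> 1 / (n * p) + 2 * c"
proof -
  have "expec (\<lambda>G. 1 / (n * p) + (\<Sum>x\<in>V. of_bool (adj G a x) * \<bar>X x G\<bar>) / (n * p)) =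
      1 / (n * p) + (\<Sum>x\<in>V. expec (\<lambda>G. of_bool (adj G a x) * \<bar>X x G\<bar>)) / (n * p)"
    by (simp only: Bochner_Integration.integral_sum Bochner_Integration.integral_add integ
        integral_divide_zero lebesgue_integral_const) simp
  also have "\<dots> \<le> 1 / (n * p) + (n * (2 * p * c)) / (n * p)"
    using assms p_pos np_pos by (intro add_left_mono divide_right_mono sum_V_le) auto
  also have "\<dots> = 1 / (n * p) + 2 * c" using p_pos n_ge_2 by simp
  finally show ?thesis .
qed

definition row_count2 :: "nat \<Rightarrow> nat \<Rightarrow> (nat set \<Rightarrow> bool) \<Rightarrow> real" where
  "row_count2 c x G = (\<Sum>(z, y)\<in>paths2 x. of_bool (adj G x z \<and> adj G z y \<and> adj G c y))"

definition path_err :: real where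
  "path_err = sqrt (2 / (n * p) + 1 / ((real n)\<^sup>2 * p ^ 3) + 1 / ((real n)\<^sup>2 * p) + 14 / n)"

lemma path_err_nonneg: "0 \<le> path_err"
  using p_pos by (simp add: path_err_def)

lemma expectation_row2_a:
  "x \<in> V \<Longrightarrow> 4 \<le> n \<Longrightarrow>
    expec (\<lambda>G. of_bool (adj G a x) * \<bar>row_count2 b x G / ((real n)\<^sup>2 * p ^ 3) - 1\<bar>) \<le> 2 * p * path_err"
  unfolding row_count2_def path_err_def by (rule expectation_row_deviation_2)

lemma expectation_row2_b:
  "x \<in> V \<Longrightarrow> 4 \<le> n \<Longrightarrow>
    expec (\<lambda>G. of_bool (adj G b x) * \<bar>row_count2 a x G / ((real n)\<^sup>2 * p ^ 3) - 1\<bar>) \<le> 2 * p * path_err"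
  using edge_gnp.expectation_row2_a[OF swap]
  by (simp add: edge_gnp.row_count2_def[OF swap] row_count2_def paths2_swap gnp_edge_commute V_swap
      edge_gnp.path_err_def[OF swap] path_err_def)

lemma expectation_row2_error_b:
  assumes "4 \<le> n"
  shows "expec (\<lambda>G. 1 / (n * p) + (\<Sum>x\<in>V. of_bool (adj G b x) * \<bar>row_count2 a x G / ((real n)\<^sup>2 * p ^ 3) - 1\<bar>) / (n * p))
    \<le> 1 / (n * p) + 2 * path_err"
  using edge_gnp.expectation_row_error[OF swap,
      of "\<lambda>x G. row_count2 a x G / ((real n)\<^sup>2 * p ^ 3) - 1" path_err] expectation_row2_b assms path_err_nonneg
  by (simp add: gnp_edge_commute V_swap)

text \<open>The plan moves mass from \<open>u\<close> to \<open>v\<close> in proportion to the number of paths of length 2.\<close>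

lemma ricci_ge_2_paths:
  assumes G: "G \<in> set_pmf P"
  defines "D \<equiv> real n * p" and "m \<equiv> (real n)\<^sup>2 * p ^ 3"
  shows "ricci n G a b \<ge> - 1 - 5 * (
      (1 / D + (\<Sum>x\<in>V. of_bool (adj G a x) * \<bar>row_count2 b x G / m - 1\<bar>) / D)
    + (1 / D + (\<Sum>x\<in>V. of_bool (adj G b x) * \<bar>row_count2 a x G / m - 1\<bar>) / D)
    + \<bar>card (nbrs n G a) / D - 1\<bar> + \<bar>card (nbrs n G b) / D - 1\<bar>)"
proof -
  interpret graph_edge n G a b using G by (rule graph_edge_P)
  have D: "0 < D" and m: "0 < m" using np_pos p_pos n_ge_2 by (auto simp: D_def m_def)
  \<comment> \<open>With the denominator \<open>m * D\<close>, a row with exactly the nominal number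
    \<open>m\<close> of paths sums to \<open>1 / D\<close>.\<close>
  define w where "w u v = (\<Sum>z\<in>V. of_bool (u \<in> V \<and> v \<in> V \<and> distinct [u, v, z] \<and> adj G u z \<and> adj G z v)) / (m * D)"
    for u v
  have w0: "0 \<le> w u v" for u v using D m by (auto simp: w_def intro!: divide_nonneg_nonneg sum_nonneg)
  have wV: "w u v = 0" if "u \<notin> V \<or> v \<notin> V" for u v using that by (auto simp: w_def)
  have ab: "a \<notin> V" "b \<notin> V" by (auto simp: V_def)
  have row: "(\<Sum>v\<in>nbrs n G b. w u v) = row_count2 b u G / (m * D)" if u: "u \<in> V" for u
  proof -
    have "(\<Sum>v\<in>nbrs n G b. w u v) = (\<Sum>y\<in>V. of_bool (adj G b y) * w u y)"
      using sum_nbrs_b[OF G] wV ab by simp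
    also have "\<dots> = (\<Sum>y\<in>V. \<Sum>z\<in>V. of_bool (distinct [u, y, z]) * of_bool (adj G u z \<and> adj G z y \<and> adj G b y)) / (m * D)"
      unfolding w_def sum_divide_distrib sum_distrib_left using u by (intro sum.cong) auto
    finally show ?thesis unfolding row_count2_def sum_paths2[OF u] .
  qed
  have col: "(\<Sum>u\<in>nbrs n G a. w u v) = row_count2 a v G / (m * D)" if v: "v \<in> V" for v
  proof -
    have "(\<Sum>u\<in>nbrs n G a. w u v) = (\<Sum>y\<in>V. of_bool (adj G a y) * w y v)"
      using sum_nbrs_a[OF G] wV ab by simp
    also have "\<dots> = (\<Sum>y\<in>V. \<Sum>z\<in>V. of_bool (distinct [v, y, z]) * of_bool (adj G v z \<and> adj G z y \<and> adj G a y)) / (m * D)"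
      unfolding w_def sum_divide_distrib sum_distrib_left using v
      by (intro sum.cong) (auto simp: adj_commute)
    finally show ?thesis unfolding row_count2_def sum_paths2[OF v] .
  qed
  have dev: "\<bar>c / (m * D) - 1 / D\<bar> = \<bar>c / m - 1\<bar> / D" for c
  proof -
    have "c / (m * D) - 1 / D = (c / m - 1) / D" by (simp add: diff_divide_distrib)
    then show ?thesis using D by (simp add: abs_divide)
  qed
  define Sa where "Sa = 1 / D + (\<Sum>x\<in>V. of_bool (adj G a x) * \<bar>row_count2 b x G / m - 1\<bar>) / D"
  define Sb where "Sb = 1 / D + (\<Sum>x\<in>V. of_bool (adj G b x) * \<bar>row_count2 a x G / m - 1\<bar>) / D"
  have Sa: "(\<Sum>u\<in>nbrs n G a. \<bar>(\<Sum>v\<in>nbrs n G b. w u v) - 1 / D\<bar>) = Sa"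
  proof -
    have "(\<Sum>u\<in>nbrs n G a. \<bar>(\<Sum>v\<in>nbrs n G b. w u v) - 1 / D\<bar>)
      = 1 / D + (\<Sum>x\<in>V. of_bool (adj G a x) * \<bar>(\<Sum>v\<in>nbrs n G b. w x v) - 1 / D\<bar>)"
      using D wV ab by (subst sum_nbrs_a[OF G]) simp
    also have "(\<Sum>x\<in>V. of_bool (adj G a x) * \<bar>(\<Sum>v\<in>nbrs n G b. w x v) - 1 / D\<bar>)
      = (\<Sum>x\<in>V. of_bool (adj G a x) * \<bar>row_count2 b x G / m - 1\<bar> / D)"
      by (intro sum.cong refl) (simp add: row dev)
    finally show ?thesis by (simp only: Sa_def sum_divide_distrib)
  qed
  have Sb: "(\<Sum>v\<in>nbrs n G b. \<bar>(\<Sum>u\<in>nbrs n G a. w u v) - 1 / D\<bar>) = Sb"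
  proof -
    have "(\<Sum>v\<in>nbrs n G b. \<bar>(\<Sum>u\<in>nbrs n G a. w u v) - 1 / D\<bar>)
      = 1 / D + (\<Sum>x\<in>V. of_bool (adj G b x) * \<bar>(\<Sum>u\<in>nbrs n G a. w u x) - 1 / D\<bar>)"
      using D wV ab by (subst sum_nbrs_b[OF G]) simp
    also have "(\<Sum>x\<in>V. of_bool (adj G b x) * \<bar>(\<Sum>u\<in>nbrs n G a. w u x) - 1 / D\<bar>)
      = (\<Sum>x\<in>V. of_bool (adj G b x) * \<bar>row_count2 a x G / m - 1\<bar> / D)"
      by (intro sum.cong refl) (simp add: col dev)
    finally show ?thesis by (simp only: Sb_def sum_divide_distrib)
  qed
  have Sb0: "0 \<le> Sb" unfolding Sb[symmetric] by (intro sum_nonneg) auto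
  have "(\<Sum>u\<in>nbrs n G a. \<Sum>v\<in>nbrs n G b. w u v * gdist_real n G u v)
      \<le> (\<Sum>u\<in>nbrs n G a. \<Sum>v\<in>nbrs n G b. w u v * 2)"
  proof (intro sum_mono)
    fix u v
    show "w u v * gdist_real n G u v \<le> w u v * 2"
    proof (cases "w u v = 0")
      case False
      then have "\<exists>z\<in>V. u \<in> V \<and> v \<in> V \<and> adj G u z \<and> adj G z v"
        unfolding w_def by (auto simp: sum_nonneg_eq_0_iff)
      then have "gdist n G u v \<le> enat 2" by (auto simp: V_def intro: gdist_le_2)
      from gdist_real_le[OF this] show ?thesis using w0 by (intro mult_left_mono) auto
    qed simp
  qed
  also have "\<dots> = 2 * (\<Sum>u\<in>nbrs n G a. (\<Sum>v\<in>nbrs n G b. w u v))"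
    by (simp add: sum_distrib_left mult.commute)
  also have "\<dots> \<le> 2 * (\<Sum>u\<in>nbrs n G a. 1 / D + \<bar>(\<Sum>v\<in>nbrs n G b. w u v) - 1 / D\<bar>)"
    by (intro mult_left_mono sum_mono) auto
  also have "\<dots> = 2 * (card (nbrs n G a) / D + Sa)"
    by (simp add: sum.distrib Sa)
  finally have "(\<Sum>u\<in>nbrs n G a. \<Sum>v\<in>nbrs n G b. w u v * gdist_real n G u v)
      \<le> 2 * (card (nbrs n G a) / D + Sa)" .
  \<comment> \<open>The constant is \<open>5 = 2 + 3\<close>: excess mass is moved at cost at most
    2, and the correction to a coupling costs 3 per unit of deviation.\<close>
  then show ?thesis
    using ricci_ge_approx_coupling[of w D, OF w0 D] Sb0 unfolding Sa Sb Sa_def[symmetric] Sb_def[symmetric]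
    by argo
qed

text \<open>Both one-sided errors are nonnegative, so their sum dominates the absolute value.
  Dividing the expected size of \<open>near2\<close> by \<open>n p\<close> leaves
  \<open>p + n p^2\<close>.\<close>

lemma expectation_ricci_middle:
  assumes "4 \<le> n"
  shows "expec (\<lambda>G. \<bar>ricci n G a b - (- 1)\<bar>)
    \<le> 2 * (p + n * p\<^sup>2 + 2 / (n * p) + 2 * deg_err) + 5 * (2 * (1 / (n * p) + 2 * path_err) + 2 * deg_err)"
proof -
  let ?D = "real n * p" and ?m = "(real n)\<^sup>2 * p ^ 3"
  let ?da = "\<lambda>G. \<bar>card (nbrs n G a) / ?D - 1\<bar>" and ?db = "\<lambda>G. \<bar>card (nbrs n G b) / ?D - 1\<bar>"
  let ?Sa = "\<lambda>G. 1 / ?D + (\<Sum>x\<in>V. of_bool (adj G a x) * \<bar>row_count2 b x G / ?m - 1\<bar>) / ?D"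
  let ?Sb = "\<lambda>G. 1 / ?D + (\<Sum>x\<in>V. of_bool (adj G b x) * \<bar>row_count2 a x G / ?m - 1\<bar>) / ?D"
  have "expec (\<lambda>G. \<bar>ricci n G a b - (- 1)\<bar>)
      \<le> expec (\<lambda>G. 2 * (card (near2 G) / ?D + 2 / ?D + ?da G + ?db G) + 5 * (?Sa G + ?Sb G + ?da G + ?db G))"
  proof (rule expectation_mono_pmf[OF finite_P])
    fix G assume G: "G \<in> set_pmf P"
    interpret graph_edge n G a b using G by (rule graph_edge_P)
    have "ricci n G a b \<le> 1 - real 2
        + real 2 * (card (insert b (near2 G)) / ?D + card {a} / ?D + ?da G + ?db G)"
      using far2[OF G] b_in_Na a_in_Nb np_pos
      by (intro ricci_le_exceptional) (auto simp: near2_def nbrs_a_eq[OF G])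
    moreover have "card (insert b (near2 G)) / ?D \<le> (card (near2 G) + 1) / ?D"
      using np_pos card_insert_le_real[OF finite_near2, of b G] by (intro divide_right_mono) auto
    moreover have "(card (near2 G) + 1) / ?D = card (near2 G) / ?D + 1 / ?D" "2 / ?D = 1 / ?D + 1 / ?D"
      "real (card {a}) / ?D = 1 / ?D" by (simp_all add: add_divide_distrib)
    ultimately have le: "ricci n G a b \<le> - 1 + 2 * (card (near2 G) / ?D + 2 / ?D + ?da G + ?db G)"
      by (simp only: of_nat_numeral) argo
    have "0 \<le> ?Sa G" "0 \<le> ?Sb G"
      using np_pos by (intro add_nonneg_nonneg divide_nonneg_nonneg sum_nonneg; simp)+
    moreover have "0 \<le> card (near2 G) / ?D" "0 \<le> 2 / ?D" using np_pos by auto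
    ultimately show "\<bar>ricci n G a b - (- 1)\<bar> \<le>
       2 * (card (near2 G) / ?D + 2 / ?D + ?da G + ?db G) + 5 * (?Sa G + ?Sb G + ?da G + ?db G)"
      using le ricci_ge_2_paths[OF G] abs_ge_zero[of "card (nbrs n G a) / ?D - 1"]
        abs_ge_zero[of "card (nbrs n G b) / ?D - 1"]
      unfolding abs_le_iff[of "ricci n G a b - (- 1)"] by argo
  qed
  also have "\<dots> = 2 * (expec (\<lambda>G. card (near2 G)) / ?D + 2 / ?D + expec ?da + expec ?db)
      + 5 * (expec ?Sa + expec ?Sb + expec ?da + expec ?db)"
    by (simp only: Bochner_Integration.integral_add integ integral_mult_right_zero
        integral_divide_zero lebesgue_integral_const measure_pmf.prob_space) simp
  also have "\<dots> \<le> 2 * ((n * p\<^sup>2 + (real n)\<^sup>2 * p ^ 3) / ?D + 2 / ?D + deg_err + deg_err)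
      + 5 * ((1 / ?D + 2 * path_err) + (1 / ?D + 2 * path_err) + deg_err + deg_err)"
    using np_pos assms path_err_nonneg
    by (intro mult_left_mono add_mono divide_right_mono expectation_near2 expectation_deg_a
      expectation_deg_b expectation_row_error expectation_row2_a expectation_row2_error_b) auto
  also have "(n * p\<^sup>2 + (real n)\<^sup>2 * p ^ 3) / ?D = p + n * p\<^sup>2"
  proof -
    have "n * p\<^sup>2 + (real n)\<^sup>2 * p ^ 3 = (p + n * p\<^sup>2) * ?D" by algebra
    moreover have "?D \<noteq> 0" using np_pos by linarith
    ultimately show ?thesis by (metis nonzero_mult_div_cancel_right)
  qed
  finally show ?thesis by (simp add: algebra_simps)
qed

section \<open>The plan along edges between the neighbourhoods\<close>

definition row_count1 :: "nat \<Rightarrow> nat \<Rightarrow> nat \<Rightarrow> (nat set \<Rightarrow> bool) \<Rightarrow> real" where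
  "row_count1 c d x G = (\<Sum>y\<in>V - {x}. of_bool (adj G d y \<and> \<not> adj G c y \<and> adj G x y))"

definition edge_err :: real where
  "edge_err = sqrt (1 / (real n * (p\<^sup>2 * (1 - p))) + 6 / n)"

lemma edge_err_nonneg: "0 \<le> edge_err"
  using p_pos p_le_1 by (simp add: edge_err_def)

lemma expectation_row1_a:
  "x \<in> V \<Longrightarrow> p < 1 \<Longrightarrow> 3 \<le> n \<Longrightarrow>
    expec (\<lambda>G. of_bool (adj G a x) * \<bar>row_count1 a b x G / (real n * (p\<^sup>2 * (1 - p))) - 1\<bar>) \<le> 2 * p * edge_err"
  unfolding row_count1_def edge_err_def by (rule expectation_row_deviation_1)

lemma expectation_row1_b:
  "x \<in> V \<Longrightarrow> p < 1 \<Longrightarrow> 3 \<le> n \<Longrightarrow>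
    expec (\<lambda>G. of_bool (adj G b x) * \<bar>row_count1 b a x G / (real n * (p\<^sup>2 * (1 - p))) - 1\<bar>) \<le> 2 * p * edge_err"
  using edge_gnp.expectation_row1_a[OF swap]
  by (simp add: edge_gnp.row_count1_def[OF swap] row_count1_def gnp_edge_commute V_swap
      edge_gnp.edge_err_def[OF swap] edge_err_def)

lemma expectation_row1_error_b:
  assumes "3 \<le> n" "p < 1"
  shows "expec (\<lambda>G. 1 / (n * p) + (\<Sum>x\<in>V. of_bool (adj G b x) * \<bar>row_count1 b a x G / (real n * (p\<^sup>2 * (1 - p))) - 1\<bar>) / (n * p))
    \<le> 1 / (n * p) + 2 * edge_err"
  using edge_gnp.expectation_row_error[OF swap,
      of "\<lambda>x G. row_count1 b a x G / (real n * (p\<^sup>2 * (1 - p))) - 1" edge_err] expectation_row1_b assms edge_err_nonneg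
  by (simp add: gnp_edge_commute V_swap)

text \<open>The plan leaves common neighbours in place and moves the remaining mass uniformly along edges.\<close>

lemma ricci_ge_edges:
  assumes G: "G \<in> set_pmf P" and p1: "p < 1"
  defines "D \<equiv> real n * p" and "m \<equiv> real n * (p\<^sup>2 * (1 - p))"
  shows "ricci n G a b \<ge> (\<Sum>x\<in>V. of_bool (adj G a x \<and> adj G b x)) / D - 4 * (
      (1 / D + (\<Sum>x\<in>V. of_bool (adj G a x) * \<bar>row_count1 a b x G / m - 1\<bar>) / D)
    + (1 / D + (\<Sum>x\<in>V. of_bool (adj G b x) * \<bar>row_count1 b a x G / m - 1\<bar>) / D)
    + \<bar>card (nbrs n G a) / D - 1\<bar> + \<bar>card (nbrs n G b) / D - 1\<bar>)"
proof -
  interpret graph_edge n G a b using G by (rule graph_edge_P)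
  have D: "0 < D" and m: "0 < m" using np_pos p_pos p1 n_ge_2 by (auto simp: D_def m_def)
  define w1 where "w1 u v = of_bool (u = v \<and> u \<in> V) / D" for u v
  \<comment> \<open>Common neighbours are excluded at both ends, since \<open>w1\<close> already
    serves them; this is the origin of the factor \<open>1 - p\<close> in \<open>m\<close>.\<close>
  define w2 where "w2 u v = of_bool (u \<in> V \<and> v \<in> V \<and> u \<noteq> v \<and> adj G u v \<and> \<not> adj G b u \<and> \<not> adj G a v) / (m * D)"
    for u v
  define w where "w u v = w1 u v + w2 u v" for u v
  have w10: "0 \<le> w1 u v" and w20: "0 \<le> w2 u v" for u v using D m by (auto simp: w1_def w2_def)
  then have w0: "0 \<le> w u v" for u v by (simp add: w_def)
  have w1V: "w1 u v = 0" and w2V: "w2 u v = 0" if "u \<notin> V \<or> v \<notin> V" for u v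
    using that by (auto simp: w1_def w2_def)
  then have wV: "w u v = 0" if "u \<notin> V \<or> v \<notin> V" for u v using that by (simp add: w_def)
  have ab: "a \<notin> V" "b \<notin> V" by (auto simp: V_def)
  have row1: "(\<Sum>v\<in>nbrs n G b. w1 u v) = of_bool (adj G b u) / D" if u: "u \<in> V" for u
  proof -
    have "(\<Sum>v\<in>nbrs n G b. w1 u v) = (\<Sum>y\<in>V. of_bool (adj G b y) * w1 u y)"
      using sum_nbrs_b[OF G] w1V ab by simp
    also have "\<dots> = (\<Sum>y\<in>V. if u = y then of_bool (adj G b u) / D else 0)"
      using u by (intro sum.cong) (auto simp: w1_def)
    finally show ?thesis using u by simp
  qed
  have col1: "(\<Sum>u\<in>nbrs n G a. w1 u v) = of_bool (adj G a v) / D" if v: "v \<in> V" for v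
  proof -
    have "(\<Sum>u\<in>nbrs n G a. w1 u v) = (\<Sum>y\<in>V. of_bool (adj G a y) * w1 y v)"
      using sum_nbrs_a[OF G] w1V ab by simp
    also have "\<dots> = (\<Sum>y\<in>V. if v = y then of_bool (adj G a v) / D else 0)"
      using v by (intro sum.cong) (auto simp: w1_def)
    finally show ?thesis using v by simp
  qed
  have row2: "(\<Sum>v\<in>nbrs n G b. w2 u v) = of_bool (\<not> adj G b u) * row_count1 a b u G / (m * D)" if u: "u \<in> V" for u
  proof -
    have "(\<Sum>v\<in>nbrs n G b. w2 u v) = (\<Sum>y\<in>V. of_bool (adj G b y) * w2 u y)"
      using sum_nbrs_b[OF G] w2V ab by simp
    also have "\<dots> = (\<Sum>y\<in>V - {u}. of_bool (adj G b y) * w2 u y)"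
      by (intro sum.mono_neutral_right) (auto simp: w2_def)
    also have "\<dots> = (\<Sum>y\<in>V - {u}. of_bool (\<not> adj G b u) * of_bool (adj G b y \<and> \<not> adj G a y \<and> adj G u y) / (m * D))"
      unfolding w2_def using u by (intro sum.cong) auto
    finally show ?thesis by (simp only: row_count1_def sum_divide_distrib sum_distrib_left)
  qed
  have col2: "(\<Sum>u\<in>nbrs n G a. w2 u v) = of_bool (\<not> adj G a v) * row_count1 b a v G / (m * D)" if v: "v \<in> V" for v
  proof -
    have "(\<Sum>u\<in>nbrs n G a. w2 u v) = (\<Sum>y\<in>V. of_bool (adj G a y) * w2 y v)"
      using sum_nbrs_a[OF G] w2V ab by simp
    also have "\<dots> = (\<Sum>y\<in>V - {v}. of_bool (adj G a y) * w2 y v)"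
      by (intro sum.mono_neutral_right) (auto simp: w2_def)
    also have "\<dots> = (\<Sum>y\<in>V - {v}. of_bool (\<not> adj G a v) * of_bool (adj G a y \<and> \<not> adj G b y \<and> adj G v y) / (m * D))"
      unfolding w2_def using v by (intro sum.cong) (auto simp: adj_commute)
    finally show ?thesis by (simp only: row_count1_def sum_divide_distrib sum_distrib_left)
  qed
  \<comment> \<open>If \<open>Q\<close> holds, the vertex is a common neighbour and its row is
    exact; otherwise only the edge count deviates.\<close>
  have dev: "\<bar>of_bool Q / D + of_bool (\<not> Q) * c / (m * D) - 1 / D\<bar> \<le> \<bar>c / m - 1\<bar> / D" for c Q
  proof (cases Q)
    case False
    have "c / (m * D) - 1 / D = (c / m - 1) / D" by (simp add: diff_divide_distrib)
    then show ?thesis using D False by (simp add: abs_divide)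
  qed (use D in simp)
  define Sa where "Sa = 1 / D + (\<Sum>x\<in>V. of_bool (adj G a x) * \<bar>row_count1 a b x G / m - 1\<bar>) / D"
  define Sb where "Sb = 1 / D + (\<Sum>x\<in>V. of_bool (adj G b x) * \<bar>row_count1 b a x G / m - 1\<bar>) / D"
  have Sa: "(\<Sum>u\<in>nbrs n G a. \<bar>(\<Sum>v\<in>nbrs n G b. w u v) - 1 / D\<bar>) \<le> Sa"
  proof -
    have "(\<Sum>u\<in>nbrs n G a. \<bar>(\<Sum>v\<in>nbrs n G b. w u v) - 1 / D\<bar>)
      = 1 / D + (\<Sum>x\<in>V. of_bool (adj G a x) * \<bar>(\<Sum>v\<in>nbrs n G b. w x v) - 1 / D\<bar>)"
      using D wV ab by (subst sum_nbrs_a[OF G]) simp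
    also have "\<dots> \<le> 1 / D + (\<Sum>x\<in>V. of_bool (adj G a x) * (\<bar>row_count1 a b x G / m - 1\<bar> / D))"
    proof (intro add_left_mono sum_mono mult_left_mono)
      fix x assume "x \<in> V"
      then show "\<bar>(\<Sum>v\<in>nbrs n G b. w x v) - 1 / D\<bar> \<le> \<bar>row_count1 a b x G / m - 1\<bar> / D"
        unfolding w_def sum.distrib by (simp only: row1 row2 dev)
    qed simp
    finally show ?thesis by (simp only: Sa_def sum_divide_distrib times_divide_eq_right)
  qed
  have Sb: "(\<Sum>v\<in>nbrs n G b. \<bar>(\<Sum>u\<in>nbrs n G a. w u v) - 1 / D\<bar>) \<le> Sb"
  proof -
    have "(\<Sum>v\<in>nbrs n G b. \<bar>(\<Sum>u\<in>nbrs n G a. w u v) - 1 / D\<bar>)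
      = 1 / D + (\<Sum>x\<in>V. of_bool (adj G b x) * \<bar>(\<Sum>u\<in>nbrs n G a. w u x) - 1 / D\<bar>)"
      using D wV ab by (subst sum_nbrs_b[OF G]) simp
    also have "\<dots> \<le> 1 / D + (\<Sum>x\<in>V. of_bool (adj G b x) * (\<bar>row_count1 b a x G / m - 1\<bar> / D))"
    proof (intro add_left_mono sum_mono mult_left_mono)
      fix x assume "x \<in> V"
      then show "\<bar>(\<Sum>u\<in>nbrs n G a. w u x) - 1 / D\<bar> \<le> \<bar>row_count1 b a x G / m - 1\<bar> / D"
        unfolding w_def sum.distrib by (simp only: col1 col2 dev)
    qed simp
    finally show ?thesis by (simp only: Sb_def sum_divide_distrib times_divide_eq_right)
  qed
  have Sb0: "0 \<le> Sb" using Sb by (rule order_trans[rotated]) (intro sum_nonneg, auto)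
  have com: "(\<Sum>u\<in>nbrs n G a. \<Sum>v\<in>nbrs n G b. w1 u v) = (\<Sum>x\<in>V. of_bool (adj G a x \<and> adj G b x)) / D"
  proof -
    have "(\<Sum>u\<in>nbrs n G a. \<Sum>v\<in>nbrs n G b. w1 u v) = (\<Sum>x\<in>V. of_bool (adj G a x) * (\<Sum>v\<in>nbrs n G b. w1 x v))"
      using w1V ab by (subst sum_nbrs_a[OF G]) simp
    also have "\<dots> = (\<Sum>x\<in>V. of_bool (adj G a x \<and> adj G b x) / D)"
      by (intro sum.cong refl) (simp add: row1)
    finally show ?thesis by (simp only: sum_divide_distrib)
  qed
  have "(\<Sum>u\<in>nbrs n G a. \<Sum>v\<in>nbrs n G b. w u v * gdist_real n G u v)
      \<le> (\<Sum>u\<in>nbrs n G a. \<Sum>v\<in>nbrs n G b. w u v - w1 u v)"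
  proof (intro sum_mono)
    fix u v
    have "w1 u v * gdist_real n G u v = 0"
    proof (cases "u = v \<and> u \<in> V")
      case True
      then have "gdist_real n G u v \<le> 0" using gdist_real_le[OF gdist_le_0[of u n G]] by (simp add: V_def)
      then show ?thesis using gdist_real_nonneg[of n G u v] by simp
    qed (simp add: w1_def)
    moreover have "w2 u v * gdist_real n G u v \<le> w2 u v"
    proof (cases "w2 u v = 0")
      case False
      then have "u \<in> V" "v \<in> V" "adj G u v" by (auto simp: w2_def split: if_splits)
      then have "gdist n G u v \<le> enat 1" by (auto simp: V_def intro: gdist_le_1[unfolded One_nat_def])
      from mult_left_mono[OF gdist_real_le[OF this] w20[of u v]] show ?thesis by simp
    qed simp
    ultimately show "w u v * gdist_real n G u v \<le> w u v - w1 u v"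
      by (auto simp: w_def distrib_right)
  qed
  also have "\<dots> = (\<Sum>u\<in>nbrs n G a. \<Sum>v\<in>nbrs n G b. w u v) - (\<Sum>x\<in>V. of_bool (adj G a x \<and> adj G b x)) / D"
    by (simp only: sum_subtractf com)
  also have "(\<Sum>u\<in>nbrs n G a. \<Sum>v\<in>nbrs n G b. w u v)
      \<le> (\<Sum>u\<in>nbrs n G a. 1 / D + \<bar>(\<Sum>v\<in>nbrs n G b. w u v) - 1 / D\<bar>)"
    by (intro sum_mono) auto
  also have "\<dots> \<le> card (nbrs n G a) / D + Sa"
    using Sa by (simp add: sum.distrib)
  finally have "(\<Sum>u\<in>nbrs n G a. \<Sum>v\<in>nbrs n G b. w u v * gdist_real n G u v)
      \<le> card (nbrs n G a) / D + Sa - (\<Sum>x\<in>V. of_bool (adj G a x \<and> adj G b x)) / D" by simp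
  \<comment> \<open>Here \<open>4 = 1 + 3\<close>, as moving mass along an edge costs 1.\<close>
  then show ?thesis
    using ricci_ge_approx_coupling[of w D, OF w0 D] Sb0 Sa Sb unfolding Sa_def[symmetric] Sb_def[symmetric]
    by argo
qed

text \<open>Only common neighbours can stay in place, so the dual bound with \<open>k = 1\<close>
  gives their fraction as upper bound, and the edge plan attains it up to small errors. Since their
  number is close to \<open>n p^2\<close>, that fraction is close to \<open>p\<close>.\<close>

lemma expectation_ricci_dense:
  assumes "3 \<le> n" "p < 1"
  shows "expec (\<lambda>G. \<bar>ricci n G a b - p\<bar>)
    \<le> 2 * sqrt (1 / (n * p\<^sup>2) + 4 / n) + 4 * (2 * (1 / (n * p) + 2 * edge_err) + 2 * deg_err)"
proof -
  let ?D = "real n * p" and ?m = "real n * (p\<^sup>2 * (1 - p))"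
  let ?da = "\<lambda>G. \<bar>card (nbrs n G a) / ?D - 1\<bar>" and ?db = "\<lambda>G. \<bar>card (nbrs n G b) / ?D - 1\<bar>"
  let ?Sa = "\<lambda>G. 1 / ?D + (\<Sum>x\<in>V. of_bool (adj G a x) * \<bar>row_count1 a b x G / ?m - 1\<bar>) / ?D"
  let ?Sb = "\<lambda>G. 1 / ?D + (\<Sum>x\<in>V. of_bool (adj G b x) * \<bar>row_count1 b a x G / ?m - 1\<bar>) / ?D"
  let ?com = "\<lambda>G. (\<Sum>x\<in>V. of_bool (adj G a x \<and> adj G b x) :: real)"
  have "expec (\<lambda>G. \<bar>ricci n G a b - p\<bar>)
      \<le> expec (\<lambda>G. \<bar>?com G / (n * p\<^sup>2) - 1\<bar> + 4 * (?Sa G + ?Sb G + ?da G + ?db G))"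
  proof (rule expectation_mono_pmf[OF finite_P])
    fix G assume G: "G \<in> set_pmf P"
    interpret graph_edge n G a b using G by (rule graph_edge_P)
    define B where "B = {x \<in> V. adj G a x \<and> adj G b x}"
    have B: "real (card B) = ?com G" unfolding B_def by (rule card_eq_sum_of_bool) simp
    have "ricci n G a b \<le> 1 - real 1
        + real 1 * (card B / ?D + card ({} :: nat set) / ?D + ?da G + ?db G)"
    proof (intro ricci_le_exceptional np_pos)
      show "B \<subseteq> nbrs n G a" by (auto simp: B_def nbrs_a_eq[OF G])
      fix u v assume "u \<in> nbrs n G a - B" "v \<in> nbrs n G b - {}"
      then have "u \<noteq> v" by (auto simp: B_def nbrs_a_eq[OF G] nbrs_b_eq[OF G] V_def a_neq_b)
      then show "enat 1 \<le> gdist n G u v" by (rule gdist_ge_1)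
    qed auto
    then have le: "ricci n G a b \<le> ?com G / ?D + ?da G + ?db G" by (simp only: B) simp
    have "?com G / ?D - p = p * (?com G / (n * p\<^sup>2) - 1)"
      using p_pos n_ge_2 by (simp add: field_simps power2_eq_square)
    then have "\<bar>?com G / ?D - p\<bar> = p * \<bar>?com G / (n * p\<^sup>2) - 1\<bar>"
      using p_pos by (simp add: abs_mult del: sum_of_bool_eq)
    also have "\<dots> \<le> 1 * \<bar>?com G / (n * p\<^sup>2) - 1\<bar>" using p_le_1 by (intro mult_right_mono) auto
    finally have com: "?com G / ?D - p \<le> \<bar>?com G / (n * p\<^sup>2) - 1\<bar>" "p - ?com G / ?D \<le> \<bar>?com G / (n * p\<^sup>2) - 1\<bar>"
      by (simp_all only: mult_1 abs_le_iff) (simp_all only: minus_diff_eq)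
    have "0 \<le> ?Sa G" "0 \<le> ?Sb G"
      using np_pos by (intro add_nonneg_nonneg divide_nonneg_nonneg sum_nonneg; simp)+
    then show "\<bar>ricci n G a b - p\<bar> \<le> \<bar>?com G / (n * p\<^sup>2) - 1\<bar> + 4 * (?Sa G + ?Sb G + ?da G + ?db G)"
      using le com ricci_ge_edges[OF G assms(2)] abs_ge_zero[of "card (nbrs n G a) / ?D - 1"]
        abs_ge_zero[of "card (nbrs n G b) / ?D - 1"]
      unfolding abs_le_iff[of "ricci n G a b - p"] by argo
  qed
  also have "\<dots> = expec (\<lambda>G. \<bar>?com G / (n * p\<^sup>2) - 1\<bar>) + 4 * (expec ?Sa + expec ?Sb + expec ?da + expec ?db)"
    by (simp only: Bochner_Integration.integral_add integ integral_mult_right_zero)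
  also have "\<dots> \<le> 2 * sqrt (1 / (n * p\<^sup>2) + 4 / n)
      + 4 * ((1 / ?D + 2 * edge_err) + (1 / ?D + 2 * edge_err) + deg_err + deg_err)"
    using assms edge_err_nonneg
    by (intro mult_left_mono add_mono expectation_common_deviation expectation_deg_a
      expectation_deg_b expectation_row_error expectation_row1_a expectation_row1_error_b) auto
  finally show ?thesis by (simp add: algebra_simps)
qed

section \<open>Tree-like and isolated edges, and the joint law of the degrees\<close>

text \<open>If \<open>near3\<close> is empty the edge is tree-like, and the probability that a
  finite random set is nonempty is at most its expected size.\<close>

lemma prob_not_tree_like:
  "measure_pmf.prob P {G. ricci n G a b \<noteq> poisson_limit (card (nbrs n G a) - 1, card (nbrs n G b) - 1)}
    \<le> n * p\<^sup>2 + 2 * (real n)\<^sup>2 * p ^ 3 + (real n) ^ 3 * p ^ 4"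
proof -
  have "expec (\<lambda>G. of_bool (ricci n G a b \<noteq> poisson_limit (card (nbrs n G a) - 1, card (nbrs n G b) - 1)))
      \<le> expec (\<lambda>G. card (near3 G))"
  proof (rule expectation_mono_pmf[OF finite_P])
    fix G assume G: "G \<in> set_pmf P"
    interpret graph_edge n G a b using G by (rule graph_edge_P)
    show "of_bool (ricci n G a b \<noteq> poisson_limit (card (nbrs n G a) - 1, card (nbrs n G b) - 1))
      \<le> real (card (near3 G))"
    proof (cases "near3 G = {}")
      case True
      then have "ricci n G a b = poisson_limit (card (nbrs n G a) - 1, card (nbrs n G b) - 1)"
        using far3[OF G] by (intro ricci_tree_like) auto
      then show ?thesis by simp
    next
      case False
      then have "1 \<le> card (near3 G)" using finite_near3 by (simp add: Suc_le_eq card_gt_0_iff)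
      then show ?thesis by simp
    qed
  qed
  then show ?thesis using expectation_near3 by (simp add: expectation_of_bool)
qed

text \<open>Union bound over the possible further edges at \<open>a\<close> or \<open>b\<close>. For
  an isolated edge the tree-like formula applies vacuously and gives 0.\<close>

lemma prob_isolated: "1 - 2 * (n * p) \<le> measure_pmf.prob P {G. isolated_edge n G a b \<and> ricci n G a b = 0}"
proof -
  have nb: "expec (\<lambda>G. of_bool (adj G b x)) = p" if "x \<in> V" for x
    using edge_gnp.prob_nbr_a[OF swap] that by (simp add: expectation_of_bool V_swap gnp_edge_commute)
  have "expec (\<lambda>G. 1 - (\<Sum>x\<in>V. of_bool (adj G a x) + of_bool (adj G b x)))
      \<le> expec (\<lambda>G. of_bool (isolated_edge n G a b \<and> ricci n G a b = 0))"
  proof (rule expectation_mono_pmf[OF finite_P])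
    fix G assume G: "G \<in> set_pmf P"
    interpret graph_edge n G a b using G by (rule graph_edge_P)
    show "1 - (\<Sum>x\<in>V. of_bool (adj G a x) + of_bool (adj G b x))
      \<le> (of_bool (isolated_edge n G a b \<and> ricci n G a b = 0) :: real)"
    proof (cases "\<exists>x\<in>V. adj G a x \<or> adj G b x")
      case True
      then obtain x where x: "x \<in> V" "adj G a x \<or> adj G b x" by blast
      have "1 \<le> (of_bool (adj G a x) + of_bool (adj G b x) :: real)" using x by auto
      also have "\<dots> \<le> (\<Sum>x\<in>V. of_bool (adj G a x) + of_bool (adj G b x))"
        using x(1) by (intro member_le_sum) auto
      finally have "1 - (\<Sum>x\<in>V. of_bool (adj G a x) + of_bool (adj G b x)) \<le> (0 :: real)" by linarith
      also have "\<dots> \<le> of_bool (isolated_edge n G a b \<and> ricci n G a b = 0)" by simp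
      finally show ?thesis .
    next
      case False
      then have N: "nbrs n G a = {b}" "nbrs n G b = {a}" by (auto simp: nbrs_a_eq[OF G] nbrs_b_eq[OF G])
      have "ricci n G a b = poisson_limit (card (nbrs n G a) - 1, card (nbrs n G b) - 1)"
        by (rule ricci_tree_like) (auto simp: N)
      then have "ricci n G a b = 0" by (simp add: N poisson_limit_def)
      then show ?thesis using N False by (simp add: isolated_edge_def)
    qed
  qed
  also have "expec (\<lambda>G. 1 - (\<Sum>x\<in>V. of_bool (adj G a x) + of_bool (adj G b x)))
      = 1 - (\<Sum>x\<in>V. expec (\<lambda>G. of_bool (adj G a x)) + expec (\<lambda>G. of_bool (adj G b x)))"
    by (simp only: Bochner_Integration.integral_diff Bochner_Integration.integral_sum
        Bochner_Integration.integral_add integ lebesgue_integral_const) simp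
  also have "(\<Sum>x\<in>V. expec (\<lambda>G. of_bool (adj G a x)) + expec (\<lambda>G. of_bool (adj G b x))) = (\<Sum>x\<in>V. p + p)"
    by (intro sum.cong refl) (simp add: nb expectation_of_bool[where Q = "\<lambda>G. adj G a _"] prob_nbr_a)
  finally have "1 - (\<Sum>x\<in>V. p + p) \<le> measure_pmf.prob P {G. isolated_edge n G a b \<and> ricci n G a b = 0}"
    by (simp only: expectation_of_bool)
  moreover have "(\<Sum>x\<in>V. p + p) \<le> n * (2 * p)" using p_pos by (intro sum_V_le) auto
  ultimately show ?thesis by argo
qed

text \<open>Apart from \<open>{a, b}\<close>, the pairs at \<open>a\<close> and those at
  \<open>b\<close> are disjoint, so the further degrees are exactly independent and binomial with
  \<open>n - 2\<close> trials. The event is split according to the two neighbourhoods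
  \<open>S\<close> and \<open>T\<close>, each of which prescribes edges and non-edges.\<close>

lemma prob_degrees:
  "measure_pmf.prob P {G. card (nbrs n G a) - 1 = k \<and> card (nbrs n G b) - 1 = l} =
    (real (n - 2 choose k) * p ^ k * (1 - p) ^ (n - 2 - k)) * (real (n - 2 choose l) * p ^ l * (1 - p) ^ (n - 2 - l))"
proof -
  define A where "A G = {x \<in> V. adj G a x}" for G
  define B where "B G = {x \<in> V. adj G b x}" for G
  define Sk where "Sk k = {S. S \<subseteq> V \<and> card S = k}" for k
  have fin_Sk [simp]: "finite (Sk k)" for k
    by (rule finite_subset[of _ "Pow V"]) (auto simp: Sk_def)
  have card_Sk: "card (Sk k) = (n - 2 choose k)" for k
    unfolding Sk_def using n_subsets[OF finite_V, of k] by (simp add: card_V)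
  have event: "of_bool (card (nbrs n G a) - 1 = k \<and> card (nbrs n G b) - 1 = l)
      = (\<Sum>S\<in>Sk k. \<Sum>T\<in>Sk l. of_bool (A G = S \<and> B G = T) :: real)" if G: "G \<in> set_pmf P" for G
  proof -
    have "card (nbrs n G a) - 1 = card (A G)" "card (nbrs n G b) - 1 = card (B G)"
      unfolding A_def B_def nbrs_a_eq[OF G] nbrs_b_eq[OF G]
      by (subst card_insert_disjoint; simp add: V_def)+
    moreover have "(\<Sum>S\<in>Sk k. \<Sum>T\<in>Sk l. of_bool (A G = S \<and> B G = T) :: real)
        = (\<Sum>S\<in>Sk k. of_bool (A G = S)) * (\<Sum>T\<in>Sk l. of_bool (B G = T))"
      by (simp only: sum_product of_bool_conj)
    moreover have "(\<Sum>S\<in>Sk k. of_bool (A G = S) :: real) = of_bool (card (A G) = k)"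
      "(\<Sum>T\<in>Sk l. of_bool (B G = T) :: real) = of_bool (card (B G) = l)"
      by (auto simp: Sk_def A_def B_def of_bool_def simp del: sum_of_bool_eq)
    ultimately show ?thesis by (simp only: of_bool_conj)
  qed
  have single: "measure_pmf.prob P {G. A G = S \<and> B G = T}
      = (p ^ k * (1 - p) ^ (n - 2 - k)) * (p ^ l * (1 - p) ^ (n - 2 - l))" if ST: "S \<in> Sk k" "T \<in> Sk l" for S T
  proof -
    let ?E = "\<lambda>X Y. (\<lambda>x. {a, x}) ` X \<union> (\<lambda>x. {b, x}) ` Y"
    have S: "S \<subseteq> V" "card S = k" and T: "T \<subseteq> V" "card T = l" using ST by (auto simp: Sk_def)
    have "{G. A G = S \<and> B G = T} = {G. (\<forall>e\<in>?E S T. G e) \<and> (\<forall>e\<in>?E (V - S) (V - T). \<not> G e)}"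
    proof (rule Collect_cong)
      fix G
      have AB: "A G = {x \<in> V. G {a, x}}" "B G = {x \<in> V. G {b, x}}"
        by (auto simp: A_def B_def adj_def V_def)
      have filter_eq: "{x \<in> V. Q x} = X \<longleftrightarrow> (\<forall>x\<in>X. Q x) \<and> (\<forall>x\<in>V - X. \<not> Q x)" if "X \<subseteq> V" for X Q
        using that by blast
      show "(A G = S \<and> B G = T) = ((\<forall>e\<in>?E S T. G e) \<and> (\<forall>e\<in>?E (V - S) (V - T). \<not> G e))"
      proof -
        have ball_image: "(\<forall>e\<in>f ` X. Q e) \<longleftrightarrow> (\<forall>x\<in>X. Q (f x))" for f :: "nat \<Rightarrow> nat set" and X Q by simp
        show ?thesis
          unfolding AB filter_eq[OF S(1)] filter_eq[OF T(1)] ball_Un ball_image by (simp only: conj_ac)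
      qed
    qed
    moreover have "card (?E X Y) = card X + card Y" if "X \<subseteq> V" "Y \<subseteq> V" for X Y
    proof -
      have "finite X" "finite Y" using that by (auto intro: finite_subset[OF _ finite_V])
      moreover have "inj_on (\<lambda>x. {a, x}) X" "inj_on (\<lambda>x. {b, x}) Y"
        using that by (auto simp: inj_on_def doubleton_eq_iff)
      moreover have "(\<lambda>x. {a, x}) ` X \<inter> (\<lambda>x. {b, x}) ` Y = {}"
        using that a_neq_b by (auto simp: doubleton_eq_iff V_def)
      ultimately show ?thesis by (simp add: card_Un_disjoint card_image)
    qed
    moreover have "measure_pmf.prob P {G. (\<forall>e\<in>?E S T. G e) \<and> (\<forall>e\<in>?E (V - S) (V - T). \<not> G e)}
        = p ^ card (?E S T) * (1 - p) ^ card (?E (V - S) (V - T))"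
    proof (rule prob_P_edges)
      have sub: "?E X Y \<subseteq> vpairs n - {{a, b}}" if "X \<subseteq> V" "Y \<subseteq> V" for X Y
        using that a_less b_less by (auto simp: V_def doubleton_eq_iff)
      show "?E S T \<subseteq> vpairs n - {{a, b}}" using S T by (intro sub)
      show "?E (V - S) (V - T) \<subseteq> vpairs n - {{a, b}}" by (intro sub) auto
      show "?E S T \<inter> ?E (V - S) (V - T) = {}"
        using S T a_neq_b by (auto simp: doubleton_eq_iff V_def)
    qed
    moreover have "card (V - S) = n - 2 - k" "card (V - T) = n - 2 - l"
      using S T finite_subset[OF _ finite_V] by (auto simp: card_Diff_subset card_V)
    ultimately show ?thesis using S T by (simp add: power_add)
  qed
  have "measure_pmf.prob P {G. card (nbrs n G a) - 1 = k \<and> card (nbrs n G b) - 1 = l}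
      = expec (\<lambda>G. \<Sum>S\<in>Sk k. \<Sum>T\<in>Sk l. of_bool (A G = S \<and> B G = T))"
    unfolding expectation_of_bool[symmetric] by (intro integral_cong_AE AE_pmfI event) auto
  also have "\<dots> = (\<Sum>S\<in>Sk k. \<Sum>T\<in>Sk l. measure_pmf.prob P {G. A G = S \<and> B G = T})"
    by (simp only: Bochner_Integration.integral_sum integ expectation_of_bool)
  also have "\<dots> = (\<Sum>S\<in>Sk k. \<Sum>T\<in>Sk l. (p ^ k * (1 - p) ^ (n - 2 - k)) * (p ^ l * (1 - p) ^ (n - 2 - l)))"
    by (intro sum.cong refl single)
  finally show ?thesis by (simp add: card_Sk mult_ac)
qed

end

section \<open>Limits\<close>

text \<open>Markov's inequality.\<close>

lemma conv_in_prob_if_L1: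
  assumes bound: "\<forall>\<^sub>F n in sequentially. finite (set_pmf (M n)) \<and>
      measure_pmf.expectation (M n) (\<lambda>G. \<bar>X n G - c\<bar>) \<le> \<beta> n"
    and lim: "\<beta> \<longlonglongrightarrow> 0"
  shows "conv_in_prob M X c"
  unfolding conv_in_prob_def
proof (intro allI impI)
  fix e :: real assume e: "0 < e"
  show "(\<lambda>n. measure_pmf.prob (M n) {G. \<bar>X n G - c\<bar> > e}) \<longlonglongrightarrow> 0"
  proof (rule tendsto_sandwich[where f = "\<lambda>_. 0" and h = "\<lambda>n. \<beta> n / e"])
    show "\<forall>\<^sub>F n in sequentially. measure_pmf.prob (M n) {G. \<bar>X n G - c\<bar> > e} \<le> \<beta> n / e"
      using bound
    proof eventually_elim
      case (elim n)
      have "measure_pmf.prob (M n) {G. \<bar>X n G - c\<bar> > e}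
          \<le> measure_pmf.expectation (M n) (\<lambda>G. \<bar>X n G - c\<bar> / e)"
        unfolding expectation_of_bool[symmetric] using e elim
        by (intro expectation_mono_pmf) (auto simp: field_simps)
      also have "\<dots> \<le> \<beta> n / e" using elim e by (simp add: divide_right_mono)
      finally show ?case .
    qed
    show "(\<lambda>n. \<beta> n / e) \<longlonglongrightarrow> 0" using tendsto_divide[OF lim tendsto_const[of e]] e by simp
  qed auto
qed

lemma tendsto_const_over_at_top:
  "filterlim (f :: nat \<Rightarrow> real) at_top sequentially \<Longrightarrow> (\<lambda>n. c / f n) \<longlonglongrightarrow> 0"
  by (rule tendsto_divide_0[OF tendsto_const]) (rule filterlim_at_top_imp_at_infinity)

lemma tendsto_const_over_n: "(\<lambda>n. c / real n) \<longlonglongrightarrow> 0"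
  by (rule tendsto_const_over_at_top) (rule filterlim_real_sequentially)

lemma tendsto_sqrt_zero: "f \<longlonglongrightarrow> 0 \<Longrightarrow> (\<lambda>n. sqrt (f n)) \<longlonglongrightarrow> 0"
  using tendsto_real_sqrt[of f 0] by simp

lemma deg_err_tendsto:
  assumes "filterlim (\<lambda>n. real n * p n) at_top sequentially"
  shows "(\<lambda>n. 2 * sqrt (1 / (real n * p n) + 4 / real n) + 1 / (real n * p n)) \<longlonglongrightarrow> 0"
  by (auto intro!: tendsto_add_zero tendsto_mult_right_zero tendsto_sqrt_zero
      tendsto_const_over_at_top assms tendsto_const_over_n)

text \<open>Truncating to a finite box bounds the limit inferior from below for every set. As the
  limit is again a probability, applying this to the complement yields the upper bound.\<close>

lemma tendsto_prob_nat_pair: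
  fixes Q :: "nat \<Rightarrow> (nat \<times> nat) pmf"
  assumes pmf: "\<And>x. (\<lambda>n. pmf (Q n) x) \<longlonglongrightarrow> pmf R x"
  shows "(\<lambda>n. measure_pmf.prob (Q n) S) \<longlonglongrightarrow> measure_pmf.prob R S"
proof -
  have lower: "\<forall>\<^sub>F n in sequentially. measure_pmf.prob R S - e < measure_pmf.prob (Q n) S" if e: "0 < e" for S e
  proof -
    define F where "F N = S \<inter> ({..N} \<times> {..N})" for N :: nat
    have finF: "finite (F N)" for N by (simp add: F_def)
    have "(\<Union>N. F N) = S"
    proof (intro equalityI subsetI)
      fix x assume "x \<in> S"
      then have "x \<in> F (max (fst x) (snd x))" by (cases x) (auto simp: F_def)
      then show "x \<in> (\<Union>N. F N)" by blast
    qed (auto simp: F_def)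
    moreover have "(\<lambda>N. measure_pmf.prob R (F N)) \<longlonglongrightarrow> measure_pmf.prob R (\<Union>N. F N)"
      by (rule measure_pmf.finite_Lim_measure_incseq) (auto simp: F_def incseq_def)
    ultimately have "\<forall>\<^sub>F N in sequentially. measure_pmf.prob R S - e < measure_pmf.prob R (F N)"
      using e by (intro order_tendstoD(1)) auto
    then obtain N where N: "measure_pmf.prob R S - e < measure_pmf.prob R (F N)"
      by (auto simp: eventually_sequentially)
    have "(\<lambda>n. measure_pmf.prob (Q n) (F N)) \<longlonglongrightarrow> measure_pmf.prob R (F N)"
      by (simp add: measure_measure_pmf_finite[OF finF] tendsto_sum pmf)
    from order_tendstoD(1)[OF this N] show ?thesis
    proof eventually_elim
      case (elim n)
      also have "measure_pmf.prob (Q n) (F N) \<le> measure_pmf.prob (Q n) S"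
        by (rule measure_pmf.finite_measure_mono) (auto simp: F_def)
      finally show ?case .
    qed
  qed
  have compl: "measure_pmf.prob T (- S) = 1 - measure_pmf.prob T S" for T :: "(nat \<times> nat) pmf"
    using measure_pmf.prob_compl[of S T] by (simp add: Compl_eq_Diff_UNIV)
  show ?thesis
  proof (rule order_tendstoI)
    fix y assume "y < measure_pmf.prob R S"
    then show "\<forall>\<^sub>F n in sequentially. y < measure_pmf.prob (Q n) S"
      using lower[of "measure_pmf.prob R S - y" S] by simp
  next
    fix y assume "measure_pmf.prob R S < y"
    then show "\<forall>\<^sub>F n in sequentially. measure_pmf.prob (Q n) S < y"
      using lower[of "y - measure_pmf.prob R S" "- S"] by (auto simp: compl elim: eventually_mono)
  qed
qed

text \<open>The binomial coefficient times \<open>p^k\<close> is a product of \<open>k\<close>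
  factors \<open>(n - 2 - i) p\<close>, each tending to \<open>r\<close>, over
  \<open>fact k\<close>.\<close>

lemma binomial_tendsto_poisson:
  fixes p :: "nat \<Rightarrow> real"
  assumes p: "\<And>n. 0 < p n \<and> p n \<le> 1" and lim: "(\<lambda>n. real n * p n) \<longlonglongrightarrow> r"
  shows "(\<lambda>n. real (n - 2 choose k) * p n ^ k * (1 - p n) ^ (n - 2 - k)) \<longlonglongrightarrow> r ^ k / fact k * exp (- r)"
proof -
  have p0: "p \<longlonglongrightarrow> 0"
  proof -
    have "(\<lambda>n. real n * p n * (1 / real n)) \<longlonglongrightarrow> r * 0"
      by (intro tendsto_mult lim tendsto_const_over_n)
    moreover have "\<forall>\<^sub>F n in sequentially. real n * p n * (1 / real n) = p n"
      using eventually_gt_at_top[of 0] by eventually_elim simp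
    ultimately have "p \<longlonglongrightarrow> r * 0" by (rule Lim_transform_eventually)
    then show ?thesis by simp
  qed
  have shift: "(\<lambda>n. (real (n - 2) - real i) * p n) \<longlonglongrightarrow> r" for i
  proof -
    have "(\<lambda>n. real n * p n - (2 + real i) * p n) \<longlonglongrightarrow> r - (2 + real i) * 0"
      by (intro tendsto_intros lim p0)
    moreover have "\<forall>\<^sub>F n in sequentially. real n * p n - (2 + real i) * p n = (real (n - 2) - real i) * p n"
      using eventually_ge_at_top[of 2] by eventually_elim (simp add: of_nat_diff algebra_simps)
    ultimately have "(\<lambda>n. (real (n - 2) - real i) * p n) \<longlonglongrightarrow> r - (2 + real i) * 0"
      by (rule Lim_transform_eventually)
    then show ?thesis by simp
  qed
  have "(\<lambda>n. (\<Prod>i<k. (real (n - 2) - real i) * p n) / fact k) \<longlonglongrightarrow> (\<Prod>i<k. r) / fact k"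
    by (intro tendsto_divide tendsto_prod shift tendsto_const) simp
  moreover have "(\<Prod>i<k. (real (n - 2) - real i) * p n) / fact k = real (n - 2 choose k) * p n ^ k" for n
  proof -
    have "real (n - 2 choose k) = (\<Prod>i<k. real (n - 2) - real i) / fact k"
      unfolding binomial_gbinomial gbinomial_prod_rev lessThan_atLeast0 ..
    then show ?thesis by (simp add: prod.distrib)
  qed
  ultimately have 1: "(\<lambda>n. real (n - 2 choose k) * p n ^ k) \<longlonglongrightarrow> r ^ k / fact k" by simp
  have shift': "(\<lambda>n. real (n - 2 - k) * p n) \<longlonglongrightarrow> r"
  proof -
    have "\<forall>\<^sub>F n in sequentially. (real (n - 2) - real k) * p n = real (n - 2 - k) * p n"
      using eventually_ge_at_top[of "k + 2"] by eventually_elim (simp add: of_nat_diff)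
    with shift[of k] show ?thesis by (rule Lim_transform_eventually)
  qed
  \<comment> \<open>The bound \<open>ln (1 - x) \<ge> - x - 2 x^2\<close> is available for
    \<open>x\<close> up to 1/2.\<close>
  have small: "\<forall>\<^sub>F n in sequentially. p n < 1 / 2"
    using order_tendstoD(2)[OF p0, of "1 / 2"] by simp
  have "(\<lambda>n. real (n - 2 - k) * ln (1 - p n)) \<longlonglongrightarrow> - r"
  proof (rule tendsto_sandwich)
    show "\<forall>\<^sub>F n in sequentially. - (real (n - 2 - k) * p n) - 2 * (real (n - 2 - k) * p n) * p n
        \<le> real (n - 2 - k) * ln (1 - p n)"
      using small
    proof eventually_elim
      case (elim n)
      then have "- p n - 2 * (p n)\<^sup>2 \<le> ln (1 - p n)"
        using p[of n] by (intro ln_one_minus_pos_lower_bound) auto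
      from mult_left_mono[OF this, of "real (n - 2 - k)"] show ?case
        by (simp add: algebra_simps power2_eq_square)
    qed
    show "\<forall>\<^sub>F n in sequentially. real (n - 2 - k) * ln (1 - p n) \<le> - (real (n - 2 - k) * p n)"
      using small
    proof eventually_elim
      case (elim n)
      then have "ln (1 - p n) \<le> - p n" using ln_le_minus_one[of "1 - p n"] by simp
      from mult_left_mono[OF this, of "real (n - 2 - k)"] show ?case by simp
    qed
    have "(\<lambda>n. - (real (n - 2 - k) * p n) - 2 * (real (n - 2 - k) * p n) * p n) \<longlonglongrightarrow> - r - 2 * r * 0"
      by (intro tendsto_intros shift' p0)
    then show "(\<lambda>n. - (real (n - 2 - k) * p n) - 2 * (real (n - 2 - k) * p n) * p n) \<longlonglongrightarrow> - r" by simp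
    show "(\<lambda>n. - (real (n - 2 - k) * p n)) \<longlonglongrightarrow> - r" by (intro tendsto_intros shift')
  qed
  then have "(\<lambda>n. exp (real (n - 2 - k) * ln (1 - p n))) \<longlonglongrightarrow> exp (- r)"
    by (rule tendsto_exp)
  moreover have "\<forall>\<^sub>F n in sequentially. exp (real (n - 2 - k) * ln (1 - p n)) = (1 - p n) ^ (n - 2 - k)"
    using small by eventually_elim (simp add: exp_of_nat_mult)
  ultimately have "(\<lambda>n. (1 - p n) ^ (n - 2 - k)) \<longlonglongrightarrow> exp (- r)"
    by (rule Lim_transform_eventually)
  from tendsto_mult[OF 1 this] show ?thesis .
qed

context
  fixes p :: "nat \<Rightarrow> real" and a b :: nat
  assumes ab: "a \<noteq> b" and p_range: "\<And>n. 0 < p n \<and> p n \<le> 1"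
begin

text \<open>For small \<open>n\<close> the set \<open>{a, b}\<close> is not a vertex pair and the
  conditioning event is null, so all estimates hold only eventually; the path counts ask for
  \<open>4 \<le> n\<close>.\<close>

lemma eventually_edge_gnp: "\<forall>\<^sub>F n in sequentially. edge_gnp n (p n) a b \<and> 4 \<le> n"
  using eventually_gt_at_top[of "max (max a b) 4"] ab p_range
  by (auto simp: edge_gnp_def elim!: eventually_mono)

lemma ricci_isolated:
  assumes "(\<lambda>n. real n * p n) \<longlonglongrightarrow> 0"
  shows "(\<lambda>n. measure_pmf.prob (gnp_edge n (p n) a b) {G. isolated_edge n G a b \<and> ricci n G a b = 0}) \<longlonglongrightarrow> 1"
proof (rule tendsto_sandwich)
  show "\<forall>\<^sub>F n in sequentially. 1 - 2 * (real n * p n) \<le>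
      measure_pmf.prob (gnp_edge n (p n) a b) {G. isolated_edge n G a b \<and> ricci n G a b = 0}"
    using eventually_edge_gnp by eventually_elim (auto intro: edge_gnp.prob_isolated)
  have "(\<lambda>n. 1 - 2 * (real n * p n)) \<longlonglongrightarrow> 1 - 2 * 0" by (intro tendsto_intros assms)
  then show "(\<lambda>n. 1 - 2 * (real n * p n)) \<longlonglongrightarrow> 1" by simp
qed auto

text \<open>The distribution functions converge at every \<open>t\<close>, continuity point or not,
  because the limit is a function of a pair of naturals whose probabilities converge on every
  set.\<close>

lemma ricci_poisson:
  assumes lim: "(\<lambda>n. real n * p n) \<longlonglongrightarrow> r" and r: "0 < r"
  shows "weak_conv_m (\<lambda>n. measure_pmf (map_pmf (\<lambda>G. ricci n G a b) (gnp_edge n (p n) a b)))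
    (measure_pmf (map_pmf poisson_limit (pair_pmf (poisson_pmf r) (poisson_pmf r))))"
  unfolding weak_conv_m_def weak_conv_def
proof (intro allI impI)
  fix t :: real
  define M where "M n = gnp_edge n (p n) a b" for n
  define d where "d n G = (card (nbrs n G a) - 1, card (nbrs n G b) - 1)" for n G
  define R where "R = pair_pmf (poisson_pmf r) (poisson_pmf r)"
  have inv_n: "(\<lambda>n. c / real n) \<longlonglongrightarrow> 0" for c by (rule tendsto_const_over_n)
  have "(\<lambda>n. pmf (map_pmf (d n) (M n)) x) \<longlonglongrightarrow> pmf R x" for x
  proof -
    obtain k l where x: "x = (k, l)" by force
    have "\<forall>\<^sub>F n in sequentially. (real (n - 2 choose k) * p n ^ k * (1 - p n) ^ (n - 2 - k))
        * (real (n - 2 choose l) * p n ^ l * (1 - p n) ^ (n - 2 - l)) = pmf (map_pmf (d n) (M n)) x"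
      using eventually_edge_gnp
    proof eventually_elim
      case (elim n)
      have "d n -` {x} = {G. card (nbrs n G a) - 1 = k \<and> card (nbrs n G b) - 1 = l}"
        by (auto simp: d_def x)
      then show ?case using edge_gnp.prob_degrees[of n "p n" a b k l] elim by (simp only: pmf_map M_def)
    qed
    moreover have "(\<lambda>n. (real (n - 2 choose k) * p n ^ k * (1 - p n) ^ (n - 2 - k))
        * (real (n - 2 choose l) * p n ^ l * (1 - p n) ^ (n - 2 - l))) \<longlonglongrightarrow> pmf R x"
      using tendsto_mult[OF binomial_tendsto_poisson[OF p_range lim] binomial_tendsto_poisson[OF p_range lim]] r
      by (simp add: x R_def pmf_pair)
    ultimately show ?thesis using tendsto_cong by force
  qed
  then have lim1: "(\<lambda>n. measure_pmf.prob (map_pmf (d n) (M n)) {x. poisson_limit x \<le> t})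
      \<longlonglongrightarrow> measure_pmf.prob R {x. poisson_limit x \<le> t}" by (rule tendsto_prob_nat_pair)
  define \<beta> where "\<beta> n = real n * (p n)\<^sup>2 + 2 * (real n)\<^sup>2 * p n ^ 3 + real n ^ 3 * p n ^ 4" for n
  have "\<beta> \<longlonglongrightarrow> 0"
  proof -
    \<comment> \<open>Each term of \<open>\<beta>\<close> is a power of the bounded quantity
      \<open>n p\<close>, divided by \<open>n\<close>.\<close>
    have "(\<lambda>n. (real n * p n)\<^sup>2 * (1 / real n) + 2 * (real n * p n) ^ 3 * (1 / real n) + (real n * p n) ^ 4 * (1 / real n))
        \<longlonglongrightarrow> r\<^sup>2 * 0 + 2 * r ^ 3 * 0 + r ^ 4 * 0"
      by (intro tendsto_intros lim inv_n)
    moreover have "\<forall>\<^sub>F n in sequentially. (real n * p n)\<^sup>2 * (1 / real n) + 2 * (real n * p n) ^ 3 * (1 / real n)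
        + (real n * p n) ^ 4 * (1 / real n) = \<beta> n"
      using eventually_gt_at_top[of 0]
      by eventually_elim (simp add: \<beta>_def power_mult_distrib eval_nat_numeral)
    ultimately show ?thesis using tendsto_cong by force
  qed
  have cdf1: "cdf (measure_pmf (map_pmf f N)) t = measure_pmf.prob N {x. f x \<le> t}" for f and N :: "'z pmf"
    by (simp add: cdf_def vimage_def)
  have "(\<lambda>n. measure_pmf.prob (M n) {G. ricci n G a b \<le> t} - measure_pmf.prob (map_pmf (d n) (M n)) {x. poisson_limit x \<le> t}) \<longlonglongrightarrow> 0"
  \<comment> \<open>The two events live on the same graph and differ only where the edge fails to
    obey the tree formula.\<close>
  proof (rule Lim_null_comparison[OF _ \<open>\<beta> \<longlonglongrightarrow> 0\<close>])
    show "\<forall>\<^sub>F n in sequentially. norm (measure_pmf.prob (M n) {G. ricci n G a b \<le> t}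
      - measure_pmf.prob (map_pmf (d n) (M n)) {x. poisson_limit x \<le> t}) \<le> \<beta> n"
      using eventually_edge_gnp
    proof eventually_elim
      case (elim n)
      let ?P = "measure_pmf.prob (M n)"
      let ?K = "{G. ricci n G a b \<le> t}" and ?L = "{G. poisson_limit (d n G) \<le> t}"
        and ?N = "{G. ricci n G a b \<noteq> poisson_limit (d n G)}"
      have "measure_pmf.prob (map_pmf (d n) (M n)) {x. poisson_limit x \<le> t} = ?P ?L"
        by (simp add: vimage_def)
      moreover have "?P ?K \<le> ?P (?L \<union> ?N)" "?P ?L \<le> ?P (?K \<union> ?N)"
        by (intro measure_pmf.finite_measure_mono; auto)+
      moreover have "?P (?L \<union> ?N) \<le> ?P ?L + ?P ?N" "?P (?K \<union> ?N) \<le> ?P ?K + ?P ?N"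
        by (intro measure_Un_le; auto)+
      moreover have "?P ?N \<le> \<beta> n"
        using edge_gnp.prob_not_tree_like[of n "p n" a b] elim by (simp add: M_def d_def \<beta>_def)
      ultimately show ?case by simp
    qed
  qed
  from tendsto_add[OF this lim1]
  show "(\<lambda>n. cdf (measure_pmf (map_pmf (\<lambda>G. ricci n G a b) (gnp_edge n (p n) a b))) t)
    \<longlonglongrightarrow> cdf (measure_pmf (map_pmf poisson_limit (pair_pmf (poisson_pmf r) (poisson_pmf r)))) t"
    by (simp add: cdf1 M_def R_def)
qed

lemma ricci_sparse:
  assumes np: "filterlim (\<lambda>n. real n * p n) at_top sequentially"
    and n2p3: "(\<lambda>n. (real n)\<^sup>2 * p n ^ 3) \<longlonglongrightarrow> 0"
  shows "conv_in_prob (\<lambda>n. gnp_edge n (p n) a b) (\<lambda>n G. ricci n G a b) (- 2)"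
proof (rule conv_in_prob_if_L1)
  let ?deg = "\<lambda>n. 2 * sqrt (1 / (real n * p n) + 4 / real n) + 1 / (real n * p n)"
  let ?\<beta> = "\<lambda>n. 3 * (p n + 2 * real n * (p n)\<^sup>2 + (real n)\<^sup>2 * p n ^ 3 + 2 / (real n * p n) + 2 * ?deg n)"
  show "\<forall>\<^sub>F n in sequentially. finite (set_pmf (gnp_edge n (p n) a b)) \<and>
      measure_pmf.expectation (gnp_edge n (p n) a b) (\<lambda>G. \<bar>ricci n G a b - - 2\<bar>) \<le> ?\<beta> n"
    using eventually_edge_gnp
  proof eventually_elim
    case (elim n)
    then interpret edge_gnp n "p n" a b by simp
    show ?case using expectation_ricci_sparse by (simp add: deg_err_def)
  qed
  \<comment> \<open>Dividing \<open>n^2 p^3\<close> by \<open>n p\<close> once gives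
    \<open>n p^2\<close>, twice gives \<open>p\<close>; both therefore vanish.\<close>
  have "(\<lambda>n. (real n)\<^sup>2 * p n ^ 3 * (1 / (real n * p n))) \<longlonglongrightarrow> 0 * 0"
    by (intro tendsto_mult n2p3 tendsto_const_over_at_top np)
  moreover have "\<forall>\<^sub>F n in sequentially. (real n)\<^sup>2 * p n ^ 3 * (1 / (real n * p n)) = real n * (p n)\<^sup>2"
    using eventually_gt_at_top[of 0] by eventually_elim (use p_range in \<open>auto simp: field_simps eval_nat_numeral less_imp_neq\<close>)
  ultimately have np2: "(\<lambda>n. real n * (p n)\<^sup>2) \<longlonglongrightarrow> 0" using tendsto_cong by force
  have "(\<lambda>n. real n * (p n)\<^sup>2 * (1 / (real n * p n))) \<longlonglongrightarrow> 0 * 0"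
    by (intro tendsto_mult np2 tendsto_const_over_at_top np)
  moreover have "\<forall>\<^sub>F n in sequentially. real n * (p n)\<^sup>2 * (1 / (real n * p n)) = p n"
    using eventually_gt_at_top[of 0] by eventually_elim (use p_range in \<open>auto simp: field_simps eval_nat_numeral less_imp_neq\<close>)
  ultimately have p0: "p \<longlonglongrightarrow> 0" using tendsto_cong by force
  show "?\<beta> \<longlonglongrightarrow> 0"
    by (intro tendsto_mult_right_zero tendsto_add_zero p0 n2p3 tendsto_const_over_at_top np
        deg_err_tendsto tendsto_mult_right_zero[OF np2, of 2, folded mult.assoc])
qed

lemma ricci_middle:
  assumes n2p3: "filterlim (\<lambda>n. (real n)\<^sup>2 * p n ^ 3) at_top sequentially"
    and np2: "(\<lambda>n. real n * (p n)\<^sup>2) \<longlonglongrightarrow> 0"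
  shows "conv_in_prob (\<lambda>n. gnp_edge n (p n) a b) (\<lambda>n G. ricci n G a b) (- 1)"
proof (rule conv_in_prob_if_L1)
  let ?deg = "\<lambda>n. 2 * sqrt (1 / (real n * p n) + 4 / real n) + 1 / (real n * p n)"
  let ?path = "\<lambda>n. sqrt (2 / (real n * p n) + 1 / ((real n)\<^sup>2 * p n ^ 3) + 1 / ((real n)\<^sup>2 * p n) + 14 / real n)"
  let ?\<beta> = "\<lambda>n. 2 * (p n + real n * (p n)\<^sup>2 + 2 / (real n * p n) + 2 * ?deg n)
    + 5 * (2 * (1 / (real n * p n) + 2 * ?path n) + 2 * ?deg n)"
  show "\<forall>\<^sub>F n in sequentially. finite (set_pmf (gnp_edge n (p n) a b)) \<and>
      measure_pmf.expectation (gnp_edge n (p n) a b) (\<lambda>G. \<bar>ricci n G a b - - 1\<bar>) \<le> ?\<beta> n"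
    using eventually_edge_gnp
  proof eventually_elim
    case (elim n)
    then interpret edge_gnp n "p n" a b by simp
    show ?case using expectation_ricci_middle elim by (simp add: deg_err_def path_err_def)
  qed
  \<comment> \<open>Once \<open>n p^2 < 1\<close>, the diverging
    \<open>n^2 p^3 = (n p) (n p^2)\<close> is at most \<open>n p\<close>.\<close>
  have np: "filterlim (\<lambda>n. real n * p n) at_top sequentially"
  proof (rule filterlim_at_top_mono[OF n2p3])
    show "\<forall>\<^sub>F n in sequentially. (real n)\<^sup>2 * p n ^ 3 \<le> real n * p n"
      using order_tendstoD(2)[OF np2, of 1, simplified]
    proof eventually_elim
      case (elim n)
      have "(real n)\<^sup>2 * p n ^ 3 = (real n * p n) * (real n * (p n)\<^sup>2)" by algebra
      also have "\<dots> \<le> (real n * p n) * 1" using elim p_range[of n] by (intro mult_left_mono) auto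
      finally show ?case by simp
    qed
  qed
  have n2p: "filterlim (\<lambda>n. (real n)\<^sup>2 * p n) at_top sequentially"
  proof (rule filterlim_at_top_mono[OF n2p3], rule always_eventually, rule allI)
    fix n
    have "p n ^ 3 \<le> p n ^ 1" using p_range[of n] by (intro power_decreasing) auto
    then show "(real n)\<^sup>2 * p n ^ 3 \<le> (real n)\<^sup>2 * p n" by (intro mult_left_mono) auto
  qed
  have "(\<lambda>n. real n * (p n)\<^sup>2 * (1 / (real n * p n))) \<longlonglongrightarrow> 0 * 0"
    by (intro tendsto_mult np2 tendsto_const_over_at_top np)
  moreover have "\<forall>\<^sub>F n in sequentially. real n * (p n)\<^sup>2 * (1 / (real n * p n)) = p n"
    using eventually_gt_at_top[of 0] by eventually_elim (use p_range in \<open>auto simp: field_simps eval_nat_numeral less_imp_neq\<close>)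
  ultimately have p0: "p \<longlonglongrightarrow> 0" using tendsto_cong by force
  show "?\<beta> \<longlonglongrightarrow> 0"
    by (intro tendsto_mult_right_zero tendsto_add_zero p0 np2 tendsto_const_over_at_top np n2p3 n2p
        deg_err_tendsto tendsto_sqrt_zero tendsto_const_over_n)
qed

text \<open>Serves both the regime \<open>p \<longlonglongrightarrow> 0\<close>, with
  \<open>q = 0\<close>, and that of a limit strictly between 0 and 1; \<open>q < 1\<close> keeps
  \<open>1 - p\<close> away from 0, so \<open>n p^2 (1 - p)\<close> diverges.\<close>

lemma ricci_dense:
  assumes np2: "filterlim (\<lambda>n. real n * (p n)\<^sup>2) at_top sequentially"
    and q: "p \<longlonglongrightarrow> q" "q < 1"
  shows "conv_in_prob (\<lambda>n. gnp_edge n (p n) a b) (\<lambda>n G. ricci n G a b) q"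
proof (rule conv_in_prob_if_L1)
  let ?deg = "\<lambda>n. 2 * sqrt (1 / (real n * p n) + 4 / real n) + 1 / (real n * p n)"
  let ?edge = "\<lambda>n. sqrt (1 / (real n * ((p n)\<^sup>2 * (1 - p n))) + 6 / real n)"
  let ?\<beta> = "\<lambda>n. (2 * sqrt (1 / (real n * (p n)\<^sup>2) + 4 / real n)
    + 4 * (2 * (1 / (real n * p n) + 2 * ?edge n) + 2 * ?deg n)) + \<bar>p n - q\<bar>"
  show "\<forall>\<^sub>F n in sequentially. finite (set_pmf (gnp_edge n (p n) a b)) \<and>
      measure_pmf.expectation (gnp_edge n (p n) a b) (\<lambda>G. \<bar>ricci n G a b - q\<bar>) \<le> ?\<beta> n"
    using eventually_edge_gnp order_tendstoD(2)[OF q]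
  proof eventually_elim
    case (elim n)
    then interpret edge_gnp n "p n" a b by simp
    have "expec (\<lambda>G. \<bar>ricci n G a b - q\<bar>) \<le> expec (\<lambda>G. \<bar>ricci n G a b - p n\<bar> + \<bar>p n - q\<bar>)"
      by (intro expectation_mono_pmf finite_P) auto
    also have "\<dots> = expec (\<lambda>G. \<bar>ricci n G a b - p n\<bar>) + \<bar>p n - q\<bar>" by simp
    also have "\<dots> \<le> ?\<beta> n"
      using expectation_ricci_dense elim by (intro add_right_mono) (simp add: deg_err_def edge_err_def)
    finally show ?case by simp
  qed
  have np: "filterlim (\<lambda>n. real n * p n) at_top sequentially"
  proof (rule filterlim_at_top_mono[OF np2], rule always_eventually, rule allI)
    fix n
    have "(p n)\<^sup>2 \<le> p n ^ 1" using p_range[of n] by (intro power_decreasing) auto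
    then show "real n * (p n)\<^sup>2 \<le> real n * p n" by (intro mult_left_mono) auto
  qed
  have "(\<lambda>n. 1 - p n) \<longlonglongrightarrow> 1 - q" by (intro tendsto_intros q)
  then have "filterlim (\<lambda>n. (1 - p n) * (real n * (p n)\<^sup>2)) at_top sequentially"
    using q by (intro filterlim_tendsto_pos_mult_at_top[OF _ _ np2]) auto
  then have edge: "filterlim (\<lambda>n. real n * ((p n)\<^sup>2 * (1 - p n))) at_top sequentially"
    by (simp add: mult_ac)
  have "(\<lambda>n. \<bar>p n - q\<bar>) \<longlonglongrightarrow> 0" using q(1) by (simp add: LIM_zero_iff tendsto_rabs_zero_iff)
  then show "?\<beta> \<longlonglongrightarrow> 0"
    by (intro tendsto_mult_right_zero tendsto_add_zero tendsto_const_over_at_top np np2 edge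
        deg_err_tendsto tendsto_sqrt_zero tendsto_const_over_n)
qed

end

theorem theorem5p6:
  fixes p :: "nat \<Rightarrow> real" and a b :: nat
  assumes ab: "a \<noteq> b"
    and p_range: "\<And>n. 0 < p n \<and> p n \<le> 1"
  defines "K \<equiv> (\<lambda>n G. ricci n G a b)"
    and "M \<equiv> (\<lambda>n. gnp_edge n (p n) a b)"
  shows
    "((\<lambda>n. real n * p n) \<longlonglongrightarrow> 0 \<longrightarrow>
        (\<lambda>n. measure_pmf.prob (M n) {G. isolated_edge n G a b \<and> K n G = 0}) \<longlonglongrightarrow> 1)
   \<and> (\<forall>r::real. 0 < r \<longrightarrow> (\<lambda>n. real n * p n) \<longlonglongrightarrow> r \<longrightarrow>
        weak_conv_m (\<lambda>n. measure_pmf (map_pmf (K n) (M n)))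
          (measure_pmf (map_pmf poisson_limit (pair_pmf (poisson_pmf r) (poisson_pmf r)))))
   \<and> (filterlim (\<lambda>n. real n * p n) at_top sequentially \<and>
        (\<lambda>n. (real n)^2 * (p n)^3) \<longlonglongrightarrow> 0 \<longrightarrow> conv_in_prob M K (-2))
   \<and> (filterlim (\<lambda>n. (real n)^2 * (p n)^3) at_top sequentially \<and>
        (\<lambda>n. real n * (p n)^2) \<longlonglongrightarrow> 0 \<longrightarrow> conv_in_prob M K (-1))
   \<and> (filterlim (\<lambda>n. real n * (p n)^2) at_top sequentially \<and>
        p \<longlonglongrightarrow> 0 \<longrightarrow> conv_in_prob M K 0)
   \<and> (\<forall>q::real. 0 < q \<and> q < 1 \<and> p \<longlonglongrightarrow> q \<longrightarrow> conv_in_prob M K q)"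
proof -
  \<comment> \<open>A positive limit of \<open>p\<close> forces the divergence that
    \<open>ricci_dense\<close> asks for.\<close>
  have np2: "filterlim (\<lambda>n. real n * (p n)\<^sup>2) at_top sequentially" if "0 < q" "p \<longlonglongrightarrow> q" for q
  proof -
    have "(\<lambda>n. (p n)\<^sup>2) \<longlonglongrightarrow> q\<^sup>2" by (intro tendsto_intros that)
    then have "filterlim (\<lambda>n. (p n)\<^sup>2 * real n) at_top sequentially"
      by (rule filterlim_tendsto_pos_mult_at_top[OF _ _ filterlim_real_sequentially]) (use that in simp)
    then show ?thesis by (simp add: mult.commute)
  qed
  show ?thesis
    unfolding K_def M_def
    using ricci_isolated[OF ab p_range] ricci_poisson[OF ab p_range] ricci_sparse[OF ab p_range]
      ricci_middle[OF ab p_range] ricci_dense[OF ab p_range] np2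
    by (intro conjI allI impI) (auto intro: ricci_dense[OF ab p_range])
qed

end
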